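(* Let $\omega\in\mathscr P_Q^0(\mathbf C^d)$ be dilated suitable, and let $\mathscr B$ be a mixed quasi-norm space on $\mathbf C^d$ such that $\nu_2(\mathscr B)<\infty$. Then the following is true: (1) $P(\mathbf C^d)$ is dense in $A(\omega,\mathscr B)$. If in addition $\nu_1(\mathscr B)\ge1$, then $P(\mathbf C^d)$ is dense in $A(\omega,\mathscr B')$ with respect to the weak$^*$-topology; (2) if $F\in A(\omega,\mathscr B)$, then $F(\lambda\,\cdot)\to F$ in $A(\omega,\mathscr B)$ as $\lambda\to1-$ ($0<\lambda<1$). If in addition $\nu_1(\mathscr B)\ge1$ and $G\in A(\omega,\mathscr B')$, then $G(\lambda\,\cdot)\to G$ with respect to the weak$^*$-topology in $A(\omega,\mathscr B')$ as $\lambda\to1-$.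
   Context: Identify $\mathbf R^{2d}\simeq\mathbf C^d$ via $(x,\xi)\leftrightarrow x+i\xi$. Weights. A weight on $\mathbf R^n$ is a positive function $\omega\in L^\infty_{loc}(\mathbf R^n)$ bounded below by a positive constant on each compact set. $\mathscr P_Q^0(\mathbf R^n)$ is the set of weights $\omega$ such that (i) there are $c,C>0$ with $C^{-1}\omega(x)^2\le\omega(x+y)\omega(x-y)\le C\omega(x)^2$ whenever $|x|\ge 2c$ and $|y|\le c/|x|$; (ii) for every $c>0$ there is $C>0$ with $C^{-1}e^{-c|x|^2}\le\omega(x)\le Ce^{c|x|^2}$ for all $x$. $\mathscr P_Q^0(\mathbf C^d)=\mathscr P_Q^0(\mathbf R^{2d})$. A weight $\omega\in\mathscr P_Q^0(\mathbf R^n)$ is dilated suitable with respect to $\varepsilon\in(0,1]$ if there are $C_\varepsilon>0$ and $\theta_\varepsilon\in(0,1)$ such that $\omega(2^{1/2}x)e^{-\varepsilon(1-\lambda^2)|x|^2/2}\le C_\varepsilon\,\omega(2^{1/2}\lambda x)$ for all $x\in\mathbf R^n$ and $1-\theta_\varepsilon<\lambda<1$. "Dilated suitable" without mention of $\varepsilon$ means with respect to some $\varepsilon\in(0,1]$ (equivalently $\varepsilon=1$). Mixed quasi-norm spaces. A mixed quasi-norm space on $\mathbf R^n$ is $\mathscr B=L^p(V)$, where $V=(V_1,\dots,V_m)$ are vector subspaces with $V_1\oplus\cdots\oplus V_m=\mathbf R^n$ and $p=(p_1,\dots,p_m)\in(0,\infty]^m$; $\|f\|_{\mathscr B}$ is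 obtained by writing $f=f(x_1,\dots,x_m)$, $x_j\in V_j$, and taking successively the $L^{p_1}(V_1)$ quasi-norm in $x_1$, ..., and finally the $L^{p_m}(V_m)$ quasi-norm in $x_m$. $\nu_1(\mathscr B)=\min_jp_j$, $\nu_2(\mathscr B)=\max_jp_j$; if $\nu_1(\mathscr B)\ge1$, then $\mathscr B'=L^{p'}(V)$ with $p'=(p_1',\dots,p_m')$ the conjugate exponents. Spaces of analytic functions. For measurable $F$ on $\mathbf C^d$, $\|F\|_{B(\omega,\mathscr B)}=\|G\,\omega\|_{\mathscr B}$, where $G(x,\xi)=(2\pi)^{-d/2}e^{-(|x|^2+|\xi|^2)/4}e^{-i\langle x,\xi\rangle/2}F(2^{-1/2}x-i2^{-1/2}\xi)$. $A(\omega,\mathscr B)$ is the space of entire functions $F$ on $\mathbf C^d$ with $\|F\|_{A(\omega,\mathscr B)}=\|F\|_{B(\omega,\mathscr B)}<\infty$. $P(\mathbf C^d)$ is the set of (analytic) polynomials on $\mathbf C^d$. The weak$^*$-topology on $A(\omega,\mathscr B')$ is the one generated by the functionals $G\mapsto(G,F)_{A^2}=\int_{\mathbf C^d}G(z)\overline{F(z)}\,d\mu(z)$, $F\in A(1/\omega,\mathscr B)$, where $d\mu(z)=\pi^{-d}e^{-|z|^2}d\lambda(z)$ and $d\lambda$ is Lebesgue measure. *)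

theory Defs
  imports "HOL-Analysis.Analysis" "HOL-Probability.Essential_Supremum"
begin

text \<open>
  The space \<open>C\<^sup>d\<close> is the type \<open>complex^'d\<close>, which is a Euclidean space over the reals of
  dimension \<open>2d\<close>; its norm, its real subspaces and its Lebesgue measure are those of \<open>R\<^sup>2\<^sup>d\<close>
  under \<open>x + i\<xi> \<leftrightarrow> (x, \<xi>)\<close>.  Weights and mixed quasi-norms are therefore defined on an
  arbitrary Euclidean space.
\<close>

section \<open>Weights\<close>

definition weight :: "('a::euclidean_space \<Rightarrow> real) \<Rightarrow> bool" where
  "weight \<omega> \<longleftrightarrow>
     (\<forall>x. 0 < \<omega> x) \<and>
     \<omega> \<in> borel_measurable lebesgue \<and>
     (\<forall>K. compact K \<longrightarrow> (\<exists>C. AE x in lebesgue. x \<in> K \<longrightarrow> \<omega> x \<le> C)) \<and>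
     (\<forall>K. compact K \<longrightarrow> (\<exists>c>0. \<forall>x\<in>K. c \<le> \<omega> x))"

definition PQ0 :: "('a::euclidean_space \<Rightarrow> real) set" where
  "PQ0 = {\<omega>. weight \<omega> \<and>
     (\<exists>c>0. \<exists>C>0. \<forall>x y. norm x \<ge> 2 * c \<and> norm y \<le> c / norm x \<longrightarrow>
        inverse C * (\<omega> x)\<^sup>2 \<le> \<omega> (x + y) * \<omega> (x - y) \<and>
        \<omega> (x + y) * \<omega> (x - y) \<le> C * (\<omega> x)\<^sup>2) \<and>
     (\<forall>c>0. \<exists>C>0. \<forall>x.
        inverse C * exp (- c * (norm x)\<^sup>2) \<le> \<omega> x \<and> \<omega> x \<le> C * exp (c * (norm x)\<^sup>2))}"

definition dilated_suitable_wrt :: "real \<Rightarrow> ('a::euclidean_space \<Rightarrow> real) \<Rightarrow> bool" where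
  "dilated_suitable_wrt \<epsilon> \<omega> \<longleftrightarrow>
     (\<exists>C>0. \<exists>\<theta>\<in>{0<..<1}. \<forall>x. \<forall>r\<in>{1 - \<theta><..<1}.
        \<omega> (sqrt 2 *\<^sub>R x) * exp (- \<epsilon> * (1 - r\<^sup>2) * (norm x)\<^sup>2 / 2)
          \<le> C * \<omega> ((sqrt 2 * r) *\<^sub>R x))"

definition dilated_suitable :: "('a::euclidean_space \<Rightarrow> real) \<Rightarrow> bool" where
  "dilated_suitable \<omega> \<longleftrightarrow> (\<exists>\<epsilon>\<in>{0<..1}. dilated_suitable_wrt \<epsilon> \<omega>)"

section \<open>Mixed quasi-norm spaces\<close>

text \<open>
  Lebesgue measure on a subspace \<open>V\<close>, as a measure on the ambient space for which the
  complement of \<open>V\<close> is null: the image of Lebesgue measure on coordinates with respect to an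
  orthonormal basis of \<open>V\<close> (compare the definition of \<open>lborel\<close>).  It does not depend on the
  chosen basis.  The measure is completed because weights are only assumed Lebesgue
  measurable, and \<open>esssup\<close> is \<open>\<infinity>\<close> on non-measurable functions.  For \<open>V = {0}\<close> it is the unit
  mass at \<open>0\<close>.
\<close>

definition orthonormal_basis_of :: "'a::euclidean_space set \<Rightarrow> 'a set \<Rightarrow> bool" where
  "orthonormal_basis_of V E \<longleftrightarrow>
     finite E \<and> pairwise orthogonal E \<and> (\<forall>e\<in>E. norm e = 1) \<and> span E = V"

lemma orthonormal_basis_of_exists:
  assumes "subspace V"
  shows "\<exists>E. orthonormal_basis_of V E"
proof -
  obtain E where "pairwise orthogonal E" "\<And>x. x \<in> E \<Longrightarrow> norm x = 1" "independent E" "span E = V"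
    using orthonormal_basis_subspace[OF assms] by metis
  then have "orthonormal_basis_of V E"
    using independent_imp_finite by (simp add: orthonormal_basis_of_def)
  then show ?thesis ..
qed

definition lebesgue_subspace :: "'a::euclidean_space set \<Rightarrow> 'a measure" where
  "lebesgue_subspace V =
     (let E = (SOME E. orthonormal_basis_of V E)
      in completion (distr (\<Pi>\<^sub>M e\<in>E. lborel) borel (\<lambda>t. \<Sum>e\<in>E. t e *\<^sub>R e)))"

text \<open>Powers of extended nonnegative reals with exponent in \<open>(0,\<infinity>)\<close>.\<close>

definition ennpow :: "ennreal \<Rightarrow> real \<Rightarrow> ennreal" where
  "ennpow x r = (if x = \<infinity> then \<infinity> else ennreal (enn2real x powr r))"

definition Lp_qnorm :: "ennreal \<Rightarrow> 'a measure \<Rightarrow> ('a \<Rightarrow> ennreal) \<Rightarrow> ennreal" where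
  "Lp_qnorm p M f =
     (if p = \<infinity> then esssup M f
      else ennpow (\<integral>\<^sup>+x. ennpow (f x) (enn2real p) \<partial>M) (1 / enn2real p))"

text \<open>The list \<open>[(V\<^sub>1, p\<^sub>1), \<dots>, (V\<^sub>m, p\<^sub>m)]\<close> represents \<open>L\<^sup>p(V)\<close>.\<close>

type_synonym 'a mixed_space = "('a set \<times> ennreal) list"

definition is_mixed_space :: "'a::euclidean_space mixed_space \<Rightarrow> bool" where
  "is_mixed_space B \<longleftrightarrow>
     (\<forall>(V, p)\<in>set B. subspace V \<and> 0 < p) \<and>
     (\<forall>x. \<exists>!xs. length xs = length B \<and> (\<forall>j<length B. xs ! j \<in> fst (B ! j)) \<and> sum_list xs = x)"

text \<open>
  The argument \<open>f\<close> plays the role of \<open>|f|\<close>.  The recursion first takes the norm in \<open>x\<^sub>1 \<in> V\<^sub>1\<close>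
  of \<open>x\<^sub>1 \<mapsto> f (x\<^sub>1 + y)\<close>, where \<open>y = x\<^sub>2 + \<dots> + x\<^sub>m\<close>, and continues with the resulting
  function of \<open>y\<close>; no variable is left in the base case.
\<close>

fun mixed_qnorm :: "'a::euclidean_space mixed_space \<Rightarrow> ('a \<Rightarrow> ennreal) \<Rightarrow> ennreal" where
  "mixed_qnorm [] f = f 0"
| "mixed_qnorm ((V, p) # B) f =
     mixed_qnorm B (\<lambda>y. Lp_qnorm p (lebesgue_subspace V) (\<lambda>x. f (x + y)))"

definition nu1 :: "'a mixed_space \<Rightarrow> ennreal" where
  "nu1 B = Min (snd ` set B)"

definition nu2 :: "'a mixed_space \<Rightarrow> ennreal" where
  "nu2 B = Max (snd ` set B)"

text \<open>
  For \<open>1 \<le> p \<le> \<infinity>\<close> this is the solution of \<open>1/p + 1/p' = 1\<close>, with \<open>1/\<infinity> = 0\<close> and \<open>1/0 = \<infinity>\<close>.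
\<close>

definition conj_exponent :: "ennreal \<Rightarrow> ennreal" where
  "conj_exponent p = inverse (1 - inverse p)"

definition dual_space :: "'a mixed_space \<Rightarrow> 'a mixed_space" where
  "dual_space B = map (\<lambda>(V, p). (V, conj_exponent p)) B"

section \<open>Spaces of entire functions\<close>

text \<open>Entire: complex differentiable at every point, that is, with complex linear derivative.\<close>

definition entire :: "(complex^'d \<Rightarrow> complex) \<Rightarrow> bool" where
  "entire F \<longleftrightarrow>
     (\<forall>z. \<exists>D. (F has_derivative D) (at z) \<and> (\<forall>c v. D (c *s v) = c * D v))"

definition polynomials :: "(complex^'d \<Rightarrow> complex) set" where
  "polynomials =
     {F. \<exists>S (c :: ('d \<Rightarrow> nat) \<Rightarrow> complex). finite S \<and>
           F = (\<lambda>z. \<Sum>\<alpha>\<in>S. c \<alpha> * (\<Prod>j\<in>UNIV. (z $ j) ^ \<alpha> j))}"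

definition Re_vec :: "complex^'d \<Rightarrow> real^'d" where
  "Re_vec z = (\<chi> j. Re (z $ j))"

definition Im_vec :: "complex^'d \<Rightarrow> real^'d" where
  "Im_vec z = (\<chi> j. Im (z $ j))"

text \<open>The function \<open>G(x, \<xi>)\<close> associated with \<open>F\<close>, at the point \<open>x + i\<xi>\<close>.\<close>

definition bargmann_factor :: "(complex^'d \<Rightarrow> complex) \<Rightarrow> complex^'d \<Rightarrow> complex" where
  "bargmann_factor F z =
     (let x = Re_vec z; \<xi> = Im_vec z in
        of_real ((2 * pi) powr (- real CARD('d) / 2) * exp (- ((norm x)\<^sup>2 + (norm \<xi>)\<^sup>2) / 4)) *
        exp (- \<i> * of_real (x \<bullet> \<xi>) / 2) *
        F (\<chi> j. of_real (x $ j / sqrt 2) - \<i> * of_real (\<xi> $ j / sqrt 2)))"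

definition A_qnorm ::
  "(complex^'d \<Rightarrow> real) \<Rightarrow> (complex^'d) mixed_space \<Rightarrow> (complex^'d \<Rightarrow> complex) \<Rightarrow> ennreal" where
  "A_qnorm \<omega> B F = mixed_qnorm B (\<lambda>z. ennreal (cmod (bargmann_factor F z * of_real (\<omega> z))))"

definition A_space ::
  "(complex^'d \<Rightarrow> real) \<Rightarrow> (complex^'d) mixed_space \<Rightarrow> (complex^'d \<Rightarrow> complex) set" where
  "A_space \<omega> B = {F. entire F \<and> A_qnorm \<omega> B F < \<infinity>}"

definition gauss_measure :: "(complex^'d) measure" where
  "gauss_measure =
     density lborel (\<lambda>z. ennreal (pi powr (- real CARD('d)) * exp (- (norm z)\<^sup>2)))"

definition A2_pairing :: "(complex^'d \<Rightarrow> complex) \<Rightarrow> (complex^'d \<Rightarrow> complex) \<Rightarrow> complex" where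
  "A2_pairing G F = (LINT z|gauss_measure. G z * cnj (F z))"

text \<open>
  The weak* topology on \<open>A(\<omega>, B')\<close>, for \<open>B\<close> with exponents at least \<open>1\<close>: the coarsest one for
  which all \<open>G \<mapsto> (G, F)\<close> with \<open>F \<in> A(1/\<omega>, B)\<close> are continuous.
\<close>

definition weak_star ::
  "(complex^'d \<Rightarrow> real) \<Rightarrow> (complex^'d) mixed_space \<Rightarrow> (complex^'d \<Rightarrow> complex) topology" where
  "weak_star \<omega> B = topology_generated_by
     {{G \<in> A_space \<omega> (dual_space B). A2_pairing G F \<in> U} | F U.
        F \<in> A_space (\<lambda>z. 1 / \<omega> z) B \<and> open U}"

lemma mixed_qnorm_zero:
  assumes "\<forall>(V, p)\<in>set B. 0 < p"
  shows "mixed_qnorm B (\<lambda>_. 0) = 0"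
  using assms
proof (induction B)
  case (Cons a B)
  obtain V p where a: "a = (V, p)" by force
  have "esssup M (\<lambda>_. 0::ennreal) = 0" for M :: "'a measure"
  proof -
    have "esssup M (\<lambda>_. 0::ennreal) = Inf {z. AE x in M. (0::ennreal) \<le> z}"
      by (rule esssup_eq_AE) simp
    then show ?thesis by (simp flip: bot_ennreal)
  qed
  then have "Lp_qnorm p (lebesgue_subspace V) (\<lambda>_. 0) = 0"
    by (auto simp: Lp_qnorm_def ennpow_def)
  then show ?case using Cons a by simp
qed simp

lemma topspace_weak_star:
  fixes \<omega> :: "complex^'d \<Rightarrow> real"
  assumes "is_mixed_space B"
  shows "topspace (weak_star \<omega> B) = A_space \<omega> (dual_space B)"
proof -
  have "mixed_qnorm B (\<lambda>_. 0) = 0"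
    using assms by (intro mixed_qnorm_zero) (auto simp: is_mixed_space_def)
  then have "A_qnorm (\<lambda>z. 1 / \<omega> z) B (\<lambda>_. 0) = 0"
    by (simp add: A_qnorm_def bargmann_factor_def Let_def)
  moreover have "entire (\<lambda>_::complex^'d. 0)"
    unfolding entire_def by (auto intro!: exI[of _ "\<lambda>_. 0"])
  ultimately have "(\<lambda>_. 0) \<in> A_space (\<lambda>z. 1 / \<omega> z) B"
    by (simp add: A_space_def)
  then have "A_space \<omega> (dual_space B) \<in>
      {{G \<in> A_space \<omega> (dual_space B). A2_pairing G F \<in> U} | F U.
        F \<in> A_space (\<lambda>z. 1 / \<omega> z) B \<and> open U}"
    by (intro CollectI exI[of _ "\<lambda>_. 0"] exI[of _ UNIV]) simp
  then show ?thesis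
    unfolding weak_star_def topology_generated_by_topspace by blast
qed

end

theory Submission
  imports Defs "HOL-Probability.Distributions" "HOL-Complex_Analysis.Cauchy_Integral_Formula"
begin

text \<open>
  Write \<open>F\<^sub>r = F(r \<cdot>)\<close> for \<open>0 < r < 1\<close>, and let \<open>h(z)\<close> be the modulus of the Bargmann factor of \<open>F\<close> times
  the weight, so that the norm of \<open>F\<close> is the mixed quasi-norm of \<open>h\<close>.  The proof has two halves, which
  are joined by \<open>F \<approx> F\<^sub>r \<approx>\<close> polynomial.

  Convergence \<open>F\<^sub>r \<rightarrow> F\<close>.  Dilated suitability yields that the function \<open>h\<^sub>r\<close> belonging to \<open>F\<^sub>r\<close>
  satisfies \<open>h\<^sub>r(z) \<le> C h(r z)\<close>, with \<open>C\<close> independent of \<open>r\<close> near \<open>1\<close> (\<open>profile_dilation\<close>).  Outside a large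
  ball the norm of \<open>F\<^sub>r - F\<close> is therefore at most a constant times that of \<open>h\<close> outside a ball of
  half the radius (\<open>dilation_tail_bound\<close>), which is small by dominated convergence when all exponents
  are finite.  On a fixed ball \<open>F\<^sub>r \<rightarrow> F\<close> uniformly (\<open>dilation_converges_on_ball\<close>).  The weak*
  statement is proved in the same way, after the Gaussian pairing has been bounded by Hoelder's
  inequality (\<open>pairing_bound\<close>); there the exponents of the dual space may be infinite, and it is the
  test function, whose exponents are finite, that makes the tail small.

  Approximation of \<open>F\<^sub>r\<close>.  A finite norm forces \<open>|F(w)| \<le> M exp ((1/2 + \<epsilon>) |w|\<^sup>2)\<close> for every
  \<open>\<epsilon> > 0\<close> (\<open>A_space_growth\<close>).  Let \<open>F = \<Sum>\<^sub>n P\<^sub>n\<close> be the expansion into homogeneous parts.  Cauchy's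
  estimate on the circle of radius \<open>\<rho>\<close>, with \<open>r < \<rho> < 1\<close>, in the complex line through \<open>w\<close> bounds
  \<open>F\<^sub>r - \<Sum>\<^sub>n\<^sub><\<^sub>N r\<^sup>n P\<^sub>n\<close> at \<open>w\<close> by \<open>(r/\<rho>)\<^sup>N\<close> times a constant times \<open>exp ((1/2 + \<epsilon>) \<rho>\<^sup>2 |w|\<^sup>2)\<close>.  For small
  \<open>\<epsilon>\<close> the coefficient of \<open>|w|\<^sup>2\<close> is below \<open>1/2\<close>, so that after multiplication by the factor
  \<open>exp (- |w|\<^sup>2 / 2)\<close> of the norm and by the weight a Gaussian remains, and Gaussians have finite norm
  for all exponents (\<open>dilation_polynomial_approximation\<close>, \<open>dilation_polynomial_dense\<close>).

  The growth estimate descends from mixed exponents to one exponent \<open>s \<le> 1\<close> by Hoelder's inequality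
  against a Gaussian (\<open>mixed_qnorm_lower_exponent\<close>) and from the resulting integral to point values by
  a mean value inequality for \<open>|F|\<^sup>s\<close> (\<open>entire_small_power_bound\<close>).

  Weights are only Lebesgue measurable, so individual slices of \<open>h\<close> may fail to be measurable.  Up to
  a positive factor, the iterated integral over the summands of the space is Lebesgue measure
  (\<open>sum_measure_eq_lborel\<close>); a null set hence meets almost every slice in a null set, and each
  statement about mixed quasi-norms is first proved for Borel functions and then transferred.
\<close>

section \<open>Powers of extended nonnegative reals\<close>

lemma ennpow_top [simp]: "ennpow top r = top"
  by (simp add: ennpow_def)

lemma ennpow_ennreal [simp]: "0 \<le> x \<Longrightarrow> ennpow (ennreal x) r = ennreal (x powr r)"
  by (simp add: ennpow_def)

lemma ennpow_zero [simp]: "ennpow 0 r = 0"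
  by (simp add: ennpow_def)

lemma ennpow_one [simp]: "ennpow x 1 = x"
  by (cases x) auto

lemma ennpow_ennpow [simp]: "ennpow (ennpow x r) s = ennpow x (r * s)"
  by (cases x) (auto simp: powr_powr)

lemma ennpow_mono: "0 \<le> r \<Longrightarrow> x \<le> y \<Longrightarrow> ennpow x r \<le> ennpow y r"
  by (cases x; cases y) (auto simp: powr_mono2 top_unique)

lemma ennpow_le_iff: "0 < r \<Longrightarrow> ennpow x r \<le> ennpow y r \<longleftrightarrow> x \<le> y"
  using ennpow_mono[of r x y] ennpow_mono[of "1/r" "ennpow x r" "ennpow y r"] by auto

lemma ennpow_less_iff: "0 < r \<Longrightarrow> ennpow x r < ennpow y r \<longleftrightarrow> x < y"
  using ennpow_le_iff[of r y x] by (simp add: not_le[symmetric])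

lemma ennpow_eq_0_iff [simp]: "ennpow x r = 0 \<longleftrightarrow> x = 0"
  by (cases x) auto

lemma ennpow_eq_top_iff [simp]: "ennpow x r = top \<longleftrightarrow> x = top"
  by (cases x) auto

lemma ennpow_mult: "ennpow (x * y) r = ennpow x r * ennpow y r"
  by (cases x; cases y)
     (auto simp: powr_mult ennreal_mult'[symmetric] ennreal_mult_top ennreal_top_mult)

lemma measurable_ennpow [measurable]: "(\<lambda>x. ennpow x r) \<in> borel_measurable borel"
  unfolding ennpow_def by measurable

lemma tendsto_ennpow_0:
  assumes "(f \<longlongrightarrow> 0) F" "0 < r"
  shows "((\<lambda>x. ennpow (f x) r) \<longlongrightarrow> 0) F"
proof (rule order_tendstoI)
  fix a :: ennreal assume "0 < a"
  then have "0 < ennpow a (1/r)" by (simp add: zero_less_iff_neq_zero)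
  then have "eventually (\<lambda>x. f x < ennpow a (1/r)) F"
    using assms(1) order_tendstoD(2) by blast
  then show "eventually (\<lambda>x. ennpow (f x) r < a) F"
  proof eventually_elim
    case (elim x)
    then have "ennpow (f x) r < ennpow (ennpow a (1/r)) r"
      using assms(2) by (simp add: ennpow_less_iff del: ennpow_ennpow)
    then show ?case using assms(2) by simp
  qed
qed auto

lemma ennpow_add_le: "0 < r \<Longrightarrow> ennpow (x + y) r \<le> ennreal (2 powr r) * (ennpow x r + ennpow y r)"
proof -
  assume r: "0 < r"
  have "x + y \<le> 2 * max x y"
    by (simp add: mult_2 add_mono)
  then have "ennpow (x + y) r \<le> ennpow (ennreal 2 * max x y) r"
    using r by (intro ennpow_mono) auto
  also have "\<dots> = ennreal (2 powr r) * ennpow (max x y) r"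
    using ennpow_ennreal[of 2 r] by (simp only: ennpow_mult)
  also have "ennpow (max x y) r \<le> ennpow x r + ennpow y r"
    by (auto simp: max_def)
  finally show ?thesis by (simp add: mult_left_mono)
qed

section \<open>Lp quasi-norms over one measure\<close>

lemma enn2real_pos: "0 < p \<Longrightarrow> p \<noteq> top \<Longrightarrow> 0 < enn2real p"
  by (simp add: enn2real_positive_iff less_top)

lemma Lp_qnorm_finite_exponent:
  "p \<noteq> top \<Longrightarrow> Lp_qnorm p M f = ennpow (\<integral>\<^sup>+x. ennpow (f x) (enn2real p) \<partial>M) (1 / enn2real p)"
  by (simp add: Lp_qnorm_def)

lemma Lp_qnorm_top [simp]: "Lp_qnorm top M f = esssup M f"
  by (simp add: Lp_qnorm_def)

lemma Lp_qnorm_mono_AE: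
  assumes "f \<in> borel_measurable M" "AE x in M. f x \<le> g x"
  shows "Lp_qnorm p M f \<le> Lp_qnorm p M g"
proof (cases "p = top")
  case False
  have "(\<integral>\<^sup>+x. ennpow (f x) (enn2real p) \<partial>M) \<le> (\<integral>\<^sup>+x. ennpow (g x) (enn2real p) \<partial>M)"
    using assms(2) by (intro nn_integral_mono_AE) (auto elim!: eventually_mono intro: ennpow_mono)
  with False show ?thesis by (simp add: Lp_qnorm_finite_exponent ennpow_mono)
qed (use assms esssup_AE_mono in auto)

lemma Lp_qnorm_cong_AE:
  assumes "f \<in> borel_measurable M" "g \<in> borel_measurable M" "AE x in M. f x = g x"
  shows "Lp_qnorm p M f = Lp_qnorm p M g"
  using assms by (intro antisym Lp_qnorm_mono_AE) (auto elim!: eventually_mono)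

lemma Lp_qnorm_zero [simp]: "0 < p \<Longrightarrow> Lp_qnorm p M (\<lambda>_. 0) = 0"
proof (cases "p = top")
  case True
  have "esssup M (\<lambda>_. 0::ennreal) \<le> 0" by (rule esssup_I) auto
  then show ?thesis using True by simp
qed (simp add: Lp_qnorm_finite_exponent)

text \<open>
  The default value of \<open>esssup\<close> at non-measurable functions makes measurability before
  completion essential here.
\<close>

lemma Lp_qnorm_completion:
  assumes "f \<in> borel_measurable M"
  shows "Lp_qnorm p (completion M) f = Lp_qnorm p M f"
proof (cases "p = top")
  case True
  have "f \<in> borel_measurable (completion M)" using assms by (rule measurable_completion)
  then show ?thesis using True assms by (simp add: esssup_eq_AE AE_completion_iff)
qed (simp add: Lp_qnorm_finite_exponent nn_integral_completion)

lemma Lp_qnorm_cmult: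
  assumes f: "f \<in> borel_measurable M" and c: "0 \<le> c" and p: "0 < p"
  shows "Lp_qnorm p M (\<lambda>x. ennreal c * f x) = ennreal c * Lp_qnorm p M f"
proof (cases "p = top")
  case False
  note [measurable] = f
  show ?thesis using False c enn2real_pos[OF p False]
    by (simp add: Lp_qnorm_finite_exponent ennpow_mult nn_integral_cmult powr_powr)
next
  case True
  have le: "esssup M (\<lambda>x. ennreal c * f x) \<le> ennreal c * esssup M f"
    if [measurable]: "f \<in> borel_measurable M" for c f
    by (rule esssup_I) (use esssup_AE[of f M] in \<open>auto elim!: eventually_mono intro: mult_left_mono\<close>)
  show ?thesis
  proof (cases "c = 0")
    case True2: True
    show ?thesis using True Lp_qnorm_zero[of top M] by (simp add: True2)
  next
    case False
    then have c': "0 < c" using c by simp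
    note [measurable] = f
    have inv: "ennreal (1/c) * (ennreal c * y) = y" for y
      using c' by (simp add: mult.assoc[symmetric] ennreal_mult'[symmetric])
    have "esssup M f = esssup M (\<lambda>x. ennreal (1/c) * (ennreal c * f x))" by (simp add: inv)
    also have "\<dots> \<le> ennreal (1/c) * esssup M (\<lambda>x. ennreal c * f x)" by (rule le) simp
    finally have "ennreal c * esssup M f \<le> ennreal c * (ennreal (1/c) * esssup M (\<lambda>x. ennreal c * f x))"
      by (rule mult_left_mono) simp
    also have "\<dots> = esssup M (\<lambda>x. ennreal c * f x)"
      using inv[of "esssup M (\<lambda>x. ennreal c * f x)"] by (simp add: ac_simps)
    finally show ?thesis using le[OF f, of c] True by simp
  qed
qed

text \<open>
  For \<open>p < 1\<close> the constant \<open>1\<close> is impossible.  The elementary bound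
  \<open>(a + b)\<^sup>r \<le> 2\<^sup>r (a\<^sup>r + b\<^sup>r)\<close> is applied to the integrand with \<open>r = p\<close> and to the integrals with
  \<open>r = 1/p\<close>, which treats all finite
  exponents alike.
\<close>

lemma Lp_qnorm_triangle:
  assumes p: "0 < p"
  shows "\<exists>K>0. \<forall>f\<in>borel_measurable M. \<forall>g\<in>borel_measurable M.
           Lp_qnorm p M (\<lambda>x. f x + g x) \<le> ennreal K * (Lp_qnorm p M f + Lp_qnorm p M g)"
proof (cases "p = top")
  case True
  have "esssup M (\<lambda>x. f x + g x) \<le> ennreal 1 * (esssup M f + esssup M g)"
    if [measurable]: "f \<in> borel_measurable M" "g \<in> borel_measurable M" for f g
  proof -
    have "AE x in M. f x + g x \<le> esssup M f + esssup M g"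
      using esssup_AE[of f M] esssup_AE[of g M] by eventually_elim (rule add_mono)
    then show ?thesis by (simp add: esssup_I)
  qed
  then show ?thesis using True by (intro exI[of _ 1]) simp
next
  case False
  define r where "r = enn2real p"
  have r: "0 < r" using enn2real_pos[OF p False] by (simp add: r_def)
  let ?I = "\<lambda>f. \<integral>\<^sup>+x. ennpow (f x) r \<partial>M"
  have "Lp_qnorm p M (\<lambda>x. f x + g x)
      \<le> ennreal (2 * 2 powr (1 / r) * 2 powr (1/r)) * (Lp_qnorm p M f + Lp_qnorm p M g)"
    if [measurable]: "f \<in> borel_measurable M" "g \<in> borel_measurable M" for f g
  proof -
    have "?I (\<lambda>x. f x + g x) \<le> (\<integral>\<^sup>+x. ennreal (2 powr r) * (ennpow (f x) r + ennpow (g x) r) \<partial>M)"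
      using r by (intro nn_integral_mono ennpow_add_le)
    also have "\<dots> = ennreal (2 powr r) * (?I f + ?I g)"
      by (simp add: nn_integral_cmult nn_integral_add)
    finally have "ennpow (?I (\<lambda>x. f x + g x)) (1/r) \<le> ennpow (ennreal (2 powr r) * (?I f + ?I g)) (1/r)"
      using r by (intro ennpow_mono) auto
    also have "\<dots> = ennreal 2 * ennpow (?I f + ?I g) (1/r)"
      using r by (simp add: ennpow_mult powr_powr)
    also have "\<dots> \<le> ennreal 2 * (ennreal (2 powr (1/r)) * (ennpow (?I f) (1/r) + ennpow (?I g) (1/r)))"
      using r by (intro mult_left_mono ennpow_add_le) auto
    also have "\<dots> = ennreal (2 * 2 powr (1/r)) * (ennpow (?I f) (1/r) + ennpow (?I g) (1/r))"
      by (simp add: ennreal_mult' mult.assoc)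
    also have "\<dots> \<le> ennreal (2 * 2 powr (1 / r) * 2 powr (1/r)) * (ennpow (?I f) (1/r) + ennpow (?I g) (1/r))"
      using r by (intro mult_right_mono ennreal_leI) (auto intro!: ge_one_powr_ge_zero)
    finally show ?thesis using False by (simp add: Lp_qnorm_finite_exponent r_def)
  qed
  then show ?thesis by (intro exI[of _ "2 * 2 powr (1 / r) * 2 powr (1/r)"]) auto
qed

lemma Lp_qnorm_less_top_AE:
  assumes [measurable]: "g \<in> borel_measurable M" and p: "0 < p" and fin: "Lp_qnorm p M g < top"
  shows "AE x in M. g x < top"
proof (cases "p = top")
  case True
  then show ?thesis using esssup_AE[of g M] fin by (auto elim!: eventually_mono)
next
  case False
  then have "(\<integral>\<^sup>+x. ennpow (g x) (enn2real p) \<partial>M) \<noteq> top"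
    using fin by (auto simp: Lp_qnorm_finite_exponent)
  then have "AE x in M. ennpow (g x) (enn2real p) \<noteq> top"
    by (intro nn_integral_PInf_AE[simplified]) auto
  then show ?thesis by (auto elim!: eventually_mono simp: less_top)
qed

text \<open>
  A finite exponent is essential: for \<open>p = \<infinity>\<close> the indicators of \<open>{n..}\<close> on the real line
  are a counterexample.
\<close>

lemma Lp_qnorm_dominated:
  assumes [measurable]: "\<And>n. f n \<in> borel_measurable M" "g \<in> borel_measurable M"
    and p: "0 < p" "p \<noteq> top"
    and le: "\<And>n. AE x in M. f n x \<le> g x" and fin: "Lp_qnorm p M g < top"
    and lim: "AE x in M. (\<lambda>n. f n x) \<longlonglongrightarrow> 0"
  shows "(\<lambda>n. Lp_qnorm p M (f n)) \<longlonglongrightarrow> 0"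
proof -
  have r: "0 < enn2real p" using enn2real_pos[OF p] .
  have "(\<lambda>n. \<integral>\<^sup>+x. ennpow (f n x) (enn2real p) \<partial>M) \<longlonglongrightarrow> (\<integral>\<^sup>+x. 0 \<partial>M)"
  proof (rule nn_integral_dominated_convergence)
    show "AE x in M. ennpow (f j x) (enn2real p) \<le> ennpow (g x) (enn2real p)" for j
      using le[of j] by (auto elim!: eventually_mono intro: ennpow_mono)
    show "(\<integral>\<^sup>+x. ennpow (g x) (enn2real p) \<partial>M) < \<infinity>"
      using fin p by (auto simp: Lp_qnorm_finite_exponent less_top[symmetric])
    show "AE x in M. (\<lambda>i. ennpow (f i x) (enn2real p)) \<longlonglongrightarrow> 0"
      using lim by eventually_elim (rule tendsto_ennpow_0[OF _ r])
  qed auto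
  then show ?thesis
    using r p by (simp add: Lp_qnorm_finite_exponent tendsto_ennpow_0)
qed

text \<open>
  Young's inequality for the exponents \<open>p/s\<close> and \<open>q/s\<close>, applied to \<open>x\<^sup>s\<close> and \<open>y\<^sup>s\<close>.
\<close>

lemma Young_ennreal:
  assumes p: "0 < p" and q: "0 < q" and s: "0 < s" "1 / p + 1 / q = 1 / s"
  shows "ennpow (x * y) s \<le> ennreal (s / p) * ennpow x p + ennreal (s / q) * ennpow y q"
proof (cases x; cases y)
  fix a b assume ab: "x = ennreal a" "0 \<le> a" "y = ennreal b" "0 \<le> b"
  have "p / s > 1" "q / s > 1" "1 / (p/s) + 1 / (q/s) = 1"
  proof -
    have "1 / p < 1 / s" "1 / q < 1 / s"
      unfolding s(2)[symmetric] using p q by simp_all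
    then show "p / s > 1" "q / s > 1" using p q s(1) by (simp_all add: field_simps)
    have "1 / (p/s) + 1 / (q/s) = s * (1 / p + 1 / q)" using p q s(1) by (simp add: distrib_left)
    then show "1 / (p/s) + 1 / (q/s) = 1" using s by simp
  qed
  from Youngs_inequality[OF this, of "a powr s" "b powr s"]
  have "a powr s * b powr s \<le> (s/p) * a powr p + (s/q) * b powr q"
    using s by (simp add: powr_powr field_simps)
  then show ?thesis
    using ab p q s by (simp add: powr_mult ennpow_mult ennreal_mult'[symmetric] ennreal_plus[symmetric] del: ennreal_plus)
qed (use p q s in \<open>auto simp: ennreal_mult_top\<close>)

lemma Lp_qnorm_eq_0_AE:
  assumes [measurable]: "f \<in> borel_measurable M" and "p \<noteq> top" "Lp_qnorm p M f = 0"
  shows "AE x in M. f x = 0"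
  using assms by (simp add: Lp_qnorm_finite_exponent nn_integral_0_iff_AE)

text \<open>
  For finite exponents both functions are normalized and Young's inequality is integrated.  If one
  exponent is infinite, the other one equals \<open>s\<close> and the essential supremum is pulled out.
\<close>

lemma Lp_qnorm_Holder:
  assumes [measurable]: "f \<in> borel_measurable M" "g \<in> borel_measurable M"
    and pq: "0 < p" "0 < q" "0 < s" "s \<noteq> top" "inverse p + inverse q = inverse s"
  shows "Lp_qnorm s M (\<lambda>x. f x * g x) \<le> Lp_qnorm p M f * Lp_qnorm q M g"
proof -
  have sup_case: "Lp_qnorm s M (\<lambda>x. f x * g x) \<le> esssup M f * Lp_qnorm s M g"
    if [measurable]: "f \<in> borel_measurable M" "g \<in> borel_measurable M" for f g
  proof -
    have "(\<integral>\<^sup>+x. ennpow (f x * g x) (enn2real s) \<partial>M)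
       \<le> (\<integral>\<^sup>+x. ennpow (esssup M f) (enn2real s) * ennpow (g x) (enn2real s) \<partial>M)"
      using esssup_AE[of f M]
      by (intro nn_integral_mono_AE)
         (auto elim!: eventually_mono simp: ennpow_mult intro!: mult_right_mono ennpow_mono)
    also have "\<dots> = ennpow (esssup M f) (enn2real s) * (\<integral>\<^sup>+x. ennpow (g x) (enn2real s) \<partial>M)"
      by (rule nn_integral_cmult) simp
    finally have "Lp_qnorm s M (\<lambda>x. f x * g x)
        \<le> ennpow (ennpow (esssup M f) (enn2real s) * (\<integral>\<^sup>+x. ennpow (g x) (enn2real s) \<partial>M)) (1 / enn2real s)"
      using pq by (simp add: Lp_qnorm_finite_exponent ennpow_mono)
    then show ?thesis
      using pq enn2real_pos[of s] by (simp add: ennpow_mult Lp_qnorm_finite_exponent)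
  qed
  have inv_inj: "x = y" if "inverse x = inverse y" for x y :: ennreal
    using that by (cases x; cases y; cases "x = 0"; cases "y = 0")
      (auto simp: inverse_ennreal top_unique split: if_splits)
  consider "p = top" | "q = top" | "p \<noteq> top" "q \<noteq> top" by blast
  then show ?thesis
  proof cases
    case 1
    then have "q = s" using pq inv_inj by simp
    then show ?thesis using 1 sup_case[of f g] by simp
  next
    case 2
    then have "p = s" using pq inv_inj by simp
    then show ?thesis using 2 sup_case[of g f] by (simp add: mult.commute)
  next
    case 3
    define a b where "a = Lp_qnorm p M f" and "b = Lp_qnorm q M g"
    define p' q' s' where "p' = enn2real p" and "q' = enn2real q" and "s' = enn2real s"
    have pos: "0 < p'" "0 < q'" "0 < s'"
      using 3 pq enn2real_pos by (auto simp: p'_def q'_def s'_def)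
    have pe: "p = ennreal p'" "q = ennreal q'" "s = ennreal s'"
      using 3 pq by (auto simp: p'_def q'_def s'_def less_top)
    have rel: "1 / p' + 1 / q' = 1 / s'"
      using pq(5) pos unfolding pe
      by (simp add: inverse_ennreal ennreal_plus[symmetric] inverse_eq_divide del: ennreal_plus)
    consider "a = 0 \<or> b = 0" | "a \<noteq> 0" "b \<noteq> 0" "a = top \<or> b = top" | "a \<noteq> 0" "b \<noteq> 0" "a \<noteq> top" "b \<noteq> top"
      by blast
    then show ?thesis
    proof cases
      case 1
      then have "(AE x in M. f x = 0) \<or> (AE x in M. g x = 0)"
        unfolding a_def b_def using 3 Lp_qnorm_eq_0_AE[of f M p] Lp_qnorm_eq_0_AE[of g M q] by auto
      then have "AE x in M. f x * g x = 0" by (auto elim!: eventually_mono)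
      then have "Lp_qnorm s M (\<lambda>x. f x * g x) = Lp_qnorm s M (\<lambda>_. 0)"
        by (intro Lp_qnorm_cong_AE) auto
      then show ?thesis using pq by simp
    next
      case 2
      then show ?thesis by (auto simp: a_def b_def ennreal_mult_top ennreal_top_mult)
    next
      case 3
      then obtain a' b' where ab: "a = ennreal a'" "b = ennreal b'" "0 < a'" "0 < b'"
        by (cases a; cases b) auto
      let ?f = "\<lambda>x. ennreal (1/a') * f x" and ?g = "\<lambda>x. ennreal (1/b') * g x"
      have "Lp_qnorm p M ?f = 1"
        using ab pq by (subst Lp_qnorm_cmult) (auto simp: a_def[symmetric] ennreal_mult'[symmetric])
      then have f1: "(\<integral>\<^sup>+x. ennpow (?f x) p' \<partial>M) = 1"
        using \<open>p \<noteq> top\<close> pos by (simp add: Lp_qnorm_finite_exponent p'_def[symmetric])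
          (metis (no_types, lifting) ennpow_ennpow ennpow_one nonzero_divide_eq_eq less_irrefl ennreal_1 ennpow_ennreal powr_one_eq_one zero_le_one)
      have "Lp_qnorm q M ?g = 1"
        using ab pq by (subst Lp_qnorm_cmult) (auto simp: b_def[symmetric] ennreal_mult'[symmetric])
      then have g1: "(\<integral>\<^sup>+x. ennpow (?g x) q' \<partial>M) = 1"
        using \<open>q \<noteq> top\<close> pos by (simp add: Lp_qnorm_finite_exponent q'_def[symmetric])
          (metis (no_types, lifting) ennpow_ennpow ennpow_one nonzero_divide_eq_eq less_irrefl ennreal_1 ennpow_ennreal powr_one_eq_one zero_le_one)
      have "(\<integral>\<^sup>+x. ennpow (?f x * ?g x) s' \<partial>M)
          \<le> (\<integral>\<^sup>+x. ennreal (s'/p') * ennpow (?f x) p' + ennreal (s'/q') * ennpow (?g x) q' \<partial>M)"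
        using pos rel by (intro nn_integral_mono Young_ennreal)
      also have "\<dots> = ennreal (s'/p') + ennreal (s'/q')"
        by (subst nn_integral_add) (auto simp: nn_integral_cmult f1 g1)
      also have "\<dots> = ennreal (s' * (1/p' + 1/q'))"
        using pos by (simp add: distrib_left ennreal_plus[symmetric] del: ennreal_plus)
      also have "\<dots> = 1" using pos rel by simp
      finally have "Lp_qnorm s M (\<lambda>x. ?f x * ?g x) \<le> ennpow 1 (1/s')"
        using pq pos by (simp add: Lp_qnorm_finite_exponent s'_def ennpow_mono)
      moreover have "ennpow 1 (1/s') = 1" using ennpow_ennreal[of 1] by simp
      moreover have "(\<lambda>x. ?f x * ?g x) = (\<lambda>x. ennreal (1 / (a'*b')) * (f x * g x))"
        using ab by (auto simp: ennreal_mult' fun_eq_iff ac_simps divide_inverse)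
      ultimately have "ennreal (1 / (a'*b')) * Lp_qnorm s M (\<lambda>x. f x * g x) \<le> 1"
        using ab pq by (simp add: Lp_qnorm_cmult)
      then have "ennreal (a'*b') * (ennreal (1 / (a'*b')) * Lp_qnorm s M (\<lambda>x. f x * g x)) \<le> ennreal (a'*b') * 1"
        by (rule mult_left_mono) simp
      moreover have "ennreal (a'*b') * ennreal (1 / (a'*b')) = 1"
        using ab by (simp add: ennreal_mult'[symmetric])
      ultimately have "Lp_qnorm s M (\<lambda>x. f x * g x) \<le> ennreal (a' * b')"
        by (simp add: mult.assoc[symmetric])
      then show ?thesis using ab by (simp add: a_def b_def ennreal_mult')
    qed
  qed
qed

lemma nn_integral_superlevel_eq_0_iff:
  fixes f :: "'a \<Rightarrow> ennreal"
  assumes [measurable]: "f \<in> borel_measurable M"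
  shows "(\<integral>\<^sup>+x. indicator {c<..} (f x) \<partial>M) = 0 \<longleftrightarrow> (AE x in M. f x \<le> c)"
  by (subst nn_integral_0_iff_AE) (auto simp: indicator_def not_less intro!: eventually_cong)

text \<open>
  For \<open>p = \<infinity>\<close> the quasi-norm exceeds \<open>c\<close> iff the superlevel set at \<open>c\<close> has positive measure, and
  that measure depends measurably on the parameter.
\<close>

lemma Lp_qnorm_measurable:
  fixes f :: "'a \<Rightarrow> 'b \<Rightarrow> ennreal"
  assumes "sigma_finite_measure M" and [measurable]: "(\<lambda>(y, x). f y x) \<in> borel_measurable (N \<Otimes>\<^sub>M M)"
  shows "(\<lambda>y. Lp_qnorm p M (f y)) \<in> borel_measurable N"
proof (cases "p = top")
  interpret sigma_finite_measure M by fact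
  case False
  then show ?thesis by (simp add: Lp_qnorm_finite_exponent)
next
  interpret sigma_finite_measure M by fact
  case True
  have "(\<lambda>y. esssup M (f y)) \<in> borel_measurable N"
  proof (rule borel_measurableI_greater)
    fix c :: ennreal
    have "{y \<in> space N. c < esssup M (f y)} = {y \<in> space N. 0 < (\<integral>\<^sup>+x. indicator {c<..} (f y x) \<partial>M)}"
    proof (intro Collect_cong conj_cong refl)
      fix y assume y: "y \<in> space N"
      then have [measurable]: "f y \<in> borel_measurable M" by measurable
      have eq: "(\<integral>\<^sup>+x. indicator {c<..} (f y x) \<partial>M) = 0 \<longleftrightarrow> (AE x in M. f y x \<le> c)"
        by (rule nn_integral_superlevel_eq_0_iff) measurable
      have "esssup M (f y) \<le> c \<longleftrightarrow> (AE x in M. f y x \<le> c)"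
      proof
        assume "esssup M (f y) \<le> c"
        then show "AE x in M. f y x \<le> c" using esssup_AE[of "f y" M] by (auto elim!: eventually_mono)
      qed (auto intro: esssup_I)
      with eq show "c < esssup M (f y) \<longleftrightarrow> 0 < (\<integral>\<^sup>+x. indicator {c<..} (f y x) \<partial>M)"
        by (metis not_less zero_less_iff_neq_zero)
    qed
    also have "\<dots> \<in> sets N" by measurable
    finally show "{y \<in> space N. c < esssup M (f y)} \<in> sets N" .
  qed
  with True show ?thesis by simp
qed

section \<open>Lebesgue measure on a subspace\<close>

abbreviation gauss :: "real \<Rightarrow> 'a::euclidean_space \<Rightarrow> ennreal" where
  "gauss a x \<equiv> ennreal (exp (- a * (norm x)\<^sup>2))"

lemma nn_integral_lborel_affine:
  fixes t :: "'a::euclidean_space"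
  assumes [measurable]: "f \<in> borel_measurable borel" and c: "c \<noteq> 0"
  shows "(\<integral>\<^sup>+x. f x \<partial>lborel) = ennreal (\<bar>c\<bar> ^ DIM('a)) * (\<integral>\<^sup>+x. f (t + c *\<^sub>R x) \<partial>lborel)"
  by (subst lborel_affine[OF c, of t]) (simp add: nn_integral_density nn_integral_distr nn_integral_cmult)

text \<open>
  Evaluate \<open>\<integral>\<integral> f(x) g(x + y)\<close> in both orders.  Integrating in \<open>y\<close> first gives the left side; the
  substitution \<open>x \<mapsto> x - y\<close> in the inner integral of the other order, followed by reflection, gives the
  right side.  The identity makes the two measures proportional; the factor is found by taking a
  Gaussian for \<open>g\<close>.
\<close>

lemma translation_invariant_unique:
  fixes M :: "'a::euclidean_space measure"
  assumes "sigma_finite_measure M" and sets: "sets M = sets borel"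
    and inv: "\<And>f v. f \<in> borel_measurable borel \<Longrightarrow> (\<integral>\<^sup>+x. f (v + x) \<partial>M) = (\<integral>\<^sup>+x. f x \<partial>M)"
    and [measurable]: "f \<in> borel_measurable borel" "g \<in> borel_measurable borel"
  shows "(\<integral>\<^sup>+x. f x \<partial>M) * (\<integral>\<^sup>+x. g x \<partial>lborel) = (\<integral>\<^sup>+x. g x \<partial>M) * (\<integral>\<^sup>+x. f x \<partial>lborel)"
proof -
  interpret M: sigma_finite_measure M by fact
  interpret P: pair_sigma_finite M lborel
    by (intro pair_sigma_finite.intro assms(1) sigma_finite_lborel)
  note [measurable_cong] = sets
  have trans: "(\<integral>\<^sup>+y. g (x + y) \<partial>lborel) = (\<integral>\<^sup>+y. g y \<partial>lborel)" for x
    using nn_integral_lborel_affine[of g 1 x] by simp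
  have refl: "(\<integral>\<^sup>+y. f (x - y) \<partial>lborel) = (\<integral>\<^sup>+y. f y \<partial>lborel)" for x
    using nn_integral_lborel_affine[of f "-1" x] by simp
  have "(\<integral>\<^sup>+x. f x \<partial>M) * (\<integral>\<^sup>+x. g x \<partial>lborel) = (\<integral>\<^sup>+x. \<integral>\<^sup>+y. f x * g (x + y) \<partial>lborel \<partial>M)"
    by (simp add: nn_integral_cmult nn_integral_multc trans)
  also have "\<dots> = (\<integral>\<^sup>+y. \<integral>\<^sup>+x. f x * g (x + y) \<partial>M \<partial>lborel)"
    by (rule P.Fubini'[symmetric]) simp
  also have "\<dots> = (\<integral>\<^sup>+y. \<integral>\<^sup>+x. f (x - y) * g x \<partial>M \<partial>lborel)"
  proof (rule nn_integral_cong)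
    fix y :: 'a
    show "(\<integral>\<^sup>+x. f x * g (x + y) \<partial>M) = (\<integral>\<^sup>+x. f (x - y) * g x \<partial>M)"
      using inv[of "\<lambda>x. f x * g (x + y)" "- y"] by simp
  qed
  also have "\<dots> = (\<integral>\<^sup>+x. \<integral>\<^sup>+y. f (x - y) * g x \<partial>lborel \<partial>M)"
    by (rule P.Fubini') simp
  also have "\<dots> = (\<integral>\<^sup>+x. g x \<partial>M) * (\<integral>\<^sup>+x. f x \<partial>lborel)"
    by (simp add: nn_integral_multc refl mult.commute nn_integral_cmult)
  finally show ?thesis .
qed

text \<open>
  The case \<open>c = 1\<close> is translation invariance and the case \<open>v = 0\<close> is the scaling law; both follow
  from the same induction on the number of coordinates.
\<close>

lemma nn_integral_PiM_affine:
  fixes c :: real and v :: "'i \<Rightarrow> real"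
  assumes "finite E" "c \<noteq> 0" "f \<in> borel_measurable (\<Pi>\<^sub>M e\<in>E. lborel)"
  shows "(\<integral>\<^sup>+t. f t \<partial>(\<Pi>\<^sub>M e\<in>E. lborel))
       = ennreal (\<bar>c\<bar> ^ card E) * (\<integral>\<^sup>+t. f (\<lambda>e\<in>E. v e + c * t e) \<partial>(\<Pi>\<^sub>M e\<in>E. lborel))"
  using assms(1,3)
proof (induction E arbitrary: f)
  case empty
  show ?case by (simp add: PiM_empty nn_integral_count_space_finite)
next
  case (insert i E)
  interpret product_sigma_finite "\<lambda>_::'i. lborel :: real measure"
    by unfold_locales
  note [measurable] = insert.prems
  let ?P = "\<Pi>\<^sub>M e\<in>E. lborel :: real measure"
  let ?a = "\<lambda>t. \<lambda>e\<in>E. v e + c * t e"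
  have [measurable]: "(\<lambda>z. (fst z)(i := v i + c * snd z)) \<in> ?P \<Otimes>\<^sub>M lborel \<rightarrow>\<^sub>M (\<Pi>\<^sub>M e\<in>insert i E. lborel)"
    "(\<lambda>z. (fst z)(i := snd z)) \<in> ?P \<Otimes>\<^sub>M lborel \<rightarrow>\<^sub>M (\<Pi>\<^sub>M e\<in>insert i E. lborel)"
    by measurable
  have [measurable]: "(\<lambda>t. f (\<lambda>e\<in>insert i E. v e + c * t e)) \<in> borel_measurable (\<Pi>\<^sub>M e\<in>insert i E. lborel)"
    by measurable
  have upd: "(\<lambda>y. f (x(i := y))) \<in> borel_measurable borel" if "x \<in> space ?P" for x
  proof -
    have "(\<lambda>y. (x, y)) \<in> borel \<rightarrow>\<^sub>M ?P \<Otimes>\<^sub>M lborel" using that by measurable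
    from measurable_compose[OF this, of "\<lambda>z. f ((fst z)(i := snd z))"]
    show ?thesis by simp
  qed
  have "(\<integral>\<^sup>+t. f t \<partial>(\<Pi>\<^sub>M e\<in>insert i E. lborel)) = (\<integral>\<^sup>+x. \<integral>\<^sup>+y. f (x(i := y)) \<partial>lborel \<partial>?P)"
    by (rule product_nn_integral_insert) (use insert in auto)
  also have "\<dots> = (\<integral>\<^sup>+x. ennreal \<bar>c\<bar> * (\<integral>\<^sup>+y. f (x(i := v i + c * y)) \<partial>lborel) \<partial>?P)"
    by (intro nn_integral_cong nn_integral_real_affine upd assms)
  also have "\<dots> = ennreal \<bar>c\<bar> * (\<integral>\<^sup>+x. \<integral>\<^sup>+y. f (x(i := v i + c * y)) \<partial>lborel \<partial>?P)"
    by (rule nn_integral_cmult) measurable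
  also have "(\<integral>\<^sup>+x. \<integral>\<^sup>+y. f (x(i := v i + c * y)) \<partial>lborel \<partial>?P)
      = ennreal (\<bar>c\<bar> ^ card E) * (\<integral>\<^sup>+x. \<integral>\<^sup>+y. f ((?a x)(i := v i + c * y)) \<partial>lborel \<partial>?P)"
    by (rule insert.IH) measurable
  also have "(\<integral>\<^sup>+x. \<integral>\<^sup>+y. f ((?a x)(i := v i + c * y)) \<partial>lborel \<partial>?P)
      = (\<integral>\<^sup>+x. \<integral>\<^sup>+y. f (\<lambda>e\<in>insert i E. v e + c * (x(i := y)) e) \<partial>lborel \<partial>?P)"
    using insert.hyps by (intro nn_integral_cong arg_cong[where f = f]) (auto simp: fun_eq_iff)
  also have "\<dots> = (\<integral>\<^sup>+t. f (\<lambda>e\<in>insert i E. v e + c * t e) \<partial>(\<Pi>\<^sub>M e\<in>insert i E. lborel))"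
    by (rule product_nn_integral_insert[symmetric]) (use insert in auto)
  finally show ?case
    by (simp only: mult.assoc[symmetric] ennreal_mult'[symmetric] abs_ge_zero
        card_insert_disjoint[OF insert.hyps] power_Suc)
qed

definition basis_of :: "'a::euclidean_space set \<Rightarrow> 'a set" where
  "basis_of V = (SOME E. orthonormal_basis_of V E)"

text \<open>
  The Borel measure whose completion is \<open>lebesgue_subspace V\<close>; product measures and Tonelli's
  theorem are used before completion.
\<close>

definition lborel_on :: "'a::euclidean_space set \<Rightarrow> 'a measure" where
  "lborel_on V = distr (\<Pi>\<^sub>M e\<in>basis_of V. lborel) borel (\<lambda>t. \<Sum>e\<in>basis_of V. t e *\<^sub>R e)"

lemma lebesgue_subspace_eq: "lebesgue_subspace V = completion (lborel_on V)"
  by (simp add: lebesgue_subspace_def lborel_on_def basis_of_def Let_def)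

lemma basis_of:
  assumes "subspace V"
  shows "finite (basis_of V)" "pairwise orthogonal (basis_of V)"
    "\<And>e. e \<in> basis_of V \<Longrightarrow> norm e = 1" "span (basis_of V) = V"
proof -
  have "orthonormal_basis_of V (basis_of V)"
    unfolding basis_of_def using orthonormal_basis_of_exists[OF assms] by (rule someI_ex)
  then show "finite (basis_of V)" "pairwise orthogonal (basis_of V)"
    "\<And>e. e \<in> basis_of V \<Longrightarrow> norm e = 1" "span (basis_of V) = V"
    by (auto simp: orthonormal_basis_of_def)
qed

lemma sets_lborel_on [simp, measurable_cong]: "sets (lborel_on V) = sets borel"
  by (simp add: lborel_on_def)

lemma space_lborel_on [simp]: "space (lborel_on V) = UNIV"
  by (simp add: lborel_on_def)

lemma nn_integral_lborel_on:
  assumes "f \<in> borel_measurable borel"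
  shows "(\<integral>\<^sup>+x. f x \<partial>lborel_on V)
       = (\<integral>\<^sup>+t. f (\<Sum>e\<in>basis_of V. t e *\<^sub>R e) \<partial>(\<Pi>\<^sub>M e\<in>basis_of V. lborel))"
  unfolding lborel_on_def by (rule nn_integral_distr) (use assms in measurable)

lemma nn_integral_lborel_on_affine:
  assumes V: "subspace V" "v \<in> V" and c: "c \<noteq> 0" and f[measurable]: "f \<in> borel_measurable borel"
  shows "(\<integral>\<^sup>+x. f x \<partial>lborel_on V)
       = ennreal (\<bar>c\<bar> ^ card (basis_of V)) * (\<integral>\<^sup>+x. f (v + c *\<^sub>R x) \<partial>lborel_on V)"
proof -
  let ?E = "basis_of V"
  note E = basis_of[OF V(1)]
  obtain u where u: "v = (\<Sum>e\<in>?E. u e *\<^sub>R e)"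
    using V(2) E(4) span_finite[OF E(1)] by auto
  have "(\<integral>\<^sup>+x. f x \<partial>lborel_on V) = ennreal (\<bar>c\<bar> ^ card ?E) *
     (\<integral>\<^sup>+t. f (\<Sum>e\<in>?E. (\<lambda>e\<in>?E. u e + c * t e) e *\<^sub>R e) \<partial>(\<Pi>\<^sub>M e\<in>?E. lborel))"
    unfolding nn_integral_lborel_on[OF f] by (rule nn_integral_PiM_affine[OF E(1) c]) measurable
  also have "(\<lambda>t. \<Sum>e\<in>?E. (\<lambda>e\<in>?E. u e + c * t e) e *\<^sub>R e) = (\<lambda>t. v + c *\<^sub>R (\<Sum>e\<in>?E. t e *\<^sub>R e))"
    by (auto simp: fun_eq_iff u scaleR_add_left sum.distrib scaleR_sum_right)
  also have "(\<integral>\<^sup>+t. f (v + c *\<^sub>R (\<Sum>e\<in>?E. t e *\<^sub>R e)) \<partial>(\<Pi>\<^sub>M e\<in>?E. lborel))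
      = (\<integral>\<^sup>+x. f (v + c *\<^sub>R x) \<partial>lborel_on V)"
    by (rule nn_integral_lborel_on[symmetric]) measurable
  finally show ?thesis .
qed

lemma nn_integral_lborel_on_translate:
  assumes "subspace V" "v \<in> V" "f \<in> borel_measurable borel"
  shows "(\<integral>\<^sup>+x. f (v + x) \<partial>lborel_on V) = (\<integral>\<^sup>+x. f x \<partial>lborel_on V)"
  using nn_integral_lborel_on_affine[OF assms(1,2) _ assms(3), of 1] by simp

lemma AE_lborel_on:
  assumes "subspace V"
  shows "AE x in lborel_on V. x \<in> V"
proof -
  have "V \<in> sets borel" using closed_subspace[OF assms] by (rule borel_closed)
  then have "(AE x in lborel_on V. x \<in> V) \<longleftrightarrow>
      (AE t in (\<Pi>\<^sub>M e\<in>basis_of V. lborel). (\<Sum>e\<in>basis_of V. t e *\<^sub>R e) \<in> V)"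
    unfolding lborel_on_def by (subst AE_distr_iff) auto
  then show ?thesis
    using basis_of(4)[OF assms] by (auto intro!: AE_I2 span_sum span_scale intro: span_base)
qed

lemma gauss_integral_real:
  assumes "0 < a"
  shows "(\<integral>\<^sup>+t. ennreal (exp (- a * t\<^sup>2)) \<partial>lborel) < \<infinity>"
proof -
  define s where "s = sqrt (1 / (2 * a))"
  have s: "s\<^sup>2 = 1 / (2 * a)" "0 < s" using assms by (auto simp: s_def)
  have "(\<integral>\<^sup>+t. ennreal (exp (- a * t\<^sup>2)) \<partial>lborel)
      = (\<integral>\<^sup>+t. ennreal (sqrt (2 * pi * s\<^sup>2)) * ennreal (normal_density 0 s t) \<partial>lborel)"
    using assms s(2) by (intro nn_integral_cong)
      (simp add: normal_density_def s(1) ennreal_mult'[symmetric] real_sqrt_gt_0_iff field_simps)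
  also have "\<dots> = ennreal (sqrt (2 * pi * s\<^sup>2)) * (\<integral>\<^sup>+t. ennreal (normal_density 0 s t) \<partial>lborel)"
    by (rule nn_integral_cmult) simp
  also have "(\<integral>\<^sup>+t. ennreal (normal_density 0 s t) \<partial>lborel) = 1"
    using s(2) by (subst nn_integral_eq_integral) (auto simp: integrable_normal_density)
  finally show ?thesis by simp
qed

text \<open>
  For orthonormal \<open>E\<close> the Gaussian is a product of one-dimensional Gaussians in the coordinates.
\<close>

lemma gauss_PiM:
  fixes E :: "'a::euclidean_space set"
  assumes E: "finite E" "pairwise orthogonal E" "\<And>e. e \<in> E \<Longrightarrow> norm e = 1" and a: "0 < a"
  shows "(\<integral>\<^sup>+t. gauss a (\<Sum>e\<in>E. t e *\<^sub>R e) \<partial>(\<Pi>\<^sub>M e\<in>E. lborel)) < \<infinity>"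
proof -
  interpret product_sigma_finite "\<lambda>_::'a. lborel :: real measure"
    by unfold_locales
  have "(norm (\<Sum>e\<in>E. t e *\<^sub>R e))\<^sup>2 = (\<Sum>e\<in>E. (t e)\<^sup>2)" for t
  proof -
    have "pairwise (\<lambda>i j. orthogonal (t i *\<^sub>R i) (t j *\<^sub>R j)) E"
      using E(2) by (auto simp: pairwise_def orthogonal_clauses)
    then show ?thesis using E by (simp add: norm_sum_Pythagorean)
  qed
  then have "gauss a (\<Sum>e\<in>E. t e *\<^sub>R e) = (\<Prod>e\<in>E. ennreal (exp (- a * (t e)\<^sup>2)))" for t
    by (simp add: prod_ennreal exp_sum[OF E(1), symmetric] sum_distrib_left sum_negf)
  then have "(\<integral>\<^sup>+t. gauss a (\<Sum>e\<in>E. t e *\<^sub>R e) \<partial>(\<Pi>\<^sub>M e\<in>E. lborel))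
      = (\<integral>\<^sup>+t. (\<Prod>e\<in>E. ennreal (exp (- a * (t e)\<^sup>2))) \<partial>(\<Pi>\<^sub>M e\<in>E. lborel))"
    by (simp only:)
  also have "\<dots> = (\<Prod>e\<in>E. \<integral>\<^sup>+t. ennreal (exp (- a * t\<^sup>2)) \<partial>lborel)"
    by (rule product_nn_integral_prod[OF E(1)]) measurable
  also have "\<dots> = (\<integral>\<^sup>+t. ennreal (exp (- a * t\<^sup>2)) \<partial>lborel) ^ card E"
    by simp
  also have "\<dots> < \<infinity>"
    using gauss_integral_real[OF a] by (simp only: infinity_ennreal_def power_less_top_ennreal) simp
  finally show ?thesis .
qed

lemma gauss_lborel_on:
  assumes V: "subspace V" and a: "0 < a"
  shows "(\<integral>\<^sup>+x. gauss a x \<partial>lborel_on V) < \<infinity>"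
  using gauss_PiM[OF basis_of(1-3)[OF V] a] by (simp add: nn_integral_lborel_on)

lemma pairwise_orthogonal_Basis: "pairwise orthogonal (Basis :: 'a::euclidean_space set)"
  by (simp add: pairwise_def orthogonal_def inner_not_same_Basis)

lemma gauss_lborel:
  assumes "0 < a"
  shows "(\<integral>\<^sup>+x. gauss a x \<partial>(lborel :: 'a::euclidean_space measure)) < \<infinity>"
proof -
  have "(\<integral>\<^sup>+x. gauss a x \<partial>(lborel :: 'a measure))
      = (\<integral>\<^sup>+t. gauss a (\<Sum>e\<in>Basis. t e *\<^sub>R (e::'a)) \<partial>(\<Pi>\<^sub>M e\<in>Basis. lborel))"
    by (subst lborel_eq, rule nn_integral_distr) measurable
  then show ?thesis
    using gauss_PiM[of "Basis :: 'a set", OF finite_Basis pairwise_orthogonal_Basis norm_Basis assms]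
    by simp
qed

text \<open>
  Balls have finite measure because a Gaussian is bounded below on them.
\<close>

lemma sigma_finite_gauss:
  fixes M :: "'a::euclidean_space measure"
  assumes sets[measurable_cong]: "sets M = sets borel" and fin: "(\<integral>\<^sup>+x. gauss 1 x \<partial>M) < \<infinity>"
  shows "sigma_finite_measure M"
proof
  have "emeasure M (cball 0 (real n)) \<noteq> \<infinity>" for n
  proof -
    have "ennreal (exp (- (real n)\<^sup>2)) * emeasure M (cball 0 (real n))
        = (\<integral>\<^sup>+x. ennreal (exp (- (real n)\<^sup>2)) * indicator (cball 0 (real n)) x \<partial>M)"
      by (rule nn_integral_cmult_indicator[symmetric]) (simp add: sets)
    also have "\<dots> \<le> (\<integral>\<^sup>+x. gauss 1 x \<partial>M)"
      by (intro nn_integral_mono) (auto simp: indicator_def intro!: ennreal_leI power_mono)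
    finally show ?thesis using fin by (auto simp: ennreal_mult_top)
  qed
  moreover have "(\<Union>n. cball (0::'a) (real n)) = UNIV"
    by (auto simp: real_arch_simple)
  ultimately show "\<exists>A. countable A \<and> A \<subseteq> sets M \<and> \<Union> A = space M \<and> (\<forall>a\<in>A. emeasure M a \<noteq> \<infinity>)"
    using sets_eq_imp_space_eq[OF sets]
    by (intro exI[of _ "range (\<lambda>n. cball 0 (real n))"]) (auto simp: sets)
qed

lemma sigma_finite_lborel_on: "subspace V \<Longrightarrow> sigma_finite_measure (lborel_on V)"
  by (rule sigma_finite_gauss) (auto intro: gauss_lborel_on[of V 1, simplified])

lemma lborel_on_nonzero:
  assumes V: "subspace V"
  shows "emeasure (lborel_on V) UNIV \<noteq> 0"
proof -
  interpret product_sigma_finite "\<lambda>_::'a. lborel :: real measure"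
    by unfold_locales
  have "emeasure (lborel_on V) UNIV = (\<integral>\<^sup>+x. 1 \<partial>lborel_on V)" by simp
  also have "\<dots> = (\<integral>\<^sup>+t. (\<Prod>e\<in>basis_of V. 1) \<partial>(\<Pi>\<^sub>M e\<in>basis_of V. lborel :: real measure))"
    by (subst nn_integral_lborel_on) auto
  also have "\<dots> = (\<Prod>e\<in>basis_of V. \<integral>\<^sup>+t. 1 \<partial>(lborel :: real measure))"
    by (rule product_nn_integral_prod) (use basis_of[OF V] in auto)
  finally show ?thesis using basis_of(1)[OF V] by simp
qed

section \<open>Direct sums of subspaces\<close>

fun sum_space :: "'a::euclidean_space mixed_space \<Rightarrow> 'a set" where
  "sum_space [] = {0}"
| "sum_space ((V, p) # B) = {x + y | x y. x \<in> V \<and> y \<in> sum_space B}"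

text \<open>
  The recursive form of unique decomposition, suited to the recursion of \<open>mixed_qnorm\<close>; it does not
  require the sum to be the whole space, so that it passes to the tail of the list.
\<close>

fun direct :: "'a::euclidean_space mixed_space \<Rightarrow> bool" where
  "direct [] \<longleftrightarrow> True"
| "direct ((V, p) # B) \<longleftrightarrow> subspace V \<and> V \<inter> sum_space B = {0} \<and> direct B"

text \<open>
  The measure whose integral is the iterated integral over the summands, in the order of
  \<open>mixed_qnorm\<close>.
\<close>

fun sum_measure :: "'a::euclidean_space mixed_space \<Rightarrow> 'a measure" where
  "sum_measure [] = return borel 0"
| "sum_measure ((V, p) # B) = distr (lborel_on V \<Otimes>\<^sub>M sum_measure B) borel (\<lambda>(x, y). x + y)"

lemma subspace_sum_space: "direct B \<Longrightarrow> subspace (sum_space B)"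
proof (induction B)
  case (Cons a B)
  then show ?case by (cases a) (auto intro!: subspace_sums)
qed auto

lemma sets_sum_measure [simp, measurable_cong]: "sets (sum_measure B) = sets borel"
  by (cases B rule: sum_measure.cases) auto

lemma space_sum_measure [simp]: "space (sum_measure B) = UNIV"
  by (cases B rule: sum_measure.cases) auto

text \<open>
  Addition is injective on \<open>V \<times> W\<close>, and an injective linear map on a finite-dimensional space is
  bounded below.
\<close>

lemma direct_sum_norm_bound:
  fixes V W :: "'a::euclidean_space set"
  assumes V: "subspace V" and W: "subspace W" and VW: "V \<inter> W = {0}"
  shows "\<exists>k>0. \<forall>x\<in>V. \<forall>y\<in>W. k * ((norm x)\<^sup>2 + (norm y)\<^sup>2) \<le> (norm (x + y))\<^sup>2"
proof -
  have "bounded_linear (\<lambda>z::'a \<times> 'a. fst z + snd z)"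
    by (intro bounded_linear_add bounded_linear_fst bounded_linear_snd)
  moreover have "\<forall>z\<in>V \<times> W. fst z + snd z = 0 \<longrightarrow> z = 0"
  proof safe
    fix x y assume xy: "x \<in> V" "y \<in> W" "fst (x, y) + snd (x, y) = 0"
    then have "y = - x" by (simp add: add_eq_0_iff)
    then have "x \<in> W" using xy(2) subspace_neg[OF W, of y] by simp
    then have "x = 0" using xy(1) VW by auto
    then show "(x, y) = 0" using \<open>y = - x\<close> by (simp add: zero_prod_def)
  qed
  ultimately obtain e where e: "e > 0" "\<forall>z\<in>V \<times> W. norm (fst z + snd z) \<ge> e * norm z"
    using injective_imp_isometric[of "V \<times> W" "\<lambda>z. fst z + snd z"] subspace_Times[OF V W] closed_subspace
    by blast
  have "e\<^sup>2 * ((norm x)\<^sup>2 + (norm y)\<^sup>2) \<le> (norm (x + y))\<^sup>2" if "x \<in> V" "y \<in> W" for x y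
  proof -
    have "e * norm (x, y) \<le> norm (x + y)" using e(2) that by force
    then have "(e * norm (x, y))\<^sup>2 \<le> (norm (x + y))\<^sup>2"
      using e(1) by (intro power_mono) auto
    then show ?thesis by (simp add: power_mult_distrib norm_Pair)
  qed
  then show ?thesis using e(1) by (intro exI[of _ "e\<^sup>2"]) auto
qed

text \<open>
  This lets a Gaussian on the sum be dominated by a product of Gaussians on the summands, which is
  how all mixed quasi-norms of Gaussians are seen to be finite.
\<close>

lemma gauss_direct_sum:
  fixes V W :: "'a::euclidean_space set"
  assumes "subspace V" "subspace W" "V \<inter> W = {0}"
  obtains k where "0 < k"
    "\<And>a x y. 0 < a \<Longrightarrow> x \<in> V \<Longrightarrow> y \<in> W \<Longrightarrow> gauss a (x + y) \<le> gauss (a * k) x * gauss (a * k) y"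
proof -
  obtain k where k: "k > 0" "\<And>x y. x \<in> V \<Longrightarrow> y \<in> W \<Longrightarrow> k * ((norm x)\<^sup>2 + (norm y)\<^sup>2) \<le> (norm (x + y))\<^sup>2"
    using direct_sum_norm_bound[OF assms] by blast
  have "gauss a (x + y) \<le> gauss (a * k) x * gauss (a * k) y" if "0 < a" "x \<in> V" "y \<in> W" for a x y
  proof -
    have "a * (k * ((norm x)\<^sup>2 + (norm y)\<^sup>2)) \<le> a * (norm (x + y))\<^sup>2"
      using k(2)[OF that(2,3)] that(1) by (intro mult_left_mono) auto
    then have "- a * (norm (x + y))\<^sup>2 \<le> - (a * k) * (norm x)\<^sup>2 + - (a * k) * (norm y)\<^sup>2"
      by (simp add: distrib_left mult.assoc)
    then have "exp (- a * (norm (x + y))\<^sup>2) \<le> exp (- (a * k) * (norm x)\<^sup>2) * exp (- (a * k) * (norm y)\<^sup>2)"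
      unfolding exp_add[symmetric] exp_le_cancel_iff .
    then have "ennreal (exp (- a * (norm (x + y))\<^sup>2))
        \<le> ennreal (exp (- (a * k) * (norm x)\<^sup>2) * exp (- (a * k) * (norm y)\<^sup>2))"
      by (rule ennreal_leI)
    then show ?thesis by (simp only: ennreal_mult'[OF exp_ge_zero])
  qed
  then show thesis using that k(1) by blast
qed

lemma nn_integral_sum_measure_Cons:
  assumes "subspace V" "sigma_finite_measure (sum_measure B)" and [measurable]: "f \<in> borel_measurable borel"
  shows "(\<integral>\<^sup>+z. f z \<partial>sum_measure ((V, p) # B)) = (\<integral>\<^sup>+y. \<integral>\<^sup>+x. f (x + y) \<partial>lborel_on V \<partial>sum_measure B)"
proof -
  interpret P: pair_sigma_finite "lborel_on V" "sum_measure B"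
    by (intro pair_sigma_finite.intro sigma_finite_lborel_on assms)
  have "(\<integral>\<^sup>+z. f z \<partial>sum_measure ((V, p) # B))
      = (\<integral>\<^sup>+z. f (fst z + snd z) \<partial>(lborel_on V \<Otimes>\<^sub>M sum_measure B))"
    by (simp add: nn_integral_distr split_beta')
  also have "\<dots> = (\<integral>\<^sup>+y. \<integral>\<^sup>+x. f (x + y) \<partial>lborel_on V \<partial>sum_measure B)"
    by (subst P.nn_integral_snd[symmetric]) auto
  finally show ?thesis .
qed

text \<open>
  The three claims are proved together: sigma-finiteness, which comes from the integrability of
  Gaussians, is what allows Tonelli's theorem in the next induction step.
\<close>

lemma sum_measure_gauss:
  "direct B \<Longrightarrow> (\<forall>a>0. (\<integral>\<^sup>+x. gauss a x \<partial>sum_measure B) < \<infinity>) \<and>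
     sigma_finite_measure (sum_measure B) \<and> (AE x in sum_measure B. x \<in> sum_space B)"
proof (induction B)
  case Nil
  have "sigma_finite_measure (sum_measure ([]::'a mixed_space))"
    by (rule sigma_finite_gauss) (auto simp: nn_integral_return)
  moreover have "AE x in sum_measure ([]::'a mixed_space). x \<in> sum_space []"
    unfolding sum_measure.simps by (subst AE_return) auto
  ultimately show ?case by (simp add: nn_integral_return)
next
  case (Cons b B)
  obtain V p where b: "b = (V, p)" by force
  have V: "subspace V" "V \<inter> sum_space B = {0}" "direct B" using Cons.prems b by auto
  note IH = Cons.IH[OF V(3)]
  then have sf: "sigma_finite_measure (sum_measure B)" by simp
  note C = nn_integral_sum_measure_Cons[OF V(1) sf]
  have AEV: "AE x in lborel_on V. x \<in> V" by (rule AE_lborel_on[OF V(1)])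
  obtain k where k: "0 < k" "\<And>a x y. 0 < a \<Longrightarrow> x \<in> V \<Longrightarrow> y \<in> sum_space B \<Longrightarrow> gauss a (x + y) \<le> gauss (a * k) x * gauss (a * k) y"
    by (rule gauss_direct_sum[OF V(1) subspace_sum_space[OF V(3)] V(2)]) blast
  have G: "(\<integral>\<^sup>+x. gauss a x \<partial>sum_measure (b # B)) < \<infinity>" if a: "a > 0" for a
  proof -
    have "(\<integral>\<^sup>+x. gauss a x \<partial>sum_measure (b # B))
        = (\<integral>\<^sup>+y. \<integral>\<^sup>+x. gauss a (x + y) \<partial>lborel_on V \<partial>sum_measure B)"
      unfolding b by (rule C) measurable
    also have "\<dots> \<le> (\<integral>\<^sup>+y. \<integral>\<^sup>+x. gauss (a * k) x * gauss (a * k) y \<partial>lborel_on V \<partial>sum_measure B)"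
    proof (rule nn_integral_mono_AE)
      show "AE y in sum_measure B. (\<integral>\<^sup>+x. gauss a (x + y) \<partial>lborel_on V)
              \<le> (\<integral>\<^sup>+x. gauss (a * k) x * gauss (a * k) y \<partial>lborel_on V)"
        using conjunct2[OF conjunct2[OF IH]]
      proof eventually_elim
        case y: (elim y)
        show ?case
          by (rule nn_integral_mono_AE) (use AEV in eventually_elim, rule k(2)[OF a _ y])
      qed
    qed
    also have "\<dots> = (\<integral>\<^sup>+x. gauss (a * k) x \<partial>lborel_on V) * (\<integral>\<^sup>+y. gauss (a * k) y \<partial>sum_measure B)"
      by (simp add: nn_integral_multc nn_integral_cmult)
    also have "\<dots> < \<infinity>"
      using IH gauss_lborel_on[OF V(1), of "a * k"] a k(1) by (auto simp: ennreal_mult_less_top)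
    finally show ?thesis .
  qed
  define S where "S = sum_space (b # B)"
  have S: "x + y \<in> S" if "x \<in> V" "y \<in> sum_space B" for x y
    using that by (auto simp: S_def b)
  have "closed S"
    unfolding S_def using subspace_sum_space[OF Cons.prems] by (rule closed_subspace)
  then have [measurable]: "S \<in> sets borel" by (rule borel_closed)
  have "(\<integral>\<^sup>+x. indicator (- S) x \<partial>sum_measure (b # B))
      = (\<integral>\<^sup>+y. \<integral>\<^sup>+x. indicator (- S) (x + y) \<partial>lborel_on V \<partial>sum_measure B)"
    unfolding b by (rule C) measurable
  also have "\<dots> = (\<integral>\<^sup>+y. 0 \<partial>sum_measure B)"
  proof (rule nn_integral_cong_AE)
    have "(\<integral>\<^sup>+x. indicator (- S) (x + y) \<partial>lborel_on V) = 0" if "y \<in> sum_space B" for y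
    proof -
      have "(\<integral>\<^sup>+x. indicator (- S) (x + y) \<partial>lborel_on V) = (\<integral>\<^sup>+x. 0 \<partial>lborel_on V)"
        by (rule nn_integral_cong_AE) (use AEV that S in \<open>auto elim!: eventually_mono simp: indicator_def\<close>)
      then show ?thesis by simp
    qed
    then show "AE y in sum_measure B. (\<integral>\<^sup>+x. indicator (- S) (x + y) \<partial>lborel_on V) = 0"
      using IH by (auto elim!: eventually_mono)
  qed
  finally have "- S \<in> null_sets (sum_measure (b # B))"
    by (simp add: null_sets_def)
  from AE_not_in[OF this] have "AE x in sum_measure (b # B). x \<in> S" by simp
  then show ?case using S_def G sigma_finite_gauss[of "sum_measure (b # B)"] G[of 1] by auto
qed

lemma sigma_finite_sum_measure: "direct B \<Longrightarrow> sigma_finite_measure (sum_measure B)"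
  using sum_measure_gauss by blast

lemma sum_measure_translate:
  "direct B \<Longrightarrow> v \<in> sum_space B \<Longrightarrow> f \<in> borel_measurable borel \<Longrightarrow>
    (\<integral>\<^sup>+x. f (v + x) \<partial>sum_measure B) = (\<integral>\<^sup>+x. f x \<partial>sum_measure B)"
proof (induction B arbitrary: v f)
  case (Cons b B)
  obtain V p where b: "b = (V, p)" by force
  have V: "subspace V" "direct B" using Cons.prems b by auto
  note C = nn_integral_sum_measure_Cons[OF V(1) sigma_finite_sum_measure[OF V(2)]]
  note [measurable] = Cons.prems(3)
  interpret sigma_finite_measure "lborel_on V" by (rule sigma_finite_lborel_on[OF V(1)])
  obtain v1 v2 where v: "v = v1 + v2" "v1 \<in> V" "v2 \<in> sum_space B" using Cons.prems b by auto
  have "(\<integral>\<^sup>+x. f (v + x) \<partial>sum_measure (b # B))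
      = (\<integral>\<^sup>+y. \<integral>\<^sup>+x. f (v1 + x + (v2 + y)) \<partial>lborel_on V \<partial>sum_measure B)"
    unfolding b v by (subst C) (auto simp: ac_simps)
  also have "\<dots> = (\<integral>\<^sup>+y. \<integral>\<^sup>+x. f (x + (v2 + y)) \<partial>lborel_on V \<partial>sum_measure B)"
    by (intro nn_integral_cong nn_integral_lborel_on_translate[OF V(1) v(2)]) measurable
  also have "\<dots> = (\<integral>\<^sup>+y. \<integral>\<^sup>+x. f (x + y) \<partial>lborel_on V \<partial>sum_measure B)"
    by (rule Cons.IH[OF V(2) v(3)]) measurable
  also have "\<dots> = (\<integral>\<^sup>+x. f x \<partial>sum_measure (b # B))"
    unfolding b by (subst C) auto
  finally show ?case .
qed auto

lemma sum_measure_nonzero: "direct B \<Longrightarrow> emeasure (sum_measure B) UNIV \<noteq> 0"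
proof (induction B)
  case (Cons b B)
  obtain V p where b: "b = (V, p)" by force
  have V: "subspace V" "direct B" using Cons.prems b by auto
  have "emeasure (sum_measure (b # B)) UNIV = (\<integral>\<^sup>+x. 1 \<partial>sum_measure (b # B))"
    by simp
  also have "\<dots> = emeasure (lborel_on V) UNIV * emeasure (sum_measure B) UNIV"
    unfolding b by (subst nn_integral_sum_measure_Cons[OF V(1) sigma_finite_sum_measure[OF V(2)]]) auto
  finally show ?case using lborel_on_nonzero[OF V(1)] Cons.IH[OF V(2)] by simp
qed auto

lemma gauss_lborel_nonzero: "(\<integral>\<^sup>+x. gauss a x \<partial>(lborel :: 'a::euclidean_space measure)) \<noteq> 0"
proof
  assume "(\<integral>\<^sup>+x. gauss a x \<partial>(lborel :: 'a measure)) = 0"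
  then have "AE x in (lborel :: 'a measure). False" by (subst (asm) nn_integral_0_iff_AE) auto
  then show False by (simp add: AE_iff_measurable[OF _ refl])
qed

text \<open>
  The iterated integral is invariant under translations by each summand, hence by every vector.
\<close>

lemma sum_measure_eq_lborel:
  fixes B :: "'a::euclidean_space mixed_space"
  assumes d: "direct B" and U: "sum_space B = UNIV"
  shows "\<exists>c>0. \<forall>f\<in>borel_measurable borel. (\<integral>\<^sup>+x. f x \<partial>sum_measure B) = ennreal c * (\<integral>\<^sup>+x. f x \<partial>lborel)"
proof -
  let ?S = "\<integral>\<^sup>+x. gauss 1 x \<partial>sum_measure B" and ?L = "\<integral>\<^sup>+x. gauss 1 x \<partial>(lborel :: 'a measure)"
  have S: "?S < \<infinity>" using sum_measure_gauss[OF d] by (meson zero_less_one)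
  have L: "?L < \<infinity>" by (rule gauss_lborel) simp
  have S0: "?S \<noteq> 0"
  proof
    assume "?S = 0"
    then have "AE x in sum_measure B. False" by (subst (asm) nn_integral_0_iff_AE) auto
    then show False using sum_measure_nonzero[OF d] by (simp add: AE_iff_measurable[OF _ refl])
  qed
  have L0: "?L \<noteq> 0" by (rule gauss_lborel_nonzero)
  obtain s l where sl: "?S = ennreal s" "?L = ennreal l" "0 < s" "0 < l"
    using S L S0 L0 by (cases ?S; cases ?L) (auto simp: less_le)
  have "(\<integral>\<^sup>+x. f x \<partial>sum_measure B) = ennreal (s / l) * (\<integral>\<^sup>+x. f x \<partial>lborel)"
    if [measurable]: "f \<in> borel_measurable borel" for f
  proof -
    have "(\<integral>\<^sup>+x. f x \<partial>sum_measure B) * ?L = ?S * (\<integral>\<^sup>+x. f x \<partial>lborel)"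
      by (rule translation_invariant_unique[OF sigma_finite_sum_measure[OF d]])
         (use sum_measure_translate[OF d] U in auto)
    then have "ennreal (1/l) * ((\<integral>\<^sup>+x. f x \<partial>sum_measure B) * ennreal l)
        = ennreal (1/l) * (ennreal s * (\<integral>\<^sup>+x. f x \<partial>lborel))"
      by (simp only: sl)
    moreover have "ennreal (1/l) * (X * ennreal l) = X" for X
      using sl by (simp add: mult.left_commute ennreal_mult'[symmetric])
    moreover have "ennreal (1/l) * (ennreal s * X) = ennreal (s / l) * X" for X
      using sl by (simp add: mult.assoc[symmetric] ennreal_mult'[symmetric])
    ultimately show ?thesis by simp
  qed
  then show ?thesis using sl by (intro exI[of _ "s / l"]) auto
qed

section \<open>Mixed quasi-norms of Borel functions\<close>

definition pos_exponents :: "'a mixed_space \<Rightarrow> bool" where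
  "pos_exponents B \<longleftrightarrow> (\<forall>(V, p)\<in>set B. 0 < p)"

lemma pos_exponents_Cons [simp]: "pos_exponents ((V, p) # B) \<longleftrightarrow> 0 < p \<and> pos_exponents B"
  by (simp add: pos_exponents_def)

lemma pos_exponents_Nil [simp]: "pos_exponents []"
  by (simp add: pos_exponents_def)

text \<open>
  One step of the recursion of \<open>mixed_qnorm\<close>, without completion.
\<close>

definition slice_qnorm :: "'a::euclidean_space set \<Rightarrow> ennreal \<Rightarrow> ('a \<Rightarrow> ennreal) \<Rightarrow> 'a \<Rightarrow> ennreal" where
  "slice_qnorm V p f y = Lp_qnorm p (lborel_on V) (\<lambda>x. f (x + y))"

lemma slice_qnorm_measurable [measurable]:
  assumes V: "subspace V" and [measurable]: "f \<in> borel_measurable borel"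
  shows "slice_qnorm V p f \<in> borel_measurable borel"
  unfolding slice_qnorm_def
  by (rule Lp_qnorm_measurable[OF sigma_finite_lborel_on[OF V]]) measurable

lemma mixed_qnorm_Cons:
  assumes [measurable]: "f \<in> borel_measurable borel"
  shows "mixed_qnorm ((V, p) # B) f = mixed_qnorm B (slice_qnorm V p f)"
  by (simp add: lebesgue_subspace_eq Lp_qnorm_completion slice_qnorm_def[abs_def])

text \<open>
  The comparison is needed on the sum of the subspaces only, where the iterated measure lives.  In
  this form it admits estimates such as \<open>gauss_direct_sum\<close> that may fail at other points.
\<close>

lemma mixed_qnorm_mono:
  assumes "direct B" "f \<in> borel_measurable borel" "g \<in> borel_measurable borel"
    and "\<And>z. z \<in> sum_space B \<Longrightarrow> f z \<le> g z"
  shows "mixed_qnorm B f \<le> mixed_qnorm B g"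
  using assms
proof (induction B arbitrary: f g)
  case (Cons b B)
  obtain V p where b: "b = (V, p)" by force
  have V: "subspace V" "direct B" using Cons.prems b by auto
  note [measurable] = Cons.prems(2,3)
  have "slice_qnorm V p f y \<le> slice_qnorm V p g y" if "y \<in> sum_space B" for y
    unfolding slice_qnorm_def using AE_lborel_on[OF V(1)] Cons.prems(4) that b
    by (intro Lp_qnorm_mono_AE) (auto elim!: eventually_mono)
  then show ?case
    unfolding b mixed_qnorm_Cons[OF Cons.prems(2)] mixed_qnorm_Cons[OF Cons.prems(3)]
    by (intro Cons.IH V slice_qnorm_measurable Cons.prems(2,3))
qed simp

lemma mixed_qnorm_cmult:
  assumes "direct B" "pos_exponents B" "f \<in> borel_measurable borel" "0 \<le> c"
  shows "mixed_qnorm B (\<lambda>z. ennreal c * f z) = ennreal c * mixed_qnorm B f"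
  using assms
proof (induction B arbitrary: f)
  case (Cons b B)
  obtain V p where b: "b = (V, p)" by force
  have V: "subspace V" "direct B" "pos_exponents B" "0 < p" using Cons.prems b by auto
  note [measurable] = Cons.prems(3)
  have "slice_qnorm V p (\<lambda>z. ennreal c * f z) = (\<lambda>y. ennreal c * slice_qnorm V p f y)"
    unfolding slice_qnorm_def using V Cons.prems(4) by (auto simp: fun_eq_iff intro!: Lp_qnorm_cmult)
  then show ?case
    using V Cons unfolding b
    by (simp add: mixed_qnorm_Cons Cons.IH slice_qnorm_measurable del: mixed_qnorm.simps)
qed simp

text \<open>
  The constants of the single steps multiply.
\<close>

lemma mixed_qnorm_triangle:
  assumes "direct B" "pos_exponents B"
  shows "\<exists>K>0. \<forall>f\<in>borel_measurable borel. \<forall>g\<in>borel_measurable borel.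
           mixed_qnorm B (\<lambda>z. f z + g z) \<le> ennreal K * (mixed_qnorm B f + mixed_qnorm B g)"
  using assms
proof (induction B)
  case (Cons b B)
  obtain V p where b: "b = (V, p)" by force
  have V: "subspace V" "direct B" "pos_exponents B" "0 < p" using Cons.prems b by auto
  obtain K where K: "K > 0" "\<And>f g. f \<in> borel_measurable borel \<Longrightarrow> g \<in> borel_measurable borel \<Longrightarrow>
      mixed_qnorm B (\<lambda>z. f z + g z) \<le> ennreal K * (mixed_qnorm B f + mixed_qnorm B g)"
    using Cons.IH V by blast
  obtain L where L: "L > 0" "\<And>f g. f \<in> borel_measurable (lborel_on V) \<Longrightarrow> g \<in> borel_measurable (lborel_on V) \<Longrightarrow>
      Lp_qnorm p (lborel_on V) (\<lambda>x. f x + g x) \<le> ennreal L * (Lp_qnorm p (lborel_on V) f + Lp_qnorm p (lborel_on V) g)"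
    using Lp_qnorm_triangle[OF V(4), of "lborel_on V"] by blast
  have "mixed_qnorm (b # B) (\<lambda>z. f z + g z) \<le> ennreal (L * K) * (mixed_qnorm (b # B) f + mixed_qnorm (b # B) g)"
    if [measurable]: "f \<in> borel_measurable borel" "g \<in> borel_measurable borel" for f g
  proof -
    note [measurable] = slice_qnorm_measurable[OF V(1)]
    have le: "slice_qnorm V p (\<lambda>z. f z + g z) y \<le> ennreal L * (slice_qnorm V p f y + slice_qnorm V p g y)" for y
      unfolding slice_qnorm_def by (rule L) measurable
    have "mixed_qnorm (b # B) (\<lambda>z. f z + g z) = mixed_qnorm B (slice_qnorm V p (\<lambda>z. f z + g z))"
      unfolding b by (rule mixed_qnorm_Cons) measurable
    also have "\<dots> \<le> mixed_qnorm B (\<lambda>y. ennreal L * (slice_qnorm V p f y + slice_qnorm V p g y))"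
      by (rule mixed_qnorm_mono[OF V(2) _ _ le]) measurable
    also have "\<dots> = ennreal L * mixed_qnorm B (\<lambda>y. slice_qnorm V p f y + slice_qnorm V p g y)"
      using L(1) V by (intro mixed_qnorm_cmult) auto
    also have "\<dots> \<le> ennreal L * (ennreal K * (mixed_qnorm B (slice_qnorm V p f) + mixed_qnorm B (slice_qnorm V p g)))"
      by (intro mult_left_mono K) auto
    finally show ?thesis
      using L(1) K(1) unfolding b
      by (simp add: mixed_qnorm_Cons ennreal_mult' mult.assoc del: mixed_qnorm.simps)
  qed
  then show ?case using L(1) K(1) by (intro exI[of _ "L * K"]) auto
qed (auto intro!: exI[of _ 1])

text \<open>
  Convergence is required wherever \<open>g\<close> is finite, rather than almost everywhere, because this
  hypothesis reproduces itself in the induction: where the slice norm of \<open>g\<close> is finite, \<open>g\<close> is finite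
  almost everywhere on the slice, and dominated convergence applies there.
\<close>

lemma mixed_qnorm_dominated:
  assumes "direct B" "pos_exponents B" "\<forall>(V, p)\<in>set B. p \<noteq> top"
    and "\<And>n. f n \<in> borel_measurable borel" "g \<in> borel_measurable borel"
    and "\<And>n z. f n z \<le> g z" and "mixed_qnorm B g < top"
    and "\<And>z. g z < top \<Longrightarrow> (\<lambda>n. f n z) \<longlonglongrightarrow> 0"
  shows "(\<lambda>n. mixed_qnorm B (f n)) \<longlonglongrightarrow> 0"
  using assms
proof (induction B arbitrary: f g)
  case (Cons b B)
  obtain V p where b: "b = (V, p)" by force
  have V: "subspace V" "direct B" "pos_exponents B" "0 < p" "p \<noteq> top" using Cons.prems b by auto
  note [measurable] = Cons.prems(4,5) slice_qnorm_measurable[OF V(1)]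
  have "(\<lambda>n. mixed_qnorm B (slice_qnorm V p (f n))) \<longlonglongrightarrow> 0"
  proof (rule Cons.IH[OF V(2,3)])
    show "\<forall>(V, p)\<in>set B. p \<noteq> top" using Cons.prems by auto
    show "slice_qnorm V p (f n) z \<le> slice_qnorm V p g z" for n z
      unfolding slice_qnorm_def using Cons.prems(6) by (intro Lp_qnorm_mono_AE) auto
    show "mixed_qnorm B (slice_qnorm V p g) < top"
      using Cons.prems(7) by (simp add: b mixed_qnorm_Cons del: mixed_qnorm.simps)
    fix y assume y: "slice_qnorm V p g y < top"
    have "AE x in lborel_on V. g (x + y) < top"
      by (rule Lp_qnorm_less_top_AE[OF _ V(4)]) (use y in \<open>auto simp: slice_qnorm_def\<close>)
    then have "AE x in lborel_on V. (\<lambda>n. f n (x + y)) \<longlonglongrightarrow> 0"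
      by eventually_elim (rule Cons.prems(8))
    then show "(\<lambda>n. slice_qnorm V p (f n) y) \<longlonglongrightarrow> 0"
      unfolding slice_qnorm_def using Cons.prems(6) y
      by (intro Lp_qnorm_dominated[OF _ _ V(4,5), where g = "\<lambda>x. g (x + y)"]) (auto simp: slice_qnorm_def)
  qed measurable
  then show ?case by (simp add: b mixed_qnorm_Cons del: mixed_qnorm.simps)
qed simp

text \<open>
  For a finite exponent \<open>k = - dim V / p\<close>; for \<open>p = \<infinity>\<close> the null sets are preserved and \<open>k = 0\<close>.
\<close>

lemma Lp_qnorm_dilation:
  fixes V :: "'a::euclidean_space set"
  assumes V: "subspace V" and p: "0 < p"
  shows "\<exists>k. \<forall>r>0. \<forall>f\<in>borel_measurable borel.
     Lp_qnorm p (lborel_on V) (\<lambda>x. f (r *\<^sub>R x)) = ennreal (r powr k) * Lp_qnorm p (lborel_on V) f"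
proof -
  let ?M = "lborel_on V" and ?d = "card (basis_of V)"
  have int: "(\<integral>\<^sup>+x. f (r *\<^sub>R x) \<partial>?M) = ennreal (r powr (- real ?d)) * (\<integral>\<^sup>+x. f x \<partial>?M)"
    if r: "0 < r" and f: "f \<in> borel_measurable borel" for f r
  proof -
    have "ennreal (r powr (- real ?d)) * (\<integral>\<^sup>+x. f x \<partial>?M)
        = ennreal (r powr (- real ?d)) * (ennreal (r ^ ?d) * (\<integral>\<^sup>+x. f (r *\<^sub>R x) \<partial>?M))"
      using nn_integral_lborel_on_affine[OF V subspace_0[OF V] _ f, of r] r by simp
    also have "\<dots> = (\<integral>\<^sup>+x. f (r *\<^sub>R x) \<partial>?M)"
      using r by (simp add: mult.assoc[symmetric] ennreal_mult'[symmetric] powr_minus powr_realpow)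
    finally show ?thesis by simp
  qed
  show ?thesis
  proof (cases "p = top")
    case False
    then have "0 < enn2real p" using p by (rule enn2real_pos[rotated])
    show ?thesis
    proof (intro exI[of _ "- real ?d * (1 / enn2real p)"] allI impI ballI)
      fix r :: real and f :: "'a \<Rightarrow> ennreal"
      assume r: "0 < r" and [measurable]: "f \<in> borel_measurable borel"
      show "Lp_qnorm p ?M (\<lambda>x. f (r *\<^sub>R x)) = ennreal (r powr (- real ?d * (1 / enn2real p))) * Lp_qnorm p ?M f"
        using False by (simp add: Lp_qnorm_finite_exponent int[OF r, of "\<lambda>x. ennpow (f x) (enn2real p)"]
            ennpow_mult powr_powr)
    qed
  next
    case True
    show ?thesis
    proof (intro exI[of _ 0] allI impI ballI)
      fix r :: real and f :: "'a \<Rightarrow> ennreal"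
      assume r: "0 < r" and [measurable]: "f \<in> borel_measurable borel"
      have "(AE x in ?M. f (r *\<^sub>R x) \<le> c) \<longleftrightarrow> (AE x in ?M. f x \<le> c)" for c
        using int[OF r, of "\<lambda>x. indicator {c<..} (f x)"] r nn_integral_superlevel_eq_0_iff[of f ?M c]
          nn_integral_superlevel_eq_0_iff[of "\<lambda>x. f (r *\<^sub>R x)" ?M c]
        by simp
      then show "Lp_qnorm p ?M (\<lambda>x. f (r *\<^sub>R x)) = ennreal (r powr 0) * Lp_qnorm p ?M f"
        using True r by (simp add: esssup_eq_AE)
    qed
  qed
qed

lemma mixed_qnorm_dilation:
  assumes "direct B" "pos_exponents B"
  shows "\<exists>k. \<forall>r>0. \<forall>f\<in>borel_measurable borel.
     mixed_qnorm B (\<lambda>z. f (r *\<^sub>R z)) = ennreal (r powr k) * mixed_qnorm B f"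
  using assms
proof (induction B)
  case (Cons b B)
  obtain V p where b: "b = (V, p)" by force
  have V: "subspace V" "direct B" "pos_exponents B" "0 < p" using Cons.prems b by auto
  note [measurable] = slice_qnorm_measurable[OF V(1)]
  obtain k where k: "\<And>r f. r > 0 \<Longrightarrow> f \<in> borel_measurable borel \<Longrightarrow>
     mixed_qnorm B (\<lambda>z. f (r *\<^sub>R z)) = ennreal (r powr k) * mixed_qnorm B f"
    using Cons.IH V by blast
  obtain l where l: "\<And>r f. r > 0 \<Longrightarrow> f \<in> borel_measurable borel \<Longrightarrow>
     Lp_qnorm p (lborel_on V) (\<lambda>x. f (r *\<^sub>R x)) = ennreal (r powr l) * Lp_qnorm p (lborel_on V) f"
    using Lp_qnorm_dilation[OF V(1,4)] by blast
  have "mixed_qnorm (b # B) (\<lambda>z. f (r *\<^sub>R z)) = ennreal (r powr (l + k)) * mixed_qnorm (b # B) f"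
    if r: "r > 0" and [measurable]: "f \<in> borel_measurable borel" for r f
  proof -
    have "slice_qnorm V p (\<lambda>z. f (r *\<^sub>R z)) = (\<lambda>y. ennreal (r powr l) * slice_qnorm V p f (r *\<^sub>R y))"
      using l[OF r, of "\<lambda>x. f (x + r *\<^sub>R y)" for y]
      by (simp add: slice_qnorm_def fun_eq_iff scaleR_add_right)
    then show ?thesis
      using V k[OF r, of "slice_qnorm V p f"] unfolding b
      by (simp add: mixed_qnorm_Cons mixed_qnorm_cmult powr_add ennreal_mult' mult.assoc del: mixed_qnorm.simps)
  qed
  then show ?case by blast
qed (auto intro!: exI[of _ 0])

text \<open>
  Also infinite exponents are allowed, which is what makes Gaussians admissible in dual spaces.
\<close>

lemma mixed_qnorm_gauss:
  assumes "direct B" "pos_exponents B" "0 < a"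
  shows "mixed_qnorm B (gauss a) < top"
  using assms
proof (induction B arbitrary: a)
  case (Cons b B)
  obtain V p where b: "b = (V, p)" by force
  have V: "subspace V" "V \<inter> sum_space B = {0}" "direct B" "pos_exponents B" "0 < p" using Cons.prems b by auto
  obtain k where k: "0 < k" "\<And>a x y. 0 < a \<Longrightarrow> x \<in> V \<Longrightarrow> y \<in> sum_space B \<Longrightarrow> gauss a (x + y) \<le> gauss (a * k) x * gauss (a * k) y"
    by (rule gauss_direct_sum[OF V(1) subspace_sum_space[OF V(3)] V(2)]) blast
  define G where "G = Lp_qnorm p (lborel_on V) (gauss (a * k))"
  have "G < top"
  proof (cases "p = top")
    case True
    have "esssup (lborel_on V) (gauss (a * k)) \<le> 1"
      using Cons.prems(3) k(1) by (intro esssup_I) auto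
    then show ?thesis by (simp add: G_def True le_less_trans[OF _ ennreal_one_less_top])
  next
    case False
    then have "0 < enn2real p" using V by (intro enn2real_pos)
    then show ?thesis
      using False gauss_lborel_on[OF V(1), of "a * k * enn2real p"] Cons.prems(3) k(1)
      by (simp add: G_def Lp_qnorm_finite_exponent less_top[symmetric] powr_def mult_ac)
  qed
  then obtain g where g: "G = ennreal g" "0 \<le> g" by (cases G) auto
  have "mixed_qnorm (b # B) (gauss a) = mixed_qnorm B (slice_qnorm V p (gauss a))"
    unfolding b by (rule mixed_qnorm_Cons) measurable
  also have "\<dots> \<le> mixed_qnorm B (\<lambda>y. ennreal g * gauss (a * k) y)"
  proof (rule mixed_qnorm_mono[OF V(3)])
    fix y assume y: "y \<in> sum_space B"
    have "slice_qnorm V p (gauss a) y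
        \<le> Lp_qnorm p (lborel_on V) (\<lambda>x. ennreal (exp (- (a * k) * (norm y)\<^sup>2)) * gauss (a * k) x)"
      unfolding slice_qnorm_def
    proof (rule Lp_qnorm_mono_AE)
      show "AE x in lborel_on V. gauss a (x + y) \<le> ennreal (exp (- (a * k) * (norm y)\<^sup>2)) * gauss (a * k) x"
        using AE_lborel_on[OF V(1)] by eventually_elim (subst mult.commute, rule k(2)[OF Cons.prems(3) _ y])
    qed measurable
    also have "\<dots> = ennreal (exp (- (a * k) * (norm y)\<^sup>2)) * G"
      unfolding G_def by (rule Lp_qnorm_cmult) (use V in auto)
    finally show "slice_qnorm V p (gauss a) y \<le> ennreal g * gauss (a * k) y"
      by (simp add: g(1) mult.commute)
  qed (use slice_qnorm_measurable[OF V(1)] in measurable)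
  also have "\<dots> = ennreal g * mixed_qnorm B (gauss (a * k))"
    using V g by (intro mixed_qnorm_cmult) auto
  also have "\<dots> < top"
    using Cons.IH[OF V(3,4), of "a * k"] Cons.prems(3) k(1) by (simp add: ennreal_mult_less_top)
  finally show ?case .
qed simp

lemma direct_map [simp]: "direct (map (\<lambda>(V, p). (V, q V p)) B) \<longleftrightarrow> direct B"
  and sum_space_map [simp]: "sum_space (map (\<lambda>(V, p). (V, q V p)) B) = sum_space B"
  and sum_measure_map [simp]: "sum_measure (map (\<lambda>(V, p). (V, q V p)) B) = sum_measure B"
  by (induction B rule: direct.induct) simp_all

text \<open>
  The function \<open>\<phi>\<close> assigns to each exponent its partner; the target exponent \<open>s\<close> is the same for all
  subspaces, so that the left side is an ordinary \<open>L\<^sup>s\<close> quasi-norm by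
  \<open>mixed_qnorm_const_exponent\<close>.
\<close>

lemma mixed_qnorm_Holder:
  assumes "direct (map (\<lambda>(V, p). (V, \<phi> p)) B)" "0 < s" "s \<noteq> top"
    and "\<forall>(V, p)\<in>set B. 0 < p \<and> 0 < \<phi> p \<and> inverse p + inverse (\<phi> p) = inverse s"
    and "f \<in> borel_measurable borel" "g \<in> borel_measurable borel"
  shows "mixed_qnorm (map (\<lambda>(V, p). (V, s)) B) (\<lambda>z. f z * g z)
     \<le> mixed_qnorm B f * mixed_qnorm (map (\<lambda>(V, p). (V, \<phi> p)) B) g"
  using assms
proof (induction B arbitrary: f g)
  case (Cons b B)
  obtain V p where b: "b = (V, p)" by force
  have V: "subspace V" "direct (map (\<lambda>(V, p). (V, \<phi> p)) B)" "0 < p" "0 < \<phi> p"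
      "inverse p + inverse (\<phi> p) = inverse s"
      "\<forall>(V, p)\<in>set B. 0 < p \<and> 0 < \<phi> p \<and> inverse p + inverse (\<phi> p) = inverse s"
    using Cons.prems b by auto
  note [measurable] = Cons.prems(5,6) slice_qnorm_measurable[OF V(1)]
  have le: "slice_qnorm V s (\<lambda>z. f z * g z) y \<le> slice_qnorm V p f y * slice_qnorm V (\<phi> p) g y" for y
    unfolding slice_qnorm_def using V(3-5) Cons.prems(2,3) by (intro Lp_qnorm_Holder) auto
  have "direct (map (\<lambda>(V, p). (V, s)) B)" using V(2) by simp
  then have "mixed_qnorm (map (\<lambda>(V, p). (V, s)) B) (slice_qnorm V s (\<lambda>z. f z * g z))
      \<le> mixed_qnorm (map (\<lambda>(V, p). (V, s)) B) (\<lambda>y. slice_qnorm V p f y * slice_qnorm V (\<phi> p) g y)"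
    by (rule mixed_qnorm_mono[OF _ _ _ le]) measurable
  also have "\<dots> \<le> mixed_qnorm B (slice_qnorm V p f)
      * mixed_qnorm (map (\<lambda>(V, p). (V, \<phi> p)) B) (slice_qnorm V (\<phi> p) g)"
    using V Cons.prems(2,3) by (intro Cons.IH) auto
  finally show ?case
    by (simp add: b mixed_qnorm_Cons del: mixed_qnorm.simps)
qed simp

lemma mixed_qnorm_const_exponent:
  assumes "direct B" "0 < s" "s \<noteq> top" "f \<in> borel_measurable borel"
  shows "mixed_qnorm (map (\<lambda>(V, p). (V, s)) B) f
     = ennpow (\<integral>\<^sup>+z. ennpow (f z) (enn2real s) \<partial>sum_measure B) (1 / enn2real s)"
  using assms
proof (induction B arbitrary: f)
  case Nil
  then show ?case using enn2real_pos[of s] by (simp add: nn_integral_return)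
next
  case (Cons b B)
  obtain V p where b: "b = (V, p)" by force
  have V: "subspace V" "direct B" using Cons.prems b by auto
  note [measurable] = Cons.prems(4) slice_qnorm_measurable[OF V(1)]
  have "mixed_qnorm (map (\<lambda>(V, p). (V, s)) (b # B)) f
      = mixed_qnorm (map (\<lambda>(V, p). (V, s)) B) (slice_qnorm V s f)"
    by (simp add: b mixed_qnorm_Cons del: mixed_qnorm.simps)
  also have "\<dots> = ennpow (\<integral>\<^sup>+y. ennpow (slice_qnorm V s f y) (enn2real s) \<partial>sum_measure B) (1 / enn2real s)"
    using V Cons.prems(2,3) by (intro Cons.IH) auto
  also have "(\<integral>\<^sup>+y. ennpow (slice_qnorm V s f y) (enn2real s) \<partial>sum_measure B)
      = (\<integral>\<^sup>+y. \<integral>\<^sup>+x. ennpow (f (x + y)) (enn2real s) \<partial>lborel_on V \<partial>sum_measure B)"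
    using Cons.prems(2,3) enn2real_pos[of s] by (simp add: slice_qnorm_def Lp_qnorm_finite_exponent)
  also have "\<dots> = (\<integral>\<^sup>+z. ennpow (f z) (enn2real s) \<partial>sum_measure (b # B))"
    unfolding b by (rule nn_integral_sum_measure_Cons[symmetric, OF V(1) sigma_finite_sum_measure[OF V(2)]]) measurable
  finally show ?case .
qed

section \<open>Mixed quasi-norms of Lebesgue measurable functions\<close>

lemma measurable_completion_AE_cong:
  assumes "f \<in> borel_measurable (completion M)" "AE x in M. f x = g x"
  shows "g \<in> borel_measurable (completion M)"
proof (rule measurableI)
  fix A :: "'b set" assume A: "A \<in> sets borel"
  have "f -` A \<inter> space (completion M) \<in> sets (completion M)"
    using assms(1) A by (rule measurable_sets)
  then show "g -` A \<inter> space (completion M) \<in> sets (completion M)"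
    by (rule completion.in_sets_AE[rotated])
       (use AE_completion[OF assms(2)] in \<open>auto elim!: eventually_mono\<close>)
qed simp

text \<open>
  Over a complete measure, functions that agree almost everywhere are both measurable or both
  non-measurable; the default value of \<open>esssup\<close> is then the same for both.
\<close>

lemma Lp_qnorm_completion_cong:
  assumes "AE x in M. f x = g x"
  shows "Lp_qnorm p (completion M) f = Lp_qnorm p (completion M) g"
proof (cases "f \<in> borel_measurable (completion M)")
  case True
  moreover have "g \<in> borel_measurable (completion M)"
    using True assms by (rule measurable_completion_AE_cong)
  ultimately show ?thesis using AE_completion[OF assms] by (intro Lp_qnorm_cong_AE)
next
  case False
  moreover have "g \<notin> borel_measurable (completion M)"
    using False measurable_completion_AE_cong[of g M f] assms by (auto simp: eq_commute)
  moreover have "(\<integral>\<^sup>+x. ennpow (f x) r \<partial>completion M) = (\<integral>\<^sup>+x. ennpow (g x) r \<partial>completion M)" for r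
    using AE_completion[OF assms] by (intro nn_integral_cong_AE) (auto elim!: eventually_mono)
  ultimately show ?thesis by (simp add: Lp_qnorm_def esssup_non_measurable)
qed

text \<open>
  By Tonelli's theorem almost all slices of a null set are null.  On a
  null set of slices the inner quasi-norms may differ, which the next step of the induction ignores.
\<close>

lemma mixed_qnorm_null_cong:
  assumes "direct B" "N \<in> null_sets (sum_measure B)" "\<And>z. z \<notin> N \<Longrightarrow> f z = g z"
  shows "mixed_qnorm B f = mixed_qnorm B g"
  using assms
proof (induction B arbitrary: f g N)
  case Nil
  then have "(0::'a) \<notin> N" by (auto simp: null_sets_def emeasure_return indicator_def split: if_splits)
  then show ?case using Nil by simp
next
  case (Cons b B)
  obtain V p where b: "b = (V, p)" by force
  have V: "subspace V" "direct B" using Cons.prems b by auto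
  interpret sigma_finite_measure "lborel_on V" by (rule sigma_finite_lborel_on[OF V(1)])
  have [measurable]: "N \<in> sets borel" using Cons.prems(2) by auto
  define N' where "N' = {y. (\<integral>\<^sup>+x. indicator N (x + y) \<partial>lborel_on V) \<noteq> 0}"
  have "{y \<in> space borel. (\<integral>\<^sup>+x. indicator N (x + y) \<partial>lborel_on V) \<noteq> 0} \<in> sets borel" by measurable
  then have N'[measurable]: "N' \<in> sets borel" by (simp add: N'_def)
  have "0 = (\<integral>\<^sup>+z. indicator N z \<partial>sum_measure (b # B))"
    using Cons.prems(2) by (simp add: null_sets_def)
  also have "\<dots> = (\<integral>\<^sup>+y. \<integral>\<^sup>+x. indicator N (x + y) \<partial>lborel_on V \<partial>sum_measure B)"
    unfolding b by (rule nn_integral_sum_measure_Cons[OF V(1) sigma_finite_sum_measure[OF V(2)]]) measurable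
  finally have "AE y in sum_measure B. y \<notin> N'"
    by (subst (asm) eq_commute, subst (asm) nn_integral_0_iff_AE) (auto simp: N'_def)
  then have null: "N' \<in> null_sets (sum_measure B)"
    by (subst (asm) AE_iff_null) (auto simp: N'_def[symmetric])
  have eq: "Lp_qnorm p (lebesgue_subspace V) (\<lambda>x. f (x + y)) = Lp_qnorm p (lebesgue_subspace V) (\<lambda>x. g (x + y))"
    if "y \<notin> N'" for y
    unfolding lebesgue_subspace_eq
  proof (rule Lp_qnorm_completion_cong)
    have "(\<integral>\<^sup>+x. indicator N (x + y) \<partial>lborel_on V) = 0" using that by (simp add: N'_def)
    then have "AE x in lborel_on V. x + y \<notin> N"
      by (subst (asm) nn_integral_0_iff_AE) (auto simp: indicator_def elim!: eventually_mono split: if_splits)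
    then show "AE x in lborel_on V. f (x + y) = g (x + y)"
      using Cons.prems(3) by (auto elim!: eventually_mono)
  qed
  show ?case unfolding b mixed_qnorm.simps by (rule Cons.IH[OF V(2) null eq])
qed

lemma inverse_inverse_ennreal [simp]: "inverse (inverse x) = (x :: ennreal)"
  by (cases x; cases "x = 0") (auto simp: inverse_ennreal)

text \<open>
  The form in which \<open>is_mixed_space\<close> enters the estimates.
\<close>

definition decomposes :: "'a::euclidean_space mixed_space \<Rightarrow> bool" where
  "decomposes B \<longleftrightarrow> direct B \<and> sum_space B = UNIV \<and> pos_exponents B"

lemma zeros_in_subspaces:
  assumes "\<forall>(V, p)\<in>set B. subspace V"
  shows "\<forall>j<length B. replicate (length B) 0 ! j \<in> fst (B ! j)"
proof (intro allI impI)
  fix j assume j: "j < length B"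
  then have "subspace (fst (B ! j))" using assms nth_mem[OF j] by (cases "B ! j") auto
  then show "replicate (length B) 0 ! j \<in> fst (B ! j)" using j by (simp add: subspace_0)
qed

lemma sum_list_zeros: "sum_list (replicate n (0::'a::monoid_add)) = 0"
  by (induction n) auto

lemma sum_space_eq:
  "sum_space B = {sum_list xs | xs. length xs = length B \<and> (\<forall>j<length B. xs ! j \<in> fst (B ! j))}"
proof (induction B rule: sum_space.induct)
  case (2 V p B)
  show ?case
  proof (intro set_eqI iffI)
    fix z assume "z \<in> sum_space ((V, p) # B)"
    then obtain x xs where "z = x + sum_list xs" "x \<in> V" "length xs = length B" "\<forall>j<length B. xs ! j \<in> fst (B ! j)"
      by (auto simp: 2)
    then show "z \<in> {sum_list xs | xs. length xs = length ((V, p) # B) \<and> (\<forall>j<length ((V, p) # B). xs ! j \<in> fst (((V, p) # B) ! j))}"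
      by (intro CollectI exI[of _ "x # xs"]) (auto simp: nth_Cons split: nat.splits)
  next
    fix z assume "z \<in> {sum_list xs | xs. length xs = length ((V, p) # B) \<and> (\<forall>j<length ((V, p) # B). xs ! j \<in> fst (((V, p) # B) ! j))}"
    then obtain ys where ys: "z = sum_list ys" "length ys = Suc (length B)" "\<forall>j<Suc (length B). ys ! j \<in> fst (((V, p) # B) ! j)"
      by auto
    then obtain x xs where [simp]: "ys = x # xs" by (cases ys) auto
    have "x \<in> V" using ys(3) by (force dest: spec[of _ 0])
    moreover have "\<forall>j<length B. xs ! j \<in> fst (B ! j)" using ys(3) by auto
    ultimately show "z \<in> sum_space ((V, p) # B)" using ys by (auto simp: 2)
  qed
qed auto

text \<open>
  A vector \<open>v\<close> in the first subspace and in the sum of the others has the two decompositions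
  \<open>v + 0 + \<dots> + 0\<close> and \<open>0 + y\<^sub>2 + \<dots> + y\<^sub>m\<close>.
\<close>

lemma direct_if_unique:
  assumes "\<forall>(V, p)\<in>set B. subspace V"
    and "\<And>xs ys. length xs = length B \<Longrightarrow> length ys = length B \<Longrightarrow> \<forall>j<length B. xs ! j \<in> fst (B ! j)
       \<Longrightarrow> \<forall>j<length B. ys ! j \<in> fst (B ! j) \<Longrightarrow> sum_list xs = sum_list ys \<Longrightarrow> xs = ys"
  shows "direct B"
  using assms
proof (induction B)
  case (Cons b B)
  obtain V p where b: "b = (V, p)" by force
  have V: "subspace V" using Cons.prems b by auto
  have "direct B"
  proof (rule Cons.IH)
    fix xs ys assume *: "length xs = length B" "length ys = length B" "\<forall>j<length B. xs ! j \<in> fst (B ! j)"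
       "\<forall>j<length B. ys ! j \<in> fst (B ! j)" "sum_list xs = sum_list ys"
    have "0 # xs = 0 # ys"
      using * V b by (intro Cons.prems(2)) (auto simp: nth_Cons subspace_0 split: nat.splits)
    then show "xs = ys" by simp
  qed (use Cons.prems in auto)
  moreover have "v = 0" if v: "v \<in> V" "v \<in> sum_space B" for v
  proof -
    obtain ys where ys: "v = sum_list ys" "length ys = length B" "\<forall>j<length B. ys ! j \<in> fst (B ! j)"
      using v(2) by (auto simp: sum_space_eq)
    have "\<forall>j<length B. replicate (length B) 0 ! j \<in> fst (B ! j)"
      using Cons.prems(1) by (intro zeros_in_subspaces) auto
    then have "v # replicate (length B) 0 = 0 # ys"
      using ys v(1) V b
      by (intro Cons.prems(2)) (auto simp: nth_Cons subspace_0 sum_list_zeros split: nat.splits)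
    then show "v = 0" by simp
  qed
  ultimately show ?case
    using V subspace_sum_space[of B] by (auto simp: b subspace_0)
qed simp

lemma decomposes_if_mixed_space:
  assumes "is_mixed_space B"
  shows "decomposes B"
proof -
  have sub: "\<forall>(V, p)\<in>set B. subspace V \<and> 0 < p"
    and ex: "\<And>x. \<exists>!xs. length xs = length B \<and> (\<forall>j<length B. xs ! j \<in> fst (B ! j)) \<and> sum_list xs = x"
    using assms by (auto simp: is_mixed_space_def)
  have "direct B"
    using sub by (intro direct_if_unique) (auto, metis (full_types) ex)
  moreover have "sum_space B = UNIV"
    using ex by (auto simp: sum_space_eq) metis
  ultimately show ?thesis using sub by (auto simp: decomposes_def pos_exponents_def)
qed

lemma decomposes_map:
  assumes "decomposes B" "\<And>V p. (V, p) \<in> set B \<Longrightarrow> 0 < \<phi> p"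
  shows "decomposes (map (\<lambda>(V, p). (V, \<phi> p)) B)"
  using assms by (auto simp: decomposes_def pos_exponents_def)

lemma sum_measure_lborel:
  fixes B :: "'a::euclidean_space mixed_space"
  assumes "decomposes B"
  obtains c where "0 < c" "\<And>f. f \<in> borel_measurable borel \<Longrightarrow> (\<integral>\<^sup>+x. f x \<partial>sum_measure B) = ennreal c * (\<integral>\<^sup>+x. f x \<partial>lborel)"
  using sum_measure_eq_lborel[of B] assms by (auto simp: decomposes_def)

lemma AE_lborel_null_set:
  assumes "AE z in lborel. P z"
  obtains N where "N \<in> null_sets lborel" "\<And>z. z \<notin> N \<Longrightarrow> P z"
proof -
  obtain N where "{z \<in> space lborel. \<not> P z} \<subseteq> N" "emeasure lborel N = 0" "N \<in> sets lborel"
    by (rule AE_E[OF assms])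
  then show thesis using that[of N] by (auto simp: null_sets_def)
qed

text \<open>
  Lebesgue null sets are null for the iterated measure, which is proportional to Lebesgue measure.
  This reduces Lebesgue measurable functions to Borel representatives.
\<close>

lemma mixed_qnorm_AE_cong:
  assumes B: "decomposes B" and eq: "AE z in lborel. f z = g z"
  shows "mixed_qnorm B f = mixed_qnorm B g"
proof -
  obtain N where N: "N \<in> null_sets lborel" "\<And>z. z \<notin> N \<Longrightarrow> f z = g z"
    by (rule AE_lborel_null_set[OF eq]) blast
  obtain c where c: "\<And>f. f \<in> borel_measurable borel \<Longrightarrow> (\<integral>\<^sup>+x. f x \<partial>sum_measure B) = ennreal c * (\<integral>\<^sup>+x. f x \<partial>lborel)"
    by (rule sum_measure_lborel[OF B]) blast
  have "N \<in> null_sets (sum_measure B)"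
    using c[of "indicator N"] N(1) by (auto simp: null_sets_def)
  then show ?thesis
    using B N(2) by (intro mixed_qnorm_null_cong[of B N]) (auto simp: decomposes_def)
qed

lemma borel_representative:
  fixes f :: "'a::euclidean_space \<Rightarrow> ennreal"
  assumes "f \<in> borel_measurable lebesgue"
  obtains f0 where "f0 \<in> borel_measurable borel" "AE z in lborel. f z = f0 z"
  using completion_ex_borel_measurable[OF assms] by auto

lemma lebesgue_mixed_qnorm_mono:
  assumes B: "decomposes B" and f: "f \<in> borel_measurable lebesgue" and g: "g \<in> borel_measurable lebesgue"
    and le: "AE z in lborel. f z \<le> g z"
  shows "mixed_qnorm B f \<le> mixed_qnorm B g"
proof -
  obtain f0 where f0[measurable]: "f0 \<in> borel_measurable borel" "AE z in lborel. f z = f0 z"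
    using borel_representative[OF f] .
  obtain g0 where g0[measurable]: "g0 \<in> borel_measurable borel" "AE z in lborel. g z = g0 z"
    using borel_representative[OF g] .
  have "AE z in lborel. f z = min (f0 z) (g0 z)"
    using f0(2) g0(2) le by eventually_elim (auto simp: min_def)
  then have "mixed_qnorm B f = mixed_qnorm B (\<lambda>z. min (f0 z) (g0 z))"
    by (rule mixed_qnorm_AE_cong[OF B])
  also have "\<dots> \<le> mixed_qnorm B g0"
    using B by (intro mixed_qnorm_mono) (auto simp: decomposes_def)
  also have "\<dots> = mixed_qnorm B g"
    using mixed_qnorm_AE_cong[OF B g0(2)] by simp
  finally show ?thesis .
qed

lemma lebesgue_mixed_qnorm_cmult:
  assumes B: "decomposes B" and f: "f \<in> borel_measurable lebesgue" and c: "0 \<le> c"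
  shows "mixed_qnorm B (\<lambda>z. ennreal c * f z) = ennreal c * mixed_qnorm B f"
proof -
  obtain f0 where f0[measurable]: "f0 \<in> borel_measurable borel" "AE z in lborel. f z = f0 z"
    using borel_representative[OF f] .
  have "mixed_qnorm B (\<lambda>z. ennreal c * f z) = mixed_qnorm B (\<lambda>z. ennreal c * f0 z)"
    using f0(2) by (intro mixed_qnorm_AE_cong[OF B]) (auto elim!: eventually_mono)
  also have "\<dots> = ennreal c * mixed_qnorm B f0"
    using B c by (intro mixed_qnorm_cmult) (auto simp: decomposes_def)
  finally show ?thesis using mixed_qnorm_AE_cong[OF B f0(2)] by simp
qed

lemma lebesgue_mixed_qnorm_triangle:
  fixes B :: "'a::euclidean_space mixed_space"
  assumes B: "decomposes B"
  obtains K where "0 < K" "\<And>f g. f \<in> borel_measurable lebesgue \<Longrightarrow> g \<in> borel_measurable lebesgue \<Longrightarrow>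
     mixed_qnorm B (\<lambda>z. f z + g z) \<le> ennreal K * (mixed_qnorm B f + mixed_qnorm B g)"
proof -
  obtain K where K: "0 < K" "\<And>f g. f \<in> borel_measurable borel \<Longrightarrow> g \<in> borel_measurable borel \<Longrightarrow>
     mixed_qnorm B (\<lambda>z. f z + g z) \<le> ennreal K * (mixed_qnorm B f + mixed_qnorm B g)"
    using mixed_qnorm_triangle[of B] B by (auto simp: decomposes_def)
  have "mixed_qnorm B (\<lambda>z. f z + g z) \<le> ennreal K * (mixed_qnorm B f + mixed_qnorm B g)"
    if f: "f \<in> borel_measurable lebesgue" and g: "g \<in> borel_measurable lebesgue" for f g
  proof -
    obtain f0 where f0[measurable]: "f0 \<in> borel_measurable borel" "AE z in lborel. f z = f0 z"
      using borel_representative[OF f] .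
    obtain g0 where g0[measurable]: "g0 \<in> borel_measurable borel" "AE z in lborel. g z = g0 z"
      using borel_representative[OF g] .
    have "mixed_qnorm B (\<lambda>z. f z + g z) = mixed_qnorm B (\<lambda>z. f0 z + g0 z)"
      using f0(2) g0(2) by (intro mixed_qnorm_AE_cong[OF B]) (auto elim!: eventually_elim2)
    then show ?thesis
      using K(2)[OF f0(1) g0(1)] mixed_qnorm_AE_cong[OF B f0(2)] mixed_qnorm_AE_cong[OF B g0(2)] by simp
  qed
  then show thesis using that K(1) by blast
qed

lemma lebesgue_mixed_qnorm_tail:
  assumes B: "decomposes B" and p: "\<forall>(V, p)\<in>set B. p \<noteq> top"
    and f: "f \<in> borel_measurable lebesgue" and fin: "mixed_qnorm B f < top"
  shows "(\<lambda>n. mixed_qnorm B (\<lambda>z. f z * indicator {z. real n < norm z} z)) \<longlonglongrightarrow> 0"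
proof -
  obtain f0 where f0[measurable]: "f0 \<in> borel_measurable borel" "AE z in lborel. f z = f0 z"
    using borel_representative[OF f] .
  have "mixed_qnorm B (\<lambda>z. f z * indicator {z. real n < norm z} z) = mixed_qnorm B (\<lambda>z. f0 z * indicator {z. real n < norm z} z)" for n
    using f0(2) by (intro mixed_qnorm_AE_cong[OF B]) (auto elim!: eventually_mono)
  moreover have "(\<lambda>n. mixed_qnorm B (\<lambda>z. f0 z * indicator {z. real n < norm z} z)) \<longlonglongrightarrow> 0"
  proof (rule mixed_qnorm_dominated[OF _ _ p, where g = f0])
    show "mixed_qnorm B f0 < top" using fin mixed_qnorm_AE_cong[OF B f0(2)] by simp
    fix z :: 'a
    have "eventually (\<lambda>n. f0 z * indicator {z. real n < norm z} z = 0) sequentially"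
      using eventually_ge_at_top[of "nat \<lceil>norm z\<rceil>"] by eventually_elim (simp add: indicator_def nat_le_iff ceiling_le_iff)
    then show "(\<lambda>n. f0 z * indicator {z. real n < norm z} z) \<longlonglongrightarrow> 0"
      by (rule tendsto_eventually)
  qed (use B in \<open>auto simp: decomposes_def indicator_def\<close>)
  ultimately show ?thesis by simp
qed

lemma AE_lborel_dilation:
  assumes ae: "AE z in (lborel :: 'a::euclidean_space measure). P z" and r: "r \<noteq> 0"
  shows "AE z in (lborel :: 'a measure). P (r *\<^sub>R z)"
proof -
  obtain N where N: "N \<in> null_sets lborel" "\<And>z. z \<notin> N \<Longrightarrow> P z"
    by (rule AE_lborel_null_set[OF ae]) blast
  have [measurable]: "N \<in> sets borel" using N(1) by auto
  have "ennreal (\<bar>r\<bar> ^ DIM('a)) * (\<integral>\<^sup>+z. indicator N (r *\<^sub>R z) \<partial>(lborel :: 'a measure)) = 0"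
    using nn_integral_lborel_affine[of "indicator N" r "0::'a"] r N(1) by (simp add: null_sets_def)
  then have "(\<integral>\<^sup>+z. indicator N (r *\<^sub>R z) \<partial>(lborel :: 'a measure)) = 0"
    using r by simp
  then have "AE z in (lborel :: 'a measure). r *\<^sub>R z \<notin> N"
    by (subst (asm) nn_integral_0_iff_AE) (auto simp: indicator_def elim!: eventually_mono split: if_splits)
  then show ?thesis using N(2) by (auto elim!: eventually_mono)
qed

lemma lebesgue_mixed_qnorm_dilation:
  fixes B :: "'a::euclidean_space mixed_space"
  assumes B: "decomposes B"
  obtains k where "\<And>r f. 0 < r \<Longrightarrow> f \<in> borel_measurable lebesgue \<Longrightarrow>
     mixed_qnorm B (\<lambda>z. f (r *\<^sub>R z)) = ennreal (r powr k) * mixed_qnorm B f"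
proof -
  obtain k where k: "\<And>r f. 0 < r \<Longrightarrow> f \<in> borel_measurable borel \<Longrightarrow>
     mixed_qnorm B (\<lambda>z. f (r *\<^sub>R z)) = ennreal (r powr k) * mixed_qnorm B f"
    using mixed_qnorm_dilation[of B] B by (auto simp: decomposes_def)
  have "mixed_qnorm B (\<lambda>z. f (r *\<^sub>R z)) = ennreal (r powr k) * mixed_qnorm B f"
    if r: "0 < r" and f: "f \<in> borel_measurable lebesgue" for r f
  proof -
    obtain f0 where f0[measurable]: "f0 \<in> borel_measurable borel" "AE z in lborel. f z = f0 z"
      using borel_representative[OF f] .
    have "AE z in lborel. f (r *\<^sub>R z) = f0 (r *\<^sub>R z)"
      using AE_lborel_dilation[OF f0(2), of r] r by simp
    then show ?thesis
      using k[OF r f0(1)] mixed_qnorm_AE_cong[OF B] f0(2) by metis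
  qed
  then show thesis using that by blast
qed

lemma lebesgue_mixed_qnorm_Holder:
  fixes B :: "'a::euclidean_space mixed_space"
  assumes B: "decomposes B" and s: "0 < s" "s \<noteq> top"
    and \<phi>: "\<forall>(V, p)\<in>set B. 0 < \<phi> p \<and> inverse p + inverse (\<phi> p) = inverse s"
  obtains C where "0 < C" "\<And>f g. f \<in> borel_measurable lebesgue \<Longrightarrow> g \<in> borel_measurable lebesgue \<Longrightarrow>
     ennpow (\<integral>\<^sup>+z. ennpow (f z * g z) (enn2real s) \<partial>lborel) (1 / enn2real s)
       \<le> ennreal C * mixed_qnorm B f * mixed_qnorm (map (\<lambda>(V, p). (V, \<phi> p)) B) g"
proof -
  let ?B' = "map (\<lambda>(V, p). (V, \<phi> p)) B" and ?s = "enn2real s"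
  have B': "decomposes ?B'" using \<phi> by (intro decomposes_map[OF B]) auto
  have s': "0 < ?s" using s by (rule enn2real_pos)
  obtain c where c: "0 < c" "\<And>f. f \<in> borel_measurable borel \<Longrightarrow> (\<integral>\<^sup>+x. f x \<partial>sum_measure B) = ennreal c * (\<integral>\<^sup>+x. f x \<partial>lborel)"
    by (rule sum_measure_lborel[OF B]) blast
  have "ennpow (\<integral>\<^sup>+z. ennpow (f z * g z) ?s \<partial>lborel) (1 / ?s)
       \<le> ennreal ((1 / c) powr (1 / ?s)) * mixed_qnorm B f * mixed_qnorm ?B' g"
    if f: "f \<in> borel_measurable lebesgue" and g: "g \<in> borel_measurable lebesgue" for f g
  proof -
    obtain f0 where f0[measurable]: "f0 \<in> borel_measurable borel" "AE z in lborel. f z = f0 z"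
      using borel_representative[OF f] .
    obtain g0 where g0[measurable]: "g0 \<in> borel_measurable borel" "AE z in lborel. g z = g0 z"
      using borel_representative[OF g] .
    have "(\<integral>\<^sup>+z. ennpow (f z * g z) ?s \<partial>lborel) = (\<integral>\<^sup>+z. ennpow (f0 z * g0 z) ?s \<partial>lborel)"
      using f0(2) g0(2) by (intro nn_integral_cong_AE) (auto elim!: eventually_elim2)
    also have "\<dots> = ennreal (1 / c) * (\<integral>\<^sup>+z. ennpow (f0 z * g0 z) ?s \<partial>sum_measure B)"
      using c by (simp add: mult.assoc[symmetric] ennreal_mult'[symmetric])
    finally have "ennpow (\<integral>\<^sup>+z. ennpow (f z * g z) ?s \<partial>lborel) (1 / ?s)
        = ennreal ((1 / c) powr (1 / ?s)) * ennpow (\<integral>\<^sup>+z. ennpow (f0 z * g0 z) ?s \<partial>sum_measure B) (1 / ?s)"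
      using c(1) by (simp add: ennpow_mult)
    also have "ennpow (\<integral>\<^sup>+z. ennpow (f0 z * g0 z) ?s \<partial>sum_measure B) (1 / ?s)
        = mixed_qnorm (map (\<lambda>(V, p). (V, s)) B) (\<lambda>z. f0 z * g0 z)"
      using B s by (intro mixed_qnorm_const_exponent[symmetric]) (auto simp: decomposes_def)
    also have "\<dots> \<le> mixed_qnorm B f0 * mixed_qnorm ?B' g0"
      using B s \<phi> by (intro mixed_qnorm_Holder) (auto simp: decomposes_def pos_exponents_def)
    also have "mixed_qnorm B f0 = mixed_qnorm B f" using mixed_qnorm_AE_cong[OF B f0(2)] by simp
    also have "mixed_qnorm ?B' g0 = mixed_qnorm ?B' g" using mixed_qnorm_AE_cong[OF B' g0(2)] by simp
    finally show ?thesis by (simp add: mult.assoc mult_left_mono)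
  qed
  then show thesis using that[of "(1 / c) powr (1 / ?s)"] c(1) by auto
qed

text \<open>
  Hoelder's inequality with target exponent \<open>1\<close>.
\<close>

lemma dual_space_pairing_bound:
  fixes B :: "'a::euclidean_space mixed_space"
  assumes B: "decomposes B" and p: "\<forall>(V, p)\<in>set B. 1 \<le> p"
  obtains C where "0 < C" "\<And>f g. f \<in> borel_measurable lebesgue \<Longrightarrow> g \<in> borel_measurable lebesgue \<Longrightarrow>
     (\<integral>\<^sup>+z. f z * g z \<partial>lborel) \<le> ennreal C * mixed_qnorm B f * mixed_qnorm (dual_space B) g"
proof -
  have "0 < conj_exponent q \<and> inverse q + inverse (conj_exponent q) = inverse 1" if "1 \<le> q" for q
  proof -
    have "inverse q \<le> 1" using that
      by (cases q) (auto simp: inverse_ennreal inverse_le_1_iff)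
    then have "inverse q + (1 - inverse q) = 1" by (rule add_diff_inverse_ennreal)
    moreover have "1 - inverse q \<noteq> top" using ennreal_diff_le_mono_left[of 1 1 "inverse q"] by (auto simp: top_unique)
    ultimately show ?thesis by (simp add: conj_exponent_def ennreal_inverse_positive)
  qed
  then have \<phi>: "\<forall>(V, p)\<in>set B. 0 < conj_exponent p \<and> inverse p + inverse (conj_exponent p) = inverse 1"
    using p by auto
  show thesis
    by (rule lebesgue_mixed_qnorm_Holder[OF B _ _ \<phi>]) (use that in \<open>auto simp: dual_space_def\<close>)
qed

lemma decomposes_dual_space:
  assumes "decomposes B"
  shows "decomposes (dual_space B)"
  unfolding dual_space_def
proof (rule decomposes_map[OF assms])
  fix p :: ennreal
  have "1 - inverse p \<noteq> top" using ennreal_diff_le_mono_left[of 1 1 "inverse p"] by (auto simp: top_unique)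
  then show "0 < conj_exponent p" by (simp add: conj_exponent_def ennreal_inverse_positive)
qed

lemma small_exponent:
  assumes "pos_exponents B"
  obtains s where "0 < s" "s \<le> (1::real)" "\<forall>(V, p)\<in>set B. ennreal s < p"
proof -
  have "\<exists>s. 0 < s \<and> s \<le> (1::real) \<and> (\<forall>(V, p)\<in>set B. ennreal s < p)"
    using assms
  proof (induction B)
    case (Cons b B)
    obtain V p where b: "b = (V, p)" by force
    obtain s where s: "0 < s" "s \<le> (1::real)" "\<forall>(V, p)\<in>set B. ennreal s < p"
      using Cons b by auto
    obtain t where t: "0 < t" "ennreal t < p"
    proof (cases "p = top")
      case True
      then show thesis using that[of 1] by simp
    next
      case False
      then have p: "p = ennreal (enn2real p)" "0 < enn2real p"
        using Cons.prems b enn2real_pos[of p] by (auto simp: less_top)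
      have "ennreal (enn2real p / 2) < ennreal (enn2real p)" using p(2) by (simp add: ennreal_less_iff)
      then show thesis using that[of "enn2real p / 2"] p by simp
    qed
    have "ennreal (min s t) \<le> ennreal s" "ennreal (min s t) \<le> ennreal t" by (auto intro: ennreal_leI)
    then have "\<forall>(V, p)\<in>set (b # B). ennreal (min s t) < p"
      using s(3) t(2) b le_less_trans by fastforce
    then show ?case using s t by (intro exI[of _ "min s t"]) simp
  qed (auto intro: exI[of _ 1])
  then show thesis using that by blast
qed

text \<open>
  Hoelder's inequality with a Gaussian as second factor lowers all exponents to one common \<open>s \<le> 1\<close>
  below each of them.  The price is a Gaussian factor of arbitrarily slow decay, which is harmless for
  estimates of Gaussian type.
\<close>

lemma mixed_qnorm_lower_exponent:
  fixes B :: "'a::euclidean_space mixed_space"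
  assumes B: "decomposes B"
  obtains s where "0 < s" "s \<le> 1" "\<And>a f. 0 < a \<Longrightarrow> f \<in> borel_measurable lebesgue \<Longrightarrow> mixed_qnorm B f < top \<Longrightarrow>
     (\<integral>\<^sup>+z. ennpow (f z * gauss a z) s \<partial>lborel) < top"
proof -
  obtain s where s: "0 < s" "s \<le> (1::real)" "\<forall>(V, p)\<in>set B. ennreal s < p"
    using small_exponent B by (auto simp: decomposes_def)
  define \<phi> where "\<phi> p = inverse (inverse (ennreal s) - inverse p)" for p
  have invs: "inverse (ennreal s) \<noteq> top" using s by simp
  have \<phi>: "\<forall>(V, p)\<in>set B. 0 < \<phi> p \<and> inverse p + inverse (\<phi> p) = inverse (ennreal s)"
  proof safe
    fix V p assume "(V, p) \<in> set B"
    then have sp: "ennreal s < p" using s by auto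
    have "inverse p \<le> inverse (ennreal s)"
      using sp s(1) by (cases p) (auto simp: inverse_ennreal ennreal_less_iff intro!: ennreal_leI)
    then show "inverse p + inverse (\<phi> p) = inverse (ennreal s)"
      by (simp add: \<phi>_def add_diff_inverse_ennreal)
    have "inverse (ennreal s) - inverse p \<le> inverse (ennreal s)" by (rule diff_le_self_ennreal)
    then show "0 < \<phi> p" using invs by (auto simp: \<phi>_def ennreal_inverse_positive top_unique)
  qed
  let ?B' = "map (\<lambda>(V, p). (V, \<phi> p)) B"
  have B': "decomposes ?B'" using \<phi> by (intro decomposes_map[OF B]) auto
  have es: "enn2real (ennreal s) = s" using s by simp
  obtain C where C: "0 < C" "\<And>f g. f \<in> borel_measurable lebesgue \<Longrightarrow> g \<in> borel_measurable lebesgue \<Longrightarrow>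
     ennpow (\<integral>\<^sup>+z. ennpow (f z * g z) s \<partial>lborel) (1 / s) \<le> ennreal C * mixed_qnorm B f * mixed_qnorm ?B' g"
    using lebesgue_mixed_qnorm_Holder[OF B _ _ \<phi>] s unfolding es by auto
  have "(\<integral>\<^sup>+z. ennpow (f z * gauss a z) s \<partial>lborel) < top"
    if a: "0 < a" and f: "f \<in> borel_measurable lebesgue" "mixed_qnorm B f < top" for a f
  proof -
    have "gauss a \<in> borel_measurable (lebesgue :: 'a measure)"
      by (rule measurable_completion) measurable
    from C(2)[OF f(1) this]
    have "ennpow (\<integral>\<^sup>+z. ennpow (f z * gauss a z) s \<partial>lborel) (1 / s) \<le> ennreal C * mixed_qnorm B f * mixed_qnorm ?B' (gauss a)" .
    also have "\<dots> < top"
      using f(2) mixed_qnorm_gauss[of ?B' a] a B' by (simp add: ennreal_mult_less_top decomposes_def)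
    finally show ?thesis by (simp add: less_top[symmetric])
  qed
  then show thesis using that s by blast
qed

section \<open>Entire functions: mean values and growth\<close>

lemma scaleR_eq_vector_mult: "r *\<^sub>R (z :: complex^'d) = complex_of_real r *s z"
  unfolding vec_eq_iff vector_scaleR_component vector_smult_component by (simp add: scaleR_conv_of_real)

lemma entire_continuous: "entire F \<Longrightarrow> continuous_on UNIV F"
  unfolding entire_def by (intro continuous_at_imp_continuous_on) (auto dest: has_derivative_continuous)

lemma entire_borel_measurable [measurable_dest]: "entire F \<Longrightarrow> F \<in> borel_measurable borel"
  using entire_continuous by (rule borel_measurable_continuous_onI)

lemma linear_vector_mult_left: "linear (\<lambda>\<zeta>. \<zeta> *s (v :: complex^'d))"
  by (rule linearI) (auto simp: vec_eq_iff algebra_simps)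

lemma linear_vector_mult_right: "linear (\<lambda>v :: complex^'d. \<zeta> *s v)"
  by (rule linearI) (auto simp: vec_eq_iff algebra_simps)

lemma norm_vector_mult: "norm (\<zeta> *s (v :: complex^'d)) = cmod \<zeta> * norm v"
proof -
  have "L2_set (\<lambda>i. cmod \<zeta> * cmod (v $ i)) UNIV = cmod \<zeta> * L2_set (\<lambda>i. cmod (v $ i)) UNIV"
    by (rule L2_set_right_distrib[symmetric]) simp
  then show ?thesis by (simp add: norm_vec_def norm_mult)
qed

lemma entire_holomorphic_line:
  assumes "entire F"
  shows "(\<lambda>\<zeta>. F (a + \<zeta> *s v)) holomorphic_on S"
proof -
  have "\<exists>f'. ((\<lambda>\<zeta>. F (a + \<zeta> *s v)) has_field_derivative f') (at \<zeta>)" for \<zeta>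
  proof -
    obtain D where D: "(F has_derivative D) (at (a + \<zeta> *s v))" "\<And>c v. D (c *s v) = c * D v"
      using assms unfolding entire_def by blast
    have "((\<lambda>\<zeta>. a + \<zeta> *s v) has_derivative (\<lambda>h. h *s v)) (at \<zeta>)"
      using has_derivative_add[OF has_derivative_const[of a] bounded_linear_imp_has_derivative]
        linear_vector_mult_left[of v] by (simp add: linear_conv_bounded_linear)
    from has_derivative_compose[OF this D(1)]
    have "((\<lambda>\<zeta>. F (a + \<zeta> *s v)) has_derivative (\<lambda>h. D v * h)) (at \<zeta>)"
      by (simp add: D(2) mult.commute)
    then show ?thesis by (auto simp: has_field_derivative_def)
  qed
  then show ?thesis
    by (auto simp: holomorphic_on_def field_differentiable_def intro: has_field_derivative_at_within)
qed

lemma entire_dilation: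
  assumes "entire F"
  shows "entire (\<lambda>z. F (r *\<^sub>R z))"
  unfolding entire_def
proof
  fix z
  obtain D where D: "(F has_derivative D) (at (r *\<^sub>R z))" "\<And>c v. D (c *s v) = c * D v"
    using assms unfolding entire_def by blast
  have "((\<lambda>z. r *\<^sub>R z) has_derivative (\<lambda>h. r *\<^sub>R h)) (at z)"
    by (auto intro!: derivative_eq_intros)
  from has_derivative_compose[OF this D(1)]
  have "((\<lambda>z. F (r *\<^sub>R z)) has_derivative (\<lambda>h. D (r *\<^sub>R h))) (at z)" .
  moreover have "D (r *\<^sub>R (c *s v)) = c * D (r *\<^sub>R v)" for c v
    by (simp add: scaleR_eq_vector_mult D(2))
  ultimately show "\<exists>D. ((\<lambda>z. F (r *\<^sub>R z)) has_derivative D) (at z) \<and> (\<forall>c v. D (c *s v) = c * D v)"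
    by blast
qed

text \<open>
  The image of Lebesgue measure is translation invariant, and the proportionality factor is \<open>1\<close>
  because the isometry fixes the Gaussian.
\<close>

lemma nn_integral_lborel_isometry:
  fixes T :: "'a::euclidean_space \<Rightarrow> 'a"
  assumes T: "linear T" "\<And>v. norm (T v) = norm v" and f[measurable]: "f \<in> borel_measurable borel"
  shows "(\<integral>\<^sup>+v. f (T v) \<partial>lborel) = (\<integral>\<^sup>+v. f v \<partial>lborel)"
proof -
  have [measurable]: "T \<in> borel \<rightarrow>\<^sub>M borel"
    using T(1) by (intro borel_measurable_continuous_onI linear_continuous_on) (simp add: linear_conv_bounded_linear)
  define M where "M = distr lborel borel T"
  have M: "(\<integral>\<^sup>+x. g x \<partial>M) = (\<integral>\<^sup>+v. g (T v) \<partial>lborel)" if "g \<in> borel_measurable borel" for g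
    unfolding M_def by (rule nn_integral_distr) (use that in auto)
  have sets: "sets M = sets borel" by (simp add: M_def)
  let ?G = "\<integral>\<^sup>+v. gauss 1 v \<partial>(lborel :: 'a measure)"
  have G: "(\<integral>\<^sup>+v. gauss 1 v \<partial>M) = ?G" by (simp add: M T)
  have fin: "?G < \<infinity>" by (rule gauss_lborel) simp
  have "inj T" unfolding linear_injective_0[OF T(1)] using T(2) by (metis norm_eq_zero)
  then have "surj T" using T(1) linear_injective_imp_surjective by blast
  have "(\<integral>\<^sup>+v. f v \<partial>M) * ?G = (\<integral>\<^sup>+v. gauss 1 v \<partial>M) * (\<integral>\<^sup>+v. f v \<partial>lborel)"
  proof (rule translation_invariant_unique[OF sigma_finite_gauss[OF sets] sets])
    show "(\<integral>\<^sup>+v. gauss 1 v \<partial>M) < \<infinity>" using G fin by simp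
    fix g :: "'a \<Rightarrow> ennreal" and v assume [measurable]: "g \<in> borel_measurable borel"
    obtain w where w: "v = T w" using \<open>surj T\<close> by blast
    have "(\<integral>\<^sup>+x. g (v + x) \<partial>M) = (\<integral>\<^sup>+x. g (T (w + x)) \<partial>lborel)"
      by (simp add: M w linear_add[OF T(1)])
    also have "\<dots> = (\<integral>\<^sup>+x. g (T x) \<partial>lborel)"
      using nn_integral_lborel_affine[of "\<lambda>x. g (T x)" 1 w] by simp
    finally show "(\<integral>\<^sup>+x. g (v + x) \<partial>M) = (\<integral>\<^sup>+x. g x \<partial>M)" by (simp add: M)
  qed measurable
  moreover have "(\<integral>\<^sup>+v. f v \<partial>M) * ?G = ?G * (\<integral>\<^sup>+v. f (T v) \<partial>lborel)"
    by (simp only: M[OF f] mult.commute)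
  ultimately have "?G * (\<integral>\<^sup>+v. f (T v) \<partial>lborel) = ?G * (\<integral>\<^sup>+v. f v \<partial>lborel)"
    using G by (simp only:)
  then show ?thesis
    using fin gauss_lborel_nonzero[where 'a = 'a, of 1] unfolding ennreal_mult_cancel_left by auto
qed

lemma circle_mean_value:
  assumes "f holomorphic_on UNIV"
  shows "ennreal (2 * pi * cmod (f 0)) \<le> (\<integral>\<^sup>+t. ennreal (cmod (f (cis t))) * indicator {0..2*pi} t \<partial>lborel)"
proof -
  have "((\<lambda>u. f u / (u - 0)) has_contour_integral (2 * of_real pi * \<i> * f 0)) (circlepath 0 1)"
    using assms by (intro Cauchy_integral_circlepath_simple) (auto intro: holomorphic_on_subset)
  then have "((\<lambda>t. f (cis t) / cis t * \<i> * cis t) has_integral (2 * of_real pi * \<i> * f 0)) {0..2*pi}"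
    by (simp add: circlepath_def has_contour_integral_part_circlepath_iff)
  then have int: "((\<lambda>t. f (cis t) * \<i>) has_integral (2 * of_real pi * \<i> * f 0)) {0..2*pi}"
    by (simp add: field_simps)
  have "continuous_on {0..2*pi} (\<lambda>t. f (cis t) * \<i>)"
    using holomorphic_on_imp_continuous_on[OF assms]
    by (intro continuous_intros continuous_on_compose2[of UNIV f "{0..2*pi}" cis]) auto
  then have si: "set_integrable lborel {0..2*pi} (\<lambda>t. f (cis t) * \<i>)"
    by (rule borel_integrable_atLeastAtMost')
  have "(LINT t:{0..2*pi}|lborel. f (cis t) * \<i>) = 2 * of_real pi * \<i> * f 0"
    using set_borel_integral_eq_integral(2)[OF si] integral_unique[OF int] by (rule trans)
  then have "ennreal (2 * pi * cmod (f 0)) = ennreal (norm (LINT t:{0..2*pi}|lborel. f (cis t) * \<i>))"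
    by (simp add: norm_mult)
  also have "\<dots> \<le> (\<integral>\<^sup>+t. ennreal (norm (indicator {0..2*pi} t *\<^sub>R (f (cis t) * \<i>))) \<partial>lborel)"
    unfolding set_lebesgue_integral_def using si by (intro integral_norm_bound_ennreal) (simp add: set_integrable_def)
  also have "\<dots> = (\<integral>\<^sup>+t. ennreal (cmod (f (cis t))) * indicator {0..2*pi} t \<partial>lborel)"
    by (intro nn_integral_cong) (auto simp: indicator_def norm_mult)
  finally show ?thesis .
qed

text \<open>
  On the complex line through \<open>a\<close> and \<open>a + v\<close> the value at \<open>a\<close> is a circle mean.  Averaging over
  \<open>v\<close> in the ball and exchanging the integrals, one meets for each angle \<open>t\<close> the rotation
  \<open>v \<mapsto> exp(i t) v\<close>, which preserves the ball and Lebesgue measure.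
\<close>

lemma entire_ball_mean_value:
  fixes F :: "complex^'d \<Rightarrow> complex"
  assumes F: "entire F"
  shows "ennreal (cmod (F a)) * emeasure lborel (ball (0 :: complex^'d) r)
    \<le> (\<integral>\<^sup>+v. ennreal (cmod (F (a + v))) * indicator (ball 0 r) v \<partial>lborel)"
proof -
  let ?B = "ball (0 :: complex^'d) r" and ?L = "lborel :: (complex^'d) measure"
  note [measurable] = entire_borel_measurable[OF F]
  have [measurable]: "(\<lambda>(v, t). cis t *s v) \<in> borel_measurable (?L \<Otimes>\<^sub>M (lborel :: real measure))"
  proof -
    have "continuous_on UNIV (\<lambda>(v :: complex^'d, t). cis t *s v)"
      unfolding split_beta' vector_scalar_mult_def by (intro continuous_intros)
    from borel_measurable_continuous_onI[OF this] show ?thesis by (simp add: borel_prod[symmetric] cong: measurable_cong_sets)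
  qed
  have [measurable]: "?B \<in> sets borel" by simp
  have meas: "(\<lambda>v. ennreal (cmod (F (a + v))) * indicator ?B v) \<in> borel_measurable borel" by measurable
  have mean: "ennreal (2 * pi * cmod (F a)) \<le> (\<integral>\<^sup>+t. ennreal (cmod (F (a + cis t *s v))) * indicator {0..2*pi} t \<partial>lborel)" for v
    using circle_mean_value[OF entire_holomorphic_line[OF F, of a v]] by simp
  define I where "I = (\<integral>\<^sup>+v. ennreal (cmod (F (a + v))) * indicator ?B v \<partial>?L)"
  have rot: "(\<integral>\<^sup>+v. ennreal (cmod (F (a + cis t *s v))) * indicator ?B v \<partial>?L) = I" for t
  proof -
    have "(\<integral>\<^sup>+v. ennreal (cmod (F (a + cis t *s v))) * indicator ?B v \<partial>?L)
        = (\<integral>\<^sup>+v. ennreal (cmod (F (a + cis t *s v))) * indicator ?B (cis t *s v) \<partial>?L)"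
      by (intro nn_integral_cong) (simp add: indicator_def norm_vector_mult)
    also have "\<dots> = I"
      unfolding I_def
      by (rule nn_integral_lborel_isometry[OF linear_vector_mult_right _ meas, of "cis t"])
         (simp add: norm_vector_mult)
    finally show ?thesis .
  qed
  have "ennreal (2 * pi * cmod (F a)) * emeasure ?L ?B = (\<integral>\<^sup>+v. ennreal (2 * pi * cmod (F a)) * indicator ?B v \<partial>?L)"
    by (rule nn_integral_cmult_indicator[symmetric]) simp
  also have "\<dots> \<le> (\<integral>\<^sup>+v. (\<integral>\<^sup>+t. ennreal (cmod (F (a + cis t *s v))) * indicator {0..2*pi} t \<partial>lborel) * indicator ?B v \<partial>?L)"
    by (intro nn_integral_mono mult_right_mono mean) auto
  also have "\<dots> = (\<integral>\<^sup>+v. \<integral>\<^sup>+t. ennreal (cmod (F (a + cis t *s v))) * indicator {0..2*pi} t * indicator ?B v \<partial>lborel \<partial>?L)"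
    by (intro nn_integral_cong nn_integral_multc[symmetric]) measurable
  also have "\<dots> = (\<integral>\<^sup>+t. \<integral>\<^sup>+v. ennreal (cmod (F (a + cis t *s v))) * indicator {0..2*pi} t * indicator ?B v \<partial>?L \<partial>lborel)"
    by (rule lborel_pair.Fubini'[symmetric]) measurable
  also have "\<dots> = (\<integral>\<^sup>+t. (\<integral>\<^sup>+v. ennreal (cmod (F (a + cis t *s v))) * indicator ?B v \<partial>?L) * indicator {0..2*pi} t \<partial>lborel)"
    by (subst nn_integral_multc[symmetric]) (auto simp: mult_ac)
  also have "\<dots> = I * ennreal (2 * pi)"
    by (simp add: rot nn_integral_cmult_indicator)
  finally have "ennreal (2 * pi) * (ennreal (cmod (F a)) * emeasure ?L ?B) \<le> ennreal (2 * pi) * I"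
    by (simp add: ennreal_mult' mult_ac)
  then show ?thesis
    unfolding I_def by (subst (asm) ennreal_mult_le_mult_iff) auto
qed

text \<open>
  Subharmonicity of \<open>|F|\<^sup>s\<close> for \<open>s < 1\<close> is replaced by the following argument.  Let \<open>n\<close> be
  the real dimension, let \<open>v\<^sub>0\<close> maximize
  \<open>\<psi>(v) = |F(a + v)| (1 - |v|)\<^sup>n\<^sup>/\<^sup>s\<close> on the unit ball and let \<open>r\<close> be half its distance to the boundary.
  On the ball of radius \<open>r\<close> about \<open>v\<^sub>0\<close> the maximality of \<open>\<psi>\<close> gives \<open>|F| \<le> 2\<^sup>n\<^sup>/\<^sup>s |F(a + v\<^sub>0)|\<close>.  In the
  mean value inequality at \<open>v\<^sub>0\<close> one can thus write \<open>|F| = |F|\<^sup>1\<^sup>-\<^sup>s |F|\<^sup>s\<close>, estimate the first factor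
  by a constant times \<open>|F(a + v\<^sub>0)|\<^sup>1\<^sup>-\<^sup>s\<close>, and cancel.  This bounds \<open>\<psi>(v\<^sub>0)\<close>, which is at least \<open>|F(a)|\<close>.
\<close>

lemma entire_small_power_bound:
  fixes s :: real
  assumes s: "0 < s" "s \<le> 1"
  obtains C where "0 < C" "\<And>(F :: complex^'d \<Rightarrow> complex) a. entire F \<Longrightarrow>
     ennreal (cmod (F a) powr s) \<le> ennreal C * (\<integral>\<^sup>+v. ennreal (cmod (F (a + v)) powr s) * indicator (ball 0 1) v \<partial>lborel)"
proof -
  let ?L = "lborel :: (complex^'d) measure"
  define n where "n = real DIM(complex^'d)"
  define m where "m = measure ?L (ball 0 1)"
  have m: "emeasure ?L (ball 0 1) = ennreal m" "0 < m"
    unfolding m_def using content_ball_pos[of 1 "0 :: complex^'d"] emeasure_lborel_ball_finite[of "0 :: complex^'d" 1]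
    by (auto simp: emeasure_eq_ennreal_measure)
  have n: "0 < n" by (simp add: n_def)
  \<comment> \<open>\<open>m r\<^sup>n\<close> is the volume of the ball of radius \<open>r\<close>.  The two powers of \<open>2\<close> come from \<open>1 - |v\<^sub>0| = 2 r\<close>
    and from the comparison of \<open>F\<close> with its value at the maximum point.\<close>
  define C where "C = 2 powr n * 2 powr (n * (1 - s) / s) / m"
  have C: "0 < C" using m by (simp add: C_def)
  have "ennreal (cmod (F a) powr s) \<le> ennreal C * (\<integral>\<^sup>+v. ennreal (cmod (F (a + v)) powr s) * indicator (ball 0 1) v \<partial>?L)"
    if F: "entire F" for F :: "complex^'d \<Rightarrow> complex" and a
  proof (cases "F a = 0")
    case False
    note [measurable] = entire_borel_measurable[OF F]
    define g where "g v = cmod (F (a + v))" for v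
    define I where "I = (\<integral>\<^sup>+v. ennreal (g v powr s) * indicator (ball 0 1) v \<partial>?L)"
    define \<psi> where "\<psi> v = g v * (1 - norm v) powr (n / s)" for v
    have g0: "0 < g 0" using False by (simp add: g_def)
    have [measurable]: "g \<in> borel_measurable borel" unfolding g_def by measurable
    have [measurable]: "ball (0 :: complex^'d) 1 \<in> sets borel" by simp
    have "continuous_on UNIV (\<lambda>v. F (a + v))"
      by (rule continuous_on_compose2[OF entire_continuous[OF F]]) (auto intro!: continuous_intros)
    then have "continuous_on (cball 0 1) g"
      unfolding g_def by (intro continuous_on_norm) (rule continuous_on_subset, auto)
    then have "continuous_on (cball 0 1) \<psi>"
      unfolding \<psi>_def using n s by (intro continuous_intros continuous_on_powr') auto
    then obtain v0 where v0: "v0 \<in> cball 0 1" "\<And>v. v \<in> cball 0 1 \<Longrightarrow> \<psi> v \<le> \<psi> v0"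
      using continuous_attains_sup[OF compact_cball, of 0 1 \<psi>] by auto
    have K: "g 0 \<le> \<psi> v0" using v0(2)[of 0] by (simp add: \<psi>_def)
    then have "norm v0 \<noteq> 1" using g0 n s by (auto simp: \<psi>_def)
    then have nv: "norm v0 < 1" using v0(1) by simp
    define r where "r = (1 - norm v0) / 2"
    have r: "0 < r" "1 - norm v0 = 2 * r" using nv by (auto simp: r_def)
    have gv0: "0 < g v0" using K g0 r(1) by (auto simp: \<psi>_def g_def zero_less_mult_iff)
    have bound: "g (v0 + w) \<le> 2 powr (n / s) * g v0" and sub: "v0 + w \<in> ball 0 1" if w: "w \<in> ball 0 r" for w
    proof -
      have nw: "r \<le> 1 - norm (v0 + w)" using norm_triangle_ineq[of v0 w] w r by simp
      then show "v0 + w \<in> ball 0 1" using r by simp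
      then have "\<psi> (v0 + w) \<le> \<psi> v0" by (intro v0) simp
      moreover have "g (v0 + w) * r powr (n / s) \<le> \<psi> (v0 + w)"
        unfolding \<psi>_def using nw r n s by (intro mult_left_mono powr_mono2) (auto simp: g_def)
      moreover have "\<psi> v0 = (2 powr (n / s) * g v0) * r powr (n / s)"
        using r by (simp add: \<psi>_def powr_mult)
      ultimately have "g (v0 + w) * r powr (n / s) \<le> (2 powr (n / s) * g v0) * r powr (n / s)"
        by simp
      then show "g (v0 + w) \<le> 2 powr (n / s) * g v0" using r by simp
    qed
    \<comment> \<open>The bound of \<open>|F|\<^sup>1\<^sup>-\<^sup>s\<close> on the small ball.\<close>
    define Q where "Q = (2 powr (n / s) * g v0) powr (1 - s)"
    have Q: "Q = 2 powr (n * (1 - s) / s) * g v0 powr (1 - s)"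
      by (simp add: Q_def powr_mult powr_powr g_def)
    have "ennreal (g v0) * emeasure ?L (ball 0 r) \<le> (\<integral>\<^sup>+w. ennreal (g (v0 + w)) * indicator (ball 0 r) w \<partial>?L)"
      using entire_ball_mean_value[OF F, of "a + v0" r] by (simp add: g_def add.assoc)
    also have "\<dots> \<le> (\<integral>\<^sup>+w. ennreal Q * (ennreal (g (v0 + w) powr s) * indicator (ball 0 1) (v0 + w)) \<partial>?L)"
    proof (intro nn_integral_mono)
      fix w
      show "ennreal (g (v0 + w)) * indicator (ball 0 r) w \<le> ennreal Q * (ennreal (g (v0 + w) powr s) * indicator (ball 0 1) (v0 + w))"
      proof (cases "w \<in> ball 0 r")
        case True
        have "g (v0 + w) = g (v0 + w) powr (1 - s) * g (v0 + w) powr s"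
          by (simp add: powr_add[symmetric] g_def)
        also have "\<dots> \<le> Q * g (v0 + w) powr s"
          unfolding Q_def using bound[OF True] s by (intro mult_right_mono powr_mono2) (auto simp: g_def)
        finally have "ennreal (g (v0 + w)) \<le> ennreal (Q * g (v0 + w) powr s)" by (rule ennreal_leI)
        then show ?thesis using True sub[OF True] by (simp add: ennreal_mult' Q_def)
      qed simp
    qed
    also have "\<dots> = ennreal Q * (\<integral>\<^sup>+w. ennreal (g (v0 + w) powr s) * indicator (ball 0 1) (v0 + w) \<partial>?L)"
      by (rule nn_integral_cmult) measurable
    also have "(\<integral>\<^sup>+w. ennreal (g (v0 + w) powr s) * indicator (ball 0 1) (v0 + w) \<partial>?L) = I"
      using nn_integral_lborel_affine[of "\<lambda>w. ennreal (g w powr s) * indicator (ball 0 1) w" 1 v0] by (simp add: I_def)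
    finally have le: "ennreal (g v0) * emeasure ?L (ball 0 r) \<le> ennreal Q * I" .
    have ball_r: "emeasure ?L (ball 0 r) = ennreal (r powr n * m)"
      using content_ball_conv_unit_ball[of r "0 :: complex^'d"] r(1) emeasure_lborel_ball_finite[of "0 :: complex^'d" r]
        powr_realpow[OF r(1), of "DIM(complex^'d)"]
      by (simp add: m_def n_def emeasure_eq_ennreal_measure)
    have "ennreal (g 0 powr s) \<le> ennreal ((g v0 * (2 * r) powr (n / s)) powr s)"
      using K r s g0 by (intro ennreal_leI powr_mono2) (auto simp: \<psi>_def)
    also have "(g v0 * (2 * r) powr (n / s)) powr s = g v0 powr s * 2 powr n * r powr n"
      using gv0 r s by (simp add: powr_mult powr_powr)
    also have "\<dots> = (2 powr n / m * g v0 powr (s - 1)) * (g v0 * (r powr n * m))"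
      using m gv0 by (simp add: powr_diff field_simps)
    also have "ennreal \<dots> = ennreal (2 powr n / m * g v0 powr (s - 1)) * (ennreal (g v0) * emeasure ?L (ball 0 r))"
    proof -
      have "0 \<le> 2 powr n / m * g v0 powr (s - 1)" using m by simp
      then show ?thesis
        unfolding ball_r by (simp only: ennreal_mult' ennreal_mult'[OF less_imp_le[OF gv0]])
    qed
    also have "\<dots> \<le> ennreal (2 powr n / m * g v0 powr (s - 1)) * (ennreal Q * I)"
      by (intro mult_left_mono le) simp
    also have "\<dots> = ennreal (2 powr n / m * g v0 powr (s - 1) * Q) * I"
    proof -
      have "0 \<le> 2 powr n / m * g v0 powr (s - 1)" using m by simp
      then show ?thesis by (simp only: ennreal_mult' mult.assoc[of _ "ennreal Q" I])
    qed
    also have "2 powr n / m * g v0 powr (s - 1) * Q = C * (g v0 powr (s - 1) * g v0 powr (1 - s))"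
      by (simp add: C_def Q)
    also have "\<dots> = C" using gv0 by (simp add: powr_add[symmetric])
    finally show ?thesis by (simp add: I_def g_def)
  qed (use s in simp)
  then show thesis using that C by blast
qed

text \<open>
  The local bound is applied on the unit ball about \<open>a\<close>, where \<open>|w|\<^sup>2 \<le> (|a| + 1)\<^sup>2\<close>; the loss in
  replacing this by \<open>|a|\<^sup>2\<close> is the factor \<open>1 + \<eta>\<close> and a constant.
\<close>

lemma entire_growth_bound:
  fixes F :: "complex^'d \<Rightarrow> complex" and s b \<eta> :: real
  assumes F: "entire F" and s: "0 < s" "s \<le> 1" and b: "0 \<le> b" and \<eta>: "0 < \<eta>"
    and fin: "(\<integral>\<^sup>+w. ennreal (cmod (F w) powr s * exp (- s * b * (norm w)\<^sup>2)) \<partial>lborel) < \<infinity>"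
  shows "\<exists>M\<ge>0. \<forall>w. cmod (F w) \<le> M * exp (b * (1 + \<eta>) * (norm w)\<^sup>2)"
proof -
  obtain C where C: "0 < C" "\<And>(F :: complex^'d \<Rightarrow> complex) a. entire F \<Longrightarrow>
     ennreal (cmod (F a) powr s) \<le> ennreal C * (\<integral>\<^sup>+v. ennreal (cmod (F (a + v)) powr s) * indicator (ball 0 1) v \<partial>lborel)"
    using entire_small_power_bound[OF s] by blast
  note [measurable] = entire_borel_measurable[OF F]
  define J where "J = (\<integral>\<^sup>+w. ennreal (cmod (F w) powr s * exp (- s * b * (norm w)\<^sup>2)) \<partial>lborel)"
  obtain j where j: "J = ennreal j" "0 \<le> j" using fin by (cases J) (auto simp: J_def)
  define M where "M = (C * j * exp (s * b * (1 + 1 / \<eta>))) powr (1 / s)"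
  have "cmod (F a) \<le> M * exp (b * (1 + \<eta>) * (norm a)\<^sup>2)" for a
  proof -
    have sq: "(norm (a + v))\<^sup>2 \<le> (1 + \<eta>) * (norm a)\<^sup>2 + (1 + 1 / \<eta>)" if "v \<in> ball 0 1" for v
    proof -
      have "norm (a + v) \<le> norm a + 1" using norm_triangle_ineq[of a v] that by simp
      then have "(norm (a + v))\<^sup>2 \<le> (norm a + 1)\<^sup>2" by (intro power_mono) auto
      also have "\<dots> \<le> (1 + \<eta>) * (norm a)\<^sup>2 + (1 + 1 / \<eta>)"
      proof -
        have "0 \<le> (\<eta> * norm a - 1)\<^sup>2 / \<eta>" using \<eta> by simp
        also have "\<dots> = \<eta> * (norm a)\<^sup>2 + 1 / \<eta> - 2 * norm a"
          using \<eta> by (simp add: power2_eq_square field_simps)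
        finally show ?thesis by (simp add: power2_eq_square algebra_simps)
      qed
      finally show ?thesis .
    qed
    define E where "E = exp (s * b * ((1 + \<eta>) * (norm a)\<^sup>2 + (1 + 1 / \<eta>)))"
    have "ennreal (cmod (F (a + v)) powr s) * indicator (ball 0 1) v
        \<le> ennreal E * ennreal (cmod (F (a + v)) powr s * exp (- s * b * (norm (a + v))\<^sup>2))" for v
    proof (cases "v \<in> ball 0 1")
      case True
      have "s * b * (norm (a + v))\<^sup>2 \<le> s * b * ((1 + \<eta>) * (norm a)\<^sup>2 + (1 + 1 / \<eta>))"
        using sq[OF True] s b by (intro mult_left_mono) auto
      then have "1 \<le> E * exp (- s * b * (norm (a + v))\<^sup>2)"
        by (simp add: E_def exp_add[symmetric])
      then have "cmod (F (a + v)) powr s * 1 \<le> cmod (F (a + v)) powr s * (E * exp (- s * b * (norm (a + v))\<^sup>2))"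
        by (rule mult_left_mono) simp
      then have "ennreal (cmod (F (a + v)) powr s) \<le> ennreal (E * (cmod (F (a + v)) powr s * exp (- s * b * (norm (a + v))\<^sup>2)))"
        by (intro ennreal_leI) (simp add: mult_ac)
      then show ?thesis using True by (simp add: ennreal_mult' E_def)
    qed simp
    then have "(\<integral>\<^sup>+v. ennreal (cmod (F (a + v)) powr s) * indicator (ball 0 1) v \<partial>lborel)
        \<le> (\<integral>\<^sup>+v. ennreal E * ennreal (cmod (F (a + v)) powr s * exp (- s * b * (norm (a + v))\<^sup>2)) \<partial>lborel)"
      by (rule nn_integral_mono)
    also have "\<dots> = ennreal E * (\<integral>\<^sup>+v. ennreal (cmod (F (a + v)) powr s * exp (- s * b * (norm (a + v))\<^sup>2)) \<partial>lborel)"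
      by (rule nn_integral_cmult) measurable
    also have "(\<integral>\<^sup>+v. ennreal (cmod (F (a + v)) powr s * exp (- s * b * (norm (a + v))\<^sup>2)) \<partial>lborel) = J"
      using nn_integral_lborel_affine[of "\<lambda>w. ennreal (cmod (F w) powr s * exp (- s * b * (norm w)\<^sup>2))" 1 a]
      by (simp add: J_def)
    finally have "ennreal C * (\<integral>\<^sup>+v. ennreal (cmod (F (a + v)) powr s) * indicator (ball 0 1) v \<partial>lborel)
        \<le> ennreal C * (ennreal E * ennreal j)"
      unfolding j(1) by (rule mult_left_mono) simp
    with C(2)[OF F, of a] have "ennreal (cmod (F a) powr s) \<le> ennreal C * (ennreal E * ennreal j)"
      by (rule order_trans)
    also have "\<dots> = ennreal (C * (E * j))" using C(1) by (simp add: ennreal_mult' E_def)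
    finally have "cmod (F a) powr s \<le> C * (E * j)"
      using C(1) j(2) by (subst (asm) ennreal_le_iff) (auto simp: E_def)
    then have "(cmod (F a) powr s) powr (1 / s) \<le> (C * (E * j)) powr (1 / s)"
      using s by (intro powr_mono2) auto
    also have "C * (E * j) = C * j * exp (s * b * (1 + 1 / \<eta>)) * exp (s * (b * (1 + \<eta>) * (norm a)\<^sup>2))"
      by (simp add: E_def exp_add[symmetric] algebra_simps)
    also have "\<dots> powr (1 / s) = M * exp (b * (1 + \<eta>) * (norm a)\<^sup>2)"
      using C(1) j(2) s by (simp add: powr_mult M_def powr_def[of "exp _"])
    finally show ?thesis using s by (simp add: powr_powr)
  qed
  then show ?thesis by (intro exI[of _ M]) (auto simp: M_def)
qed

section \<open>The expansion into homogeneous parts\<close>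

text \<open>
  The homogeneous part of degree \<open>n\<close>, read off from the restriction of \<open>F\<close> to the complex line
  through \<open>w\<close>.
\<close>

definition taylor_part :: "(complex^'d \<Rightarrow> complex) \<Rightarrow> nat \<Rightarrow> complex^'d \<Rightarrow> complex" where
  "taylor_part F n w = (deriv ^^ n) (\<lambda>\<zeta>. F (\<zeta> *s w)) 0 / fact n"

lemma entire_holomorphic_ray: "entire F \<Longrightarrow> (\<lambda>\<zeta>. F (\<zeta> *s w)) holomorphic_on S"
  using entire_holomorphic_line[of F 0 w S] by simp

lemma taylor_part_bound:
  assumes F: "entire F" and R: "0 < R" and M: "\<And>\<zeta>. cmod \<zeta> = R \<Longrightarrow> cmod (F (\<zeta> *s w)) \<le> M"
  shows "cmod (taylor_part F n w) \<le> M / R ^ n"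
proof -
  have "cmod ((deriv ^^ n) (\<lambda>\<zeta>. F (\<zeta> *s w)) 0) \<le> fact n * M / R ^ n"
    using R M by (intro Cauchy_inequality entire_holomorphic_ray[OF F]
        holomorphic_on_imp_continuous_on[OF entire_holomorphic_ray[OF F]]) auto
  then show ?thesis
    by (simp add: taylor_part_def norm_divide field_simps)
qed

lemma taylor_sums:
  assumes "entire F"
  shows "(\<lambda>n. taylor_part F n w * \<zeta> ^ n) sums F (\<zeta> *s w)"
  using holomorphic_power_series[OF entire_holomorphic_ray[OF assms, of w], of \<zeta> 0 "cmod \<zeta> + 1"]
  by (simp add: taylor_part_def)

text \<open>
  Cauchy's estimates on the circle of radius \<open>R\<close> bound the remainder by a geometric series.
\<close>

lemma taylor_tail:
  assumes F: "entire F" and \<zeta>: "cmod \<zeta> < R" and M: "\<And>\<zeta>. cmod \<zeta> = R \<Longrightarrow> cmod (F (\<zeta> *s w)) \<le> M"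
  shows "cmod (F (\<zeta> *s w) - (\<Sum>m<N. taylor_part F m w * \<zeta> ^ m)) \<le> M * (cmod \<zeta> / R) ^ N / (1 - cmod \<zeta> / R)"
proof -
  have R: "0 < R" using \<zeta> norm_ge_zero[of \<zeta>] by linarith
  define q where "q = cmod \<zeta> / R"
  have q: "0 \<le> q" "q < 1" using \<zeta> R by (auto simp: q_def)
  have s: "(\<lambda>n. taylor_part F (n + N) w * \<zeta> ^ (n + N)) sums (F (\<zeta> *s w) - (\<Sum>m<N. taylor_part F m w * \<zeta> ^ m))"
    by (rule sums_split_initial_segment[OF taylor_sums[OF F]])
  have g: "(\<lambda>n. M * q ^ N * q ^ n) sums (M * q ^ N * (1 / (1 - q)))"
    using q by (intro sums_mult geometric_sums) simp
  have "cmod (taylor_part F (n + N) w * \<zeta> ^ (n + N)) \<le> M * q ^ N * q ^ n" for n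
  proof -
    have "cmod (taylor_part F (n + N) w * \<zeta> ^ (n + N)) \<le> M / R ^ (n + N) * cmod \<zeta> ^ (n + N)"
      unfolding norm_mult norm_power by (intro mult_right_mono taylor_part_bound[OF F R M]) auto
    also have "\<dots> = M * q ^ N * q ^ n" by (simp add: q_def power_divide power_add mult_ac)
    finally show ?thesis .
  qed
  then have "cmod (F (\<zeta> *s w) - (\<Sum>m<N. taylor_part F m w * \<zeta> ^ m)) \<le> M * q ^ N * (1 / (1 - q))"
    by (rule norm_sums_le[OF s g])
  then show ?thesis by (simp add: q_def)
qed

text \<open>
  Cauchy's estimate on the circle of radius \<open>1/\<rho>\<close>, whose points carry \<open>w\<close>
  into the unit ball.
\<close>

lemma taylor_part_growth:
  fixes F :: "complex^'d \<Rightarrow> complex"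
  assumes F: "entire F"
  obtains M where "0 \<le> M" "\<And>v. norm v \<le> 1 \<Longrightarrow> cmod (F v) \<le> M"
    "\<And>n w \<rho>. 0 < \<rho> \<Longrightarrow> norm w \<le> \<rho> \<Longrightarrow> cmod (taylor_part F n w) \<le> M * \<rho> ^ n"
proof -
  have "compact (F ` cball 0 1)"
    using entire_continuous[OF F] by (intro compact_continuous_image) (auto intro: continuous_on_subset)
  then obtain M where M: "\<And>v. norm v \<le> 1 \<Longrightarrow> cmod (F v) \<le> M"
    using compact_imp_bounded bounded_iff by (metis image_eqI mem_cball_0)
  have "cmod (taylor_part F n w) \<le> M * \<rho> ^ n" if "0 < \<rho>" "norm w \<le> \<rho>" for n w \<rho>
  proof -
    have "cmod (taylor_part F n w) \<le> M / (1 / \<rho>) ^ n"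
      using that by (intro taylor_part_bound[OF F] M) (auto simp: norm_vector_mult)
    then show ?thesis by (simp add: power_one_over)
  qed
  moreover have "0 \<le> M" using order_trans[OF norm_ge_zero M[of 0]] by simp
  ultimately show thesis using that M by blast
qed

text \<open>
  By induction: the part of degree \<open>n\<close> at \<open>u\<close> is the limit, locally uniform in \<open>u\<close>, of
  \<open>(F(\<epsilon> u) - \<Sum>\<^sub>m\<^sub><\<^sub>n \<epsilon>\<^sup>m P\<^sub>m(u)) / \<epsilon>\<^sup>n\<close> as \<open>\<epsilon> \<rightarrow> 0\<close>, where \<open>P\<^sub>m\<close> is the part
  of degree \<open>m\<close>, since the remainder of the expansion of \<open>F(\<epsilon> u)\<close> is of
  order \<open>\<epsilon>\<^sup>n\<^sup>+\<^sup>1\<close> by \<open>taylor_tail\<close>.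
\<close>

lemma taylor_part_holomorphic:
  fixes F :: "complex^'d \<Rightarrow> complex"
  assumes F: "entire F"
  shows "(\<lambda>t. taylor_part F n (w + t *s v)) holomorphic_on UNIV"
proof (induction n rule: less_induct)
  case (less n)
  obtain M where M: "0 \<le> M" "\<And>v. norm v \<le> 1 \<Longrightarrow> cmod (F v) \<le> M" using taylor_part_growth[OF F] by metis
  define e where "e k = 1 / real (Suc k)" for k
  have e: "0 < e k" for k by (simp add: e_def)
  define f where "f k t = (F (of_real (e k) *s (w + t *s v))
      - (\<Sum>m<n. taylor_part F m (w + t *s v) * of_real (e k) ^ m)) / of_real (e k) ^ n" for k t
  show ?case
  proof (rule holomorphic_uniform_sequence[OF open_UNIV])
    fix k
    have "(\<lambda>t. F (of_real (e k) *s w + t *s (of_real (e k) *s v))) holomorphic_on UNIV"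
      by (rule entire_holomorphic_line[OF F])
    moreover have "of_real (e k) *s w + t *s (of_real (e k) *s v) = of_real (e k) *s (w + t *s v)" for t
      by (simp add: vec_eq_iff algebra_simps)
    ultimately have "(\<lambda>t. F (of_real (e k) *s (w + t *s v))) holomorphic_on UNIV" by (simp only:)
    then show "f k holomorphic_on UNIV"
      unfolding f_def using e[of k] less.IH by (intro holomorphic_intros) auto
  next
    fix x :: complex
    define \<rho> where "\<rho> = norm w + (cmod x + 1) * norm v + 1"
    have \<rho>: "0 < \<rho>" by (simp add: \<rho>_def add_nonneg_pos)
    have lim_e: "e \<longlonglongrightarrow> 0" unfolding e_def[abs_def] by (rule LIMSEQ_Suc[OF lim_1_over_n])
    have "uniform_limit (cball x 1) f (\<lambda>t. taylor_part F n (w + t *s v)) sequentially"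
    proof (rule uniform_limitI)
      fix \<epsilon> :: real assume \<epsilon>: "0 < \<epsilon>"
      have "(\<lambda>k. 2 * M * \<rho> ^ Suc n * e k) \<longlonglongrightarrow> 2 * M * \<rho> ^ Suc n * 0"
        by (intro tendsto_mult_left lim_e)
      then have "\<forall>\<^sub>F k in sequentially. 2 * M * \<rho> ^ Suc n * e k < \<epsilon>"
        using \<epsilon> by (auto dest: order_tendstoD)
      moreover have "\<forall>\<^sub>F k in sequentially. e k < 1 / (2 * \<rho>)"
        using lim_e \<rho> by (intro order_tendstoD(2)[of e 0]) auto
      ultimately show "\<forall>\<^sub>F k in sequentially. \<forall>t\<in>cball x 1. dist (f k t) (taylor_part F n (w + t *s v)) < \<epsilon>"
      proof eventually_elim
        case (elim k)
        show ?case
        proof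
          fix t assume t: "t \<in> cball x 1"
          define u where "u = w + t *s v"
          have "cmod t \<le> cmod x + 1" using t norm_triangle_ineq2[of t x] by (simp add: dist_norm norm_minus_commute)
          then have "norm u \<le> norm w + (cmod x + 1) * norm v"
            unfolding u_def using norm_triangle_ineq[of w "t *s v"] mult_right_mono[of "cmod t" "cmod x + 1" "norm v"]
            by (simp add: norm_vector_mult)
          then have u: "norm u \<le> \<rho>" by (simp add: \<rho>_def)
          have half: "e k * \<rho> < 1 / 2" using elim(2) \<rho> by (simp add: field_simps)
          have nz: "complex_of_real (e k) ^ n \<noteq> 0" using e[of k] by simp
          have "f k t - taylor_part F n u = (F (of_real (e k) *s u) - (\<Sum>m<Suc n. taylor_part F m u * of_real (e k) ^ m)) / of_real (e k) ^ n"
            using nz by (simp add: f_def u_def[symmetric] field_simps)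
          then have "cmod (f k t - taylor_part F n u)
              = cmod (F (of_real (e k) *s u) - (\<Sum>m<Suc n. taylor_part F m u * of_real (e k) ^ m)) / e k ^ n"
            using e[of k] by (simp add: norm_divide norm_power)
          also have "\<dots> \<le> (M * (cmod (of_real (e k)) / (1 / \<rho>)) ^ Suc n / (1 - cmod (of_real (e k)) / (1 / \<rho>))) / e k ^ n"
          proof (intro divide_right_mono taylor_tail[OF F] M(2))
            show "cmod (of_real (e k)) < 1 / \<rho>" using e[of k] half \<rho> by (simp add: field_simps)
            fix \<zeta> assume "cmod \<zeta> = 1 / \<rho>"
            then show "norm (\<zeta> *s u) \<le> 1" using u \<rho> by (simp add: norm_vector_mult)
          qed (use e[of k] in auto)
          also have "\<dots> = M * (\<rho> ^ Suc n * e k) / (1 - e k * \<rho>)"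
            using e[of k] by (simp add: power_mult_distrib)
          also have "\<dots> \<le> M * (\<rho> ^ Suc n * e k) / (1 / 2)"
            using half M(1) \<rho> e[of k] by (intro divide_left_mono) auto
          also have "\<dots> = 2 * M * \<rho> ^ Suc n * e k" by simp
          finally show "dist (f k t) (taylor_part F n (w + t *s v)) < \<epsilon>"
            using elim(1) by (simp add: dist_norm u_def)
        qed
      qed
    qed
    then show "\<exists>d>0. cball x d \<subseteq> UNIV \<and> uniform_limit (cball x d) f (\<lambda>t. taylor_part F n (w + t *s v)) sequentially"
      by (intro exI[of _ 1]) auto
  qed
qed

section \<open>Recognizing polynomials\<close>

lemma polynomialsI:
  "finite S \<Longrightarrow> (\<lambda>z. \<Sum>\<alpha>\<in>S. c \<alpha> * (\<Prod>j\<in>UNIV. (z $ j) ^ \<alpha> j)) \<in> polynomials"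
  unfolding polynomials_def by (intro CollectI exI[of _ S] exI[of _ c]) simp

lemma const_in_polynomials: "(\<lambda>_. c) \<in> polynomials"
  unfolding polynomials_def
  by (intro CollectI exI[of _ "{\<lambda>_. 0}"] exI[of _ "\<lambda>_. c"]) simp

lemma add_in_polynomials:
  assumes "P \<in> polynomials" "Q \<in> polynomials"
  shows "(\<lambda>z. P z + Q z) \<in> polynomials"
proof -
  obtain S c where P: "finite S" "P = (\<lambda>z. \<Sum>\<alpha>\<in>S. c \<alpha> * (\<Prod>j\<in>UNIV. (z $ j) ^ \<alpha> j))"
    using assms(1) unfolding polynomials_def by blast
  obtain T d where Q: "finite T" "Q = (\<lambda>z. \<Sum>\<alpha>\<in>T. d \<alpha> * (\<Prod>j\<in>UNIV. (z $ j) ^ \<alpha> j))"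
    using assms(2) unfolding polynomials_def by blast
  have ext: "(\<Sum>\<alpha>\<in>S. c \<alpha> * m \<alpha>) = (\<Sum>\<alpha>\<in>S \<union> T. (if \<alpha> \<in> S then c \<alpha> else 0) * m \<alpha>)"
     "(\<Sum>\<alpha>\<in>T. d \<alpha> * m \<alpha>) = (\<Sum>\<alpha>\<in>S \<union> T. (if \<alpha> \<in> T then d \<alpha> else 0) * m \<alpha>)" for m
    using P(1) Q(1) by (auto intro!: sum.mono_neutral_cong_left)
  have "(\<lambda>z. P z + Q z) = (\<lambda>z. \<Sum>\<alpha>\<in>S \<union> T. ((if \<alpha> \<in> S then c \<alpha> else 0) + (if \<alpha> \<in> T then d \<alpha> else 0)) * (\<Prod>j\<in>UNIV. (z $ j) ^ \<alpha> j))"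
    unfolding P(2) Q(2) ext by (simp only: distrib_right sum.distrib)
  then show ?thesis
    using P(1) Q(1) by (simp only: polynomialsI finite_Un simp_thms)
qed

lemma cmult_in_polynomials:
  assumes "P \<in> polynomials"
  shows "(\<lambda>z. a * P z) \<in> polynomials"
proof -
  obtain S c where P: "finite S" "P = (\<lambda>z. \<Sum>\<alpha>\<in>S. c \<alpha> * (\<Prod>j\<in>UNIV. (z $ j) ^ \<alpha> j))"
    using assms unfolding polynomials_def by blast
  have "(\<lambda>z. a * P z) = (\<lambda>z. \<Sum>\<alpha>\<in>S. (a * c \<alpha>) * (\<Prod>j\<in>UNIV. (z $ j) ^ \<alpha> j))"
    by (simp add: P(2) sum_distrib_left mult.assoc)
  then show ?thesis using P(1) by (simp only: polynomialsI finite_imageI)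
qed

lemma coordinate_mult_in_polynomials:
  fixes P :: "complex^'d \<Rightarrow> complex"
  assumes "P \<in> polynomials"
  shows "(\<lambda>z. z $ i * P z) \<in> polynomials"
proof -
  obtain S c where P: "finite S" "P = (\<lambda>z. \<Sum>\<alpha>\<in>S. c \<alpha> * (\<Prod>j\<in>UNIV. (z $ j) ^ \<alpha> j))"
    using assms unfolding polynomials_def by blast
  define up where "up \<alpha> = \<alpha>(i := Suc (\<alpha> i))" for \<alpha> :: "'d \<Rightarrow> nat"
  define down where "down \<beta> = \<beta>(i := \<beta> i - 1)" for \<beta> :: "'d \<Rightarrow> nat"
  have du: "down (up \<alpha>) = \<alpha>" for \<alpha> by (auto simp: up_def down_def)
  have inj: "inj_on up S" by (rule inj_on_inverseI[of _ down]) (simp add: du)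
  have mono: "(\<Prod>j\<in>UNIV. (z $ j) ^ up \<alpha> j) = z $ i * (\<Prod>j\<in>UNIV. (z $ j) ^ \<alpha> j)" for z :: "complex^'d" and \<alpha>
  proof -
    have "(\<Prod>j\<in>UNIV. (z $ j) ^ up \<alpha> j) = (\<Prod>j\<in>UNIV. (if j = i then z $ i else 1) * (z $ j) ^ \<alpha> j)"
      by (intro prod.cong) (auto simp: up_def)
    then show ?thesis by (simp add: prod.distrib)
  qed
  have "(\<lambda>z. z $ i * P z) = (\<lambda>z. \<Sum>\<beta>\<in>up ` S. c (down \<beta>) * (\<Prod>j\<in>UNIV. (z $ j) ^ \<beta> j))"
    by (simp add: P(2) sum.reindex[OF inj] du mono sum_distrib_left mult_ac)
  then show ?thesis using P(1) by (simp only: polynomialsI finite_imageI)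
qed

lemma sum_in_polynomials:
  assumes "\<And>k. k \<in> A \<Longrightarrow> P k \<in> polynomials"
  shows "(\<lambda>z. \<Sum>k\<in>A. P k z) \<in> polynomials"
  using assms
  by (induction A rule: infinite_finite_induct) (auto intro: const_in_polynomials add_in_polynomials)

lemma linear_factors_in_polynomials:
  fixes P :: "complex^'d \<Rightarrow> complex"
  assumes "P \<in> polynomials"
  shows "(\<lambda>z. P z * (\<Prod>l\<in>A. c l * (z $ i - d l))) \<in> polynomials"
proof (induction A rule: infinite_finite_induct)
  case (insert l A)
  let ?Q = "\<lambda>z. P z * (\<Prod>l\<in>A. c l * (z $ i - d l))"
  have "(\<lambda>z. P z * (\<Prod>l\<in>insert l A. c l * (z $ i - d l))) = (\<lambda>z. c l * (z $ i * ?Q z) + (- (c l * d l)) * ?Q z)"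
    using insert.hyps by (simp add: fun_eq_iff algebra_simps)
  moreover have "\<dots> \<in> polynomials"
    by (intro add_in_polynomials cmult_in_polynomials coordinate_mult_in_polynomials insert.IH)
  ultimately show ?case by simp
qed (use assms in auto)

definition update :: "complex^'d \<Rightarrow> 'd \<Rightarrow> complex \<Rightarrow> complex^'d" where
  "update z j t = (\<chi> i. if i = j then t else z $ i)"

lemma update_nth [simp]: "update z j t $ i = (if i = j then t else z $ i)"
  by (simp add: update_def)

text \<open>
  Both sides are polynomials of degree at most \<open>n\<close> that agree at \<open>0, \<dots>, n\<close>.
\<close>

lemma Lagrange_interpolation:
  fixes p :: "complex poly"
  assumes "degree p \<le> n"
  shows "poly p t = (\<Sum>k\<le>n. poly p (of_nat k) * (\<Prod>l\<in>{..n} - {k}. inverse (of_nat k - of_nat l) * (t - of_nat l)))"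
proof -
  define q where "q = (\<Sum>k\<le>n. smult (poly p (of_nat k)) (\<Prod>l\<in>{..n} - {k}. smult (inverse (of_nat k - of_nat l)) [:- of_nat l, 1:]))"
  have poly_q: "poly q x = (\<Sum>k\<le>n. poly p (of_nat k) * (\<Prod>l\<in>{..n} - {k}. inverse (of_nat k - of_nat l) * (x - of_nat l)))" for x
    by (simp add: q_def poly_sum poly_prod algebra_simps)
  have "degree (smult (poly p (of_nat k)) (\<Prod>l\<in>{..n} - {k}. smult (inverse (of_nat k - of_nat l)) [:- of_nat l, 1:])) \<le> n"
    if "k \<le> n" for k
  proof -
    have "degree (\<Prod>l\<in>{..n} - {k}. smult (inverse (of_nat k - of_nat l :: complex)) [:- of_nat l, 1:])
        \<le> (\<Sum>l\<in>{..n} - {k}. degree (smult (inverse (of_nat k - of_nat l :: complex)) [:- of_nat l, 1:]))"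
      by (rule degree_prod_sum_le[unfolded comp_def]) simp
    also have "\<dots> \<le> (\<Sum>l\<in>{..n} - {k}. 1)"
      by (intro sum_mono) (rule order_trans[OF degree_smult_le], simp)
    also have "\<dots> = n" using that by simp
    finally show ?thesis using degree_smult_le order_trans by blast
  qed
  then have "degree q \<le> n" unfolding q_def by (intro degree_sum_le) auto
  moreover have "poly p x = poly q x" if x: "x \<in> of_nat ` {..n}" for x
  proof -
    obtain m where m: "x = of_nat m" "m \<le> n" using x by auto
    have "(\<Prod>l\<in>{..n} - {k}. inverse (of_nat k - of_nat l) * (of_nat m - of_nat l :: complex)) = (if k = m then 1 else 0)"
      if "k \<le> n" for k
    proof (cases "k = m")
      case True
      then show ?thesis by (auto intro!: prod.neutral)
    next
      case False
      then show ?thesis using m by (auto intro!: prod_zero)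
    qed
    then have "poly q x = (\<Sum>k\<le>n. if k = m then poly p (of_nat k) else 0)"
      unfolding poly_q m(1) by (intro sum.cong) auto
    then show ?thesis using m by simp
  qed
  moreover have "card (of_nat ` {..n} :: complex set) = Suc n"
    by (subst card_image) (auto intro: inj_onI)
  ultimately have "p = q" using assms by (intro poly_eqI_degree[of "of_nat ` {..n}"]) auto
  then have "poly p t = poly q t" by (rule arg_cong)
  then show ?thesis unfolding poly_q .
qed

text \<open>
  Induction on the set of coordinates on which the function depends.  Interpolating in one of them at
  \<open>0, \<dots>, n\<close> expresses the function by polynomials in that coordinate with coefficients that are values
  of the same function, so that they inherit the hypothesis and depend on one coordinate fewer.
\<close>

lemma separately_polynomial:
  fixes P :: "complex^'d \<Rightarrow> complex"
  assumes "\<And>w j. \<exists>p. degree p \<le> n \<and> (\<forall>t. P (update w j t) = poly p t)"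
  shows "P \<in> polynomials"
proof -
  have "P \<in> polynomials"
    if "finite J" "\<And>w j. \<exists>p. degree p \<le> n \<and> (\<forall>t. P (update w j t) = poly p t)"
      "\<And>z z'. (\<And>i. i \<in> J \<Longrightarrow> z $ i = z' $ i) \<Longrightarrow> P z = P z'" for J and P :: "complex^'d \<Rightarrow> complex"
    using that
  proof (induction J arbitrary: P)
    case empty
    then have "P = (\<lambda>_. P 0)" by auto
    then show ?case using const_in_polynomials by metis
  next
    case (insert j J)
    define Q where "Q k z = P (update z j (of_nat k))" for k z
    have "Q k \<in> polynomials" for k
    proof (rule insert.IH)
      fix w i
      show "\<exists>p. degree p \<le> n \<and> (\<forall>t. Q k (update w i t) = poly p t)"
      proof (cases "i = j")
        case True
        have "update (update w i t) j (of_nat k) = update w j (of_nat k)" for t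
          by (simp add: vec_eq_iff True)
        then show ?thesis by (intro exI[of _ "[:Q k w:]"]) (simp add: Q_def)
      next
        case False
        have "update (update w i t) j (of_nat k) = update (update w j (of_nat k)) i t" for t
          using False by (simp add: vec_eq_iff)
        then show ?thesis using insert.prems(1)[of "update w j (of_nat k)" i] by (simp add: Q_def)
      qed
    next
      fix z z' :: "complex^'d" assume "\<And>i. i \<in> J \<Longrightarrow> z $ i = z' $ i"
      then show "Q k z = Q k z'" unfolding Q_def by (intro insert.prems(2)) auto
    qed
    moreover have "P z = (\<Sum>k\<le>n. Q k z * (\<Prod>l\<in>{..n} - {k}. inverse (of_nat k - of_nat l) * (z $ j - of_nat l)))" for z
    proof -
      obtain p where p: "degree p \<le> n" "\<And>t. P (update z j t) = poly p t"
        using insert.prems(1) by blast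
      have "update z j (z $ j) = z" by (simp add: vec_eq_iff)
      then have "P z = poly p (z $ j)" using p(2)[of "z $ j"] by simp
      then show ?thesis using Lagrange_interpolation[OF p(1), of "z $ j"] by (simp add: Q_def p(2))
    qed
    ultimately show ?case
      by (subst fun_eq_iff[THEN iffD2, of P]) (auto intro!: sum_in_polynomials linear_factors_in_polynomials)
  qed
  then show ?thesis using assms by (metis finite vec_eq_iff UNIV_I)
qed

text \<open>
  On each line parallel to a coordinate axis the homogeneous part is entire and of growth order \<open>n\<close>,
  hence a polynomial of degree at most \<open>n\<close> by Liouville's theorem.
\<close>

lemma taylor_part_in_polynomials:
  assumes F: "entire F"
  shows "taylor_part F n \<in> polynomials"
proof (rule separately_polynomial)
  fix w j
  obtain M where M: "0 \<le> M" "\<And>n w \<rho>. 0 < \<rho> \<Longrightarrow> norm w \<le> \<rho> \<Longrightarrow> cmod (taylor_part F n w) \<le> M * \<rho> ^ n"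
    using taylor_part_growth[OF F] by metis
  let ?u = "update w j 0" and ?f = "\<lambda>t. taylor_part F n (update w j 0 + t *s axis j 1)"
  have upd: "update w j t = ?u + t *s axis j 1" for t
    by (simp add: vec_eq_iff axis_def)
  have growth: "cmod (?f t) \<le> (M * 2 ^ n) * cmod t ^ n" if t: "max 1 (norm ?u) \<le> cmod t" for t
  proof -
    have "norm (?u + t *s axis j 1) \<le> 2 * cmod t"
      using norm_triangle_ineq[of ?u "t *s axis j 1"] t by (simp add: norm_vector_mult)
    then have "cmod (?f t) \<le> M * (2 * cmod t) ^ n" using t by (intro M(2)) auto
    then show ?thesis by (simp add: power_mult_distrib)
  qed
  have L: "?f t = (\<Sum>k\<le>n. (deriv ^^ k) ?f 0 / fact k * t ^ k)" for t
    by (rule Liouville_polynomial[OF taylor_part_holomorphic[OF F] growth])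
  define p where "p = (\<Sum>k\<le>n. monom ((deriv ^^ k) ?f 0 / fact k) k)"
  have "degree p \<le> n"
    unfolding p_def by (intro degree_sum_le) (auto intro: order_trans[OF degree_monom_le])
  moreover have "taylor_part F n (update w j t) = poly p t" for t
    unfolding upd[of t] using L[of t] by (simp add: p_def poly_sum poly_monom)
  ultimately show "\<exists>p. degree p \<le> n \<and> (\<forall>t. taylor_part F n (update w j t) = poly p t)" by blast
qed

text \<open>
  For \<open>\<rho> < 1\<close> the growth exponent \<open>b\<close> improves to \<open>b \<rho>\<^sup>2\<close> because the Taylor coefficients are
  estimated on the circle of radius \<open>\<rho>\<close>; this gain pays for the convergence in norm.
\<close>

lemma dilation_polynomial_approximation:
  fixes F :: "complex^'d \<Rightarrow> complex"
  assumes F: "entire F" and growth: "\<And>w. cmod (F w) \<le> M * exp (b * (norm w)\<^sup>2)" and r: "0 < r" "r < \<rho>"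
  obtains P where "P \<in> polynomials"
    "\<And>w. cmod (F (r *\<^sub>R w) - P w) \<le> M * exp (b * \<rho>\<^sup>2 * (norm w)\<^sup>2) * (r / \<rho>) ^ N / (1 - r / \<rho>)"
proof
  let ?P = "\<lambda>w. \<Sum>m<N. (of_real r) ^ m * taylor_part F m w"
  show "?P \<in> polynomials"
    by (intro sum_in_polynomials cmult_in_polynomials taylor_part_in_polynomials F)
  fix w
  have "cmod (F (of_real r *s w) - (\<Sum>m<N. taylor_part F m w * of_real r ^ m))
      \<le> M * exp (b * \<rho>\<^sup>2 * (norm w)\<^sup>2) * (cmod (of_real r) / \<rho>) ^ N / (1 - cmod (of_real r) / \<rho>)"
  proof (rule taylor_tail[OF F])
    fix \<zeta> assume "cmod \<zeta> = \<rho>"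
    then show "cmod (F (\<zeta> *s w)) \<le> M * exp (b * \<rho>\<^sup>2 * (norm w)\<^sup>2)"
      using growth[of "\<zeta> *s w"] by (simp add: norm_vector_mult power_mult_distrib mult.assoc)
  qed (use r in auto)
  then show "cmod (F (r *\<^sub>R w) - ?P w) \<le> M * exp (b * \<rho>\<^sup>2 * (norm w)\<^sup>2) * (r / \<rho>) ^ N / (1 - r / \<rho>)"
    using r by (simp add: scaleR_eq_vector_mult mult.commute)
qed

section \<open>The function whose mixed quasi-norm is taken\<close>

definition cnj_vec :: "complex^'d \<Rightarrow> complex^'d" where
  "cnj_vec z = (\<chi> j. cnj (z $ j))"

lemma linear_cnj_vec: "linear cnj_vec"
  by (rule linearI) (auto simp: cnj_vec_def vec_eq_iff)

lemma norm_cnj_vec [simp]: "norm (cnj_vec z) = norm z"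
  by (simp add: cnj_vec_def norm_vec_def)

text \<open>
  The argument at which the Bargmann factor evaluates \<open>F\<close>, as a point of the complex space.
\<close>

definition bargmann_arg :: "complex^'d \<Rightarrow> complex^'d" where
  "bargmann_arg z = (1 / sqrt 2) *\<^sub>R cnj_vec z"

lemma norm_bargmann_arg: "(norm (bargmann_arg z))\<^sup>2 = (norm z)\<^sup>2 / 2"
  by (simp add: bargmann_arg_def power_divide)

lemma bargmann_arg_scaleR: "bargmann_arg (r *\<^sub>R z) = r *\<^sub>R bargmann_arg z"
  by (simp add: bargmann_arg_def linear_scale[OF linear_cnj_vec])

lemma bargmann_arg_measurable [measurable]: "bargmann_arg \<in> borel_measurable borel"
proof -
  have "linear (bargmann_arg :: complex^'d \<Rightarrow> complex^'d)"
    unfolding bargmann_arg_def by (intro linear_compose_scale_right linear_cnj_vec)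
  then show ?thesis
    by (intro borel_measurable_continuous_onI linear_continuous_on) (simp add: linear_conv_bounded_linear)
qed

lemma nn_integral_bargmann_arg:
  fixes f :: "complex^'d \<Rightarrow> ennreal"
  assumes [measurable]: "f \<in> borel_measurable borel"
  shows "(\<integral>\<^sup>+w. f w \<partial>lborel)
     = ennreal ((1 / sqrt 2) ^ DIM(complex^'d)) * (\<integral>\<^sup>+z. f (bargmann_arg z) \<partial>lborel)"
  using nn_integral_lborel_affine[of f "1 / sqrt 2" 0]
    nn_integral_lborel_isometry[OF linear_cnj_vec norm_cnj_vec, of "\<lambda>z. f ((1 / sqrt 2) *\<^sub>R z)"]
  by (simp add: bargmann_arg_def)

text \<open>
  The type argument carries the dimension.
\<close>

definition bargmann_const :: "'d::finite itself \<Rightarrow> real" where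
  "bargmann_const _ = (2 * pi) powr (- real CARD('d) / 2)"

lemma bargmann_const_pos [simp]: "0 < bargmann_const TYPE('d::finite)"
  by (simp add: bargmann_const_def)

lemma bargmann_const_nonneg [simp]: "0 \<le> bargmann_const TYPE('d::finite)"
  by (simp add: bargmann_const_def)

text \<open>
  The modulus of the Bargmann factor times the weight: \<open>A_qnorm\<close> is its mixed quasi-norm.
\<close>

definition profile :: "(complex^'d \<Rightarrow> real) \<Rightarrow> (complex^'d \<Rightarrow> complex) \<Rightarrow> complex^'d \<Rightarrow> ennreal" where
  "profile \<omega> F z = ennreal (bargmann_const TYPE('d) * exp (- (norm z)\<^sup>2 / 4) * cmod (F (bargmann_arg z)) * \<omega> z)"

lemma norm_Re_Im_vec: "(norm (Re_vec z))\<^sup>2 + (norm (Im_vec z))\<^sup>2 = (norm z)\<^sup>2"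
  by (simp add: power2_norm_eq_inner inner_vec_def Re_vec_def Im_vec_def inner_complex_def sum.distrib)

lemma A_qnorm_eq_profile:
  fixes \<omega> :: "complex^'d \<Rightarrow> real"
  assumes "\<And>z. 0 < \<omega> z"
  shows "A_qnorm \<omega> B F = mixed_qnorm B (profile \<omega> F)"
proof -
  have "cmod (bargmann_factor F z * of_real (\<omega> z))
      = bargmann_const TYPE('d) * exp (- (norm z)\<^sup>2 / 4) * cmod (F (bargmann_arg z)) * \<omega> z" for z :: "complex^'d"
  proof -
    have "(\<chi> j. of_real (Re_vec z $ j / sqrt 2) - \<i> * of_real (Im_vec z $ j / sqrt 2)) = bargmann_arg z"
      by (simp add: vec_eq_iff bargmann_arg_def cnj_vec_def Re_vec_def Im_vec_def complex_eq_iff)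
    moreover have "cmod (exp (- \<i> * of_real (Re_vec z \<bullet> Im_vec z) / 2)) = 1"
      by (simp add: norm_exp_eq_Re)
    ultimately show ?thesis
      using assms[of z] unfolding bargmann_factor_def Let_def norm_Re_Im_vec
      by (simp add: norm_mult bargmann_const_def)
  qed
  then show ?thesis by (simp add: A_qnorm_def profile_def[abs_def])
qed

lemma profile_measurable:
  assumes [measurable]: "F \<in> borel_measurable borel" and \<omega>: "\<omega> \<in> borel_measurable lebesgue"
  shows "profile \<omega> F \<in> borel_measurable lebesgue"
proof -
  note \<omega>[measurable]
  have [measurable]: "(\<lambda>z. bargmann_const TYPE('a) * exp (- (norm z)\<^sup>2 / 4) * cmod (F (bargmann_arg z))) \<in> borel_measurable lebesgue"
    by (rule measurable_completion) measurable
  show ?thesis unfolding profile_def by measurable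
qed

lemma lebesgue_measurable_dilation:
  assumes "f \<in> borel_measurable lebesgue"
  shows "(\<lambda>z. f (r *\<^sub>R z)) \<in> borel_measurable lebesgue"
  using measurable_compose[OF lebesgue_measurable_scaling assms] .

lemma lebesgue_measurable_indicator:
  assumes "A \<in> sets borel"
  shows "indicator A \<in> borel_measurable lebesgue"
  by (rule measurable_completion) (use assms in simp)

section \<open>Polynomials are entire and grow slowly\<close>

lemma entire_const: "entire (\<lambda>_. c)"
  unfolding entire_def by (auto intro!: exI[of _ "\<lambda>_. 0"])

lemma entire_coordinate: "entire (\<lambda>z. z $ j)"
  unfolding entire_def
  by (auto intro!: exI[of _ "\<lambda>h. h $ j"] bounded_linear_imp_has_derivative bounded_linear_vec_nth)

lemma entire_add:
  assumes "entire F" "entire G" shows "entire (\<lambda>z. F z + G z)"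
  unfolding entire_def
proof
  fix z
  obtain D E where "(F has_derivative D) (at z)" "\<forall>c v. D (c *s v) = c * D v"
     "(G has_derivative E) (at z)" "\<forall>c v. E (c *s v) = c * E v"
    using assms unfolding entire_def by meson
  then show "\<exists>D. ((\<lambda>z. F z + G z) has_derivative D) (at z) \<and> (\<forall>c v. D (c *s v) = c * D v)"
    by (intro exI[of _ "\<lambda>h. D h + E h"]) (auto intro: has_derivative_add simp: distrib_left)
qed

lemma entire_mult:
  assumes "entire F" "entire G" shows "entire (\<lambda>z. F z * G z)"
  unfolding entire_def
proof
  fix z
  obtain D E where "(F has_derivative D) (at z)" "\<forall>c v. D (c *s v) = c * D v"
     "(G has_derivative E) (at z)" "\<forall>c v. E (c *s v) = c * E v"
    using assms unfolding entire_def by meson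
  then show "\<exists>D. ((\<lambda>z. F z * G z) has_derivative D) (at z) \<and> (\<forall>c v. D (c *s v) = c * D v)"
    by (intro exI[of _ "\<lambda>h. F z * E h + D h * G z"] conjI has_derivative_mult) (simp_all add: distrib_left)
qed

definition poly_growth :: "(complex^'d \<Rightarrow> complex) \<Rightarrow> bool" where
  "poly_growth F \<longleftrightarrow> (\<exists>M\<ge>0. \<exists>N. \<forall>w. cmod (F w) \<le> M * (1 + norm w) ^ N)"

lemma poly_growth_const: "poly_growth (\<lambda>_. c)"
  unfolding poly_growth_def by (intro exI[of _ "cmod c"] conjI exI[of _ 0]) auto

lemma poly_growth_coordinate: "poly_growth (\<lambda>z :: complex^'d. z $ j)"
proof -
  have "cmod (w $ j) \<le> 1 + norm w" for w :: "complex^'d"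
    using Finite_Cartesian_Product.norm_nth_le[of w j] by linarith
  then show ?thesis
    unfolding poly_growth_def by (intro exI[of _ 1] conjI exI[of _ 1]) auto
qed

lemma poly_growth_mult:
  assumes "poly_growth F" "poly_growth G" shows "poly_growth (\<lambda>z. F z * G z)"
proof -
  obtain M N where M: "M \<ge> 0" "\<And>w. cmod (F w) \<le> M * (1 + norm w) ^ N"
    using assms(1) unfolding poly_growth_def by blast
  obtain M' N' where M': "M' \<ge> 0" "\<And>w. cmod (G w) \<le> M' * (1 + norm w) ^ N'"
    using assms(2) unfolding poly_growth_def by blast
  have "cmod (F w * G w) \<le> (M * M') * (1 + norm w) ^ (N + N')" for w
    using mult_mono[OF M(2)[of w] M'(2)[of w]] M(1)
    by (simp add: norm_mult power_add mult_ac)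
  then show ?thesis unfolding poly_growth_def using M(1) M'(1) by (meson mult_nonneg_nonneg)
qed

lemma poly_growth_add:
  assumes "poly_growth F" "poly_growth G" shows "poly_growth (\<lambda>z. F z + G z)"
proof -
  obtain M N where M: "M \<ge> 0" "\<And>w. cmod (F w) \<le> M * (1 + norm w) ^ N"
    using assms(1) unfolding poly_growth_def by blast
  obtain M' N' where M': "M' \<ge> 0" "\<And>w. cmod (G w) \<le> M' * (1 + norm w) ^ N'"
    using assms(2) unfolding poly_growth_def by blast
  have "cmod (F w + G w) \<le> (M + M') * (1 + norm w) ^ (N + N')" for w
  proof -
    have "M * (1 + norm w) ^ N \<le> M * (1 + norm w) ^ (N + N')"
      "M' * (1 + norm w) ^ N' \<le> M' * (1 + norm w) ^ (N + N')"
      using M(1) M'(1) by (auto intro!: mult_left_mono power_increasing)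
    then show ?thesis
      using norm_triangle_ineq[of "F w" "G w"] M(2)[of w] M'(2)[of w] unfolding distrib_right by linarith
  qed
  then show ?thesis unfolding poly_growth_def using M(1) M'(1) by (meson add_nonneg_nonneg)
qed

lemma polynomials_entire_poly_growth:
  assumes "P \<in> polynomials"
  shows "entire P \<and> poly_growth P"
proof -
  obtain S c where P: "finite S" "P = (\<lambda>z. \<Sum>\<alpha>\<in>S. c \<alpha> * (\<Prod>j\<in>UNIV. (z $ j) ^ \<alpha> j))"
    using assms unfolding polynomials_def by blast
  have pow: "entire (\<lambda>z. (z $ j) ^ k) \<and> poly_growth (\<lambda>z. (z $ j) ^ k)" for j :: 'a and k
    by (induction k) (auto intro: entire_const entire_mult entire_coordinate poly_growth_const poly_growth_mult poly_growth_coordinate)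
  have prd: "entire (\<lambda>z. \<Prod>j\<in>A. (z $ j) ^ \<alpha> j) \<and> poly_growth (\<lambda>z. \<Prod>j\<in>A. (z $ j) ^ \<alpha> j)" for A :: "'a set" and \<alpha>
    by (induction A rule: infinite_finite_induct) (use pow in \<open>auto intro: entire_const entire_mult poly_growth_const poly_growth_mult\<close>)
  show ?thesis
    unfolding P(2) using P(1)
    by (induction S rule: finite_induct)
       (use prd in \<open>auto intro!: entire_add entire_mult poly_growth_add poly_growth_mult entire_const poly_growth_const\<close>)
qed

text \<open>
  From \<open>1 + t \<le> exp t\<close> and \<open>N t \<le> N\<^sup>2 + t\<^sup>2 / 4\<close>.
\<close>

lemma poly_growth_gauss:
  assumes "poly_growth F"
  shows "\<exists>M\<ge>0. \<forall>w. cmod (F w) \<le> M * exp (1 / 4 * (norm w)\<^sup>2)"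
proof -
  obtain M N where M: "M \<ge> 0" "\<And>w. cmod (F w) \<le> M * (1 + norm w) ^ N"
    using assms unfolding poly_growth_def by blast
  have "cmod (F w) \<le> (M * exp ((real N)\<^sup>2)) * exp (1 / 4 * (norm w)\<^sup>2)" for w
  proof -
    have "(1 + norm w) ^ N \<le> exp (norm w) ^ N"
      by (intro power_mono exp_ge_add_one_self) auto
    also have "\<dots> = exp (real N * norm w)" by (simp add: exp_of_nat_mult)
    also have "\<dots> \<le> exp ((real N)\<^sup>2 + 1 / 4 * (norm w)\<^sup>2)"
    proof -
      have "0 \<le> (real N - norm w / 2)\<^sup>2" by simp
      then show ?thesis by (simp add: power2_eq_square algebra_simps)
    qed
    finally have "M * (1 + norm w) ^ N \<le> M * exp ((real N)\<^sup>2 + 1 / 4 * (norm w)\<^sup>2)"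
      using M(1) by (rule mult_left_mono)
    then show ?thesis using M(2)[of w] by (simp add: exp_add mult.assoc)
  qed
  then show ?thesis using M(1) by (intro exI[of _ "M * exp ((real N)\<^sup>2)"]) auto
qed

section \<open>Pointwise growth and polynomial approximation\<close>

text \<open>
  Positive measurable weights between Gaussians of arbitrarily slow decay and growth.
\<close>

locale gaussian_weight =
  fixes \<omega> :: "complex^'d \<Rightarrow> real"
  assumes pos: "\<And>z. 0 < \<omega> z"
    and measurable_weight: "\<omega> \<in> borel_measurable lebesgue"
    and gaussian_bounds: "\<And>a. 0 < a \<Longrightarrow> \<exists>C>0. \<forall>z. inverse C * exp (- a * (norm z)\<^sup>2) \<le> \<omega> z \<and> \<omega> z \<le> C * exp (a * (norm z)\<^sup>2)"
begin

lemma A_space_iff: "F \<in> A_space \<omega> B \<longleftrightarrow> entire F \<and> mixed_qnorm B (profile \<omega> F) < top"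
  by (simp add: A_space_def A_qnorm_eq_profile pos)

text \<open>
  Multiplied by a slowly decaying Gaussian, the weight is bounded below by a Gaussian, so that
  \<open>mixed_qnorm_lower_exponent\<close> yields the integral of \<open>entire_growth_bound\<close>.  The exponent \<open>1/2\<close> comes
  from the factor \<open>exp (- |z|\<^sup>2 / 4)\<close> of the Bargmann factor and \<open>|z|\<^sup>2 = 2 |w|\<^sup>2\<close>.
\<close>

lemma A_space_growth:
  fixes \<epsilon> :: real
  assumes B: "decomposes B" and F: "F \<in> A_space \<omega> B" and \<epsilon>: "0 < \<epsilon>"
  shows "\<exists>M\<ge>0. \<forall>w. cmod (F w) \<le> M * exp ((1 / 2 + \<epsilon>) * (norm w)\<^sup>2)"
proof -
  have ent: "entire F" and fin: "mixed_qnorm B (profile \<omega> F) < top" using F by (auto simp: A_space_iff)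
  note [measurable] = entire_borel_measurable[OF ent]
  obtain s where s: "0 < s" "s \<le> 1" "\<And>a f. 0 < a \<Longrightarrow> f \<in> borel_measurable lebesgue \<Longrightarrow> mixed_qnorm B f < top \<Longrightarrow>
     (\<integral>\<^sup>+z. ennpow (f z * gauss a z) s \<partial>lborel) < top"
    using mixed_qnorm_lower_exponent[OF B] by blast
  \<comment> \<open>With these choices \<open>b = 1/2 + 4a\<close> and \<open>b (1 + \<eta>) = 1/2 + \<epsilon>/2\<close>; a part \<open>2a\<close> of the decay in \<open>z\<close>,
    which is \<open>4a\<close> in \<open>w\<close>, compensates for the weight and for the Gaussian of Hoelder's inequality.\<close>
  define a where "a = \<epsilon> / 16"
  have a: "0 < a" using \<epsilon> by (simp add: a_def)
  define b where "b = 1 / 2 + \<epsilon> / 4"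
  define \<eta> where "\<eta> = \<epsilon> / (2 + \<epsilon>)"
  have b_eq: "b = 1 / 2 + 4 * a" by (simp add: a_def b_def)
  have \<eta>: "0 < \<eta>" "b * (1 + \<eta>) \<le> 1 / 2 + \<epsilon>"
  proof -
    show "0 < \<eta>" using \<epsilon> by (simp add: \<eta>_def)
    have "b * (1 + \<eta>) = 1 / 2 + \<epsilon> / 2" using \<epsilon> by (simp add: b_def \<eta>_def field_simps power2_eq_square)
    then show "b * (1 + \<eta>) \<le> 1 / 2 + \<epsilon>" using \<epsilon> by simp
  qed
  obtain C where C: "0 < C" "\<And>z. inverse C * exp (- a * (norm z)\<^sup>2) \<le> \<omega> z"
    using gaussian_bounds[OF a] by blast
  define c where "c = bargmann_const TYPE('d) * inverse C"
  have c: "0 < c" using C(1) by (simp add: c_def)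
  define h where "h w = ennreal (cmod (F w) powr s * exp (- s * b * (norm w)\<^sup>2))" for w
  have [measurable]: "h \<in> borel_measurable borel" unfolding h_def by measurable
  have "ennreal (c powr s) * h (bargmann_arg z) \<le> ennpow (profile \<omega> F z * gauss a z) s" for z
  proof -
    let ?F = "cmod (F (bargmann_arg z))"
    have "c powr s * (?F powr s * exp (- s * b * (norm (bargmann_arg z))\<^sup>2))
        = (c * (?F * exp (- b * (norm (bargmann_arg z))\<^sup>2))) powr s"
      using c by (simp add: powr_mult powr_def[of "exp _"] mult_ac)
    also have "- b * (norm (bargmann_arg z))\<^sup>2 = - (norm z)\<^sup>2 / 4 + - a * (norm z)\<^sup>2 + - a * (norm z)\<^sup>2"
      by (simp add: norm_bargmann_arg b_eq field_simps)
    also have "c * (?F * exp (- (norm z)\<^sup>2 / 4 + - a * (norm z)\<^sup>2 + - a * (norm z)\<^sup>2))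
        = bargmann_const TYPE('d) * exp (- (norm z)\<^sup>2 / 4) * ?F * (inverse C * exp (- a * (norm z)\<^sup>2)) * exp (- a * (norm z)\<^sup>2)"
      by (simp only: exp_add c_def mult_ac)
    also have "\<dots> powr s \<le> (bargmann_const TYPE('d) * exp (- (norm z)\<^sup>2 / 4) * ?F * \<omega> z * exp (- a * (norm z)\<^sup>2)) powr s"
      using s(1) C
      by (intro powr_mono2 mult_right_mono mult_left_mono) auto
    finally show ?thesis
      using pos[of z] by (simp add: h_def profile_def ennreal_mult'[symmetric] ennreal_leI)
  qed
  then have "(\<integral>\<^sup>+z. ennreal (c powr s) * h (bargmann_arg z) \<partial>lborel) \<le> (\<integral>\<^sup>+z. ennpow (profile \<omega> F z * gauss a z) s \<partial>lborel)"
    by (rule nn_integral_mono)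
  also have "\<dots> < top"
    by (rule s(3)[OF a profile_measurable[OF _ measurable_weight] fin]) measurable
  finally have "ennreal (c powr s) * (\<integral>\<^sup>+z. h (bargmann_arg z) \<partial>lborel) < top"
    by (simp add: nn_integral_cmult)
  then have "(\<integral>\<^sup>+z. h (bargmann_arg z) \<partial>lborel) < top"
    using c by (auto simp: ennreal_mult_less_top)
  then have "(\<integral>\<^sup>+w. h w \<partial>lborel) < \<infinity>"
    by (subst nn_integral_bargmann_arg) (auto simp: ennreal_mult_less_top)
  then obtain M where M: "M \<ge> 0" "\<And>w. cmod (F w) \<le> M * exp (b * (1 + \<eta>) * (norm w)\<^sup>2)"
    using entire_growth_bound[OF ent s(1,2) _ \<eta>(1), of b] \<epsilon> by (auto simp: h_def b_def)
  have "cmod (F w) \<le> M * exp ((1 / 2 + \<epsilon>) * (norm w)\<^sup>2)" for w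
    using M(2)[of w] order_trans mult_left_mono[OF iffD2[OF exp_le_cancel_iff mult_right_mono[OF \<eta>(2)]] M(1), of "(norm w)\<^sup>2"]
    by fastforce
  then show ?thesis using M(1) by blast
qed

text \<open>
  If \<open>b < 1/2\<close>, the Bargmann factor and the weight leave a Gaussian.  The bound is linear in \<open>M\<close>,
  so that it also measures how fast a sequence of such functions tends to zero.
\<close>

lemma A_qnorm_gaussian_growth:
  assumes B: "decomposes B" and b: "b < 1 / 2"
  obtains K where "0 \<le> K" "\<And>F M. F \<in> borel_measurable borel \<Longrightarrow> 0 \<le> M \<Longrightarrow>
     (\<And>w. cmod (F w) \<le> M * exp (b * (norm w)\<^sup>2)) \<Longrightarrow> mixed_qnorm B (profile \<omega> F) \<le> ennreal (M * K)"
proof -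
  define a where "a = (1 / 2 - b) / 4"
  have a: "0 < a" using b by (simp add: a_def)
  obtain C where C: "0 < C" "\<And>z. \<omega> z \<le> C * exp (a * (norm z)\<^sup>2)"
    using gaussian_bounds[OF a] by blast
  define c where "c = bargmann_const TYPE('d) * C"
  have c: "0 < c" using C(1) by (simp add: c_def)
  have "mixed_qnorm B (gauss a) < top" using B a unfolding decomposes_def by (intro mixed_qnorm_gauss) auto
  then obtain g where g: "mixed_qnorm B (gauss a) = ennreal g" "0 \<le> g" by (cases "mixed_qnorm B (gauss a)") auto
  have gm: "gauss a \<in> borel_measurable (lebesgue :: (complex^'d) measure)"
    by (rule measurable_completion) measurable
  have "mixed_qnorm B (profile \<omega> F) \<le> ennreal (M * (c * g))"
    if F[measurable]: "F \<in> borel_measurable borel" and M: "0 \<le> M" "\<And>w. cmod (F w) \<le> M * exp (b * (norm w)\<^sup>2)" for F M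
  proof -
    have "profile \<omega> F z \<le> ennreal (M * c) * gauss a z" for z
    proof -
      have "bargmann_const TYPE('d) * exp (- (norm z)\<^sup>2 / 4) * cmod (F (bargmann_arg z)) * \<omega> z
          \<le> bargmann_const TYPE('d) * exp (- (norm z)\<^sup>2 / 4) * (M * exp (b * (norm (bargmann_arg z))\<^sup>2)) * (C * exp (a * (norm z)\<^sup>2))"
        using M C pos[of z] by (intro mult_mono mult_left_mono) (auto intro: less_imp_le)
      also have "\<dots> = (M * c) * (exp (- (norm z)\<^sup>2 / 4) * exp (b * (norm (bargmann_arg z))\<^sup>2) * exp (a * (norm z)\<^sup>2))"
        by (simp only: c_def mult_ac)
      also have "exp (- (norm z)\<^sup>2 / 4) * exp (b * (norm (bargmann_arg z))\<^sup>2) * exp (a * (norm z)\<^sup>2) = exp (- a * (norm z)\<^sup>2)"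
        unfolding exp_add[symmetric] norm_bargmann_arg a_def by (simp add: field_simps)
      finally show ?thesis
        unfolding profile_def using M(1) c by (simp add: ennreal_mult'[symmetric] ennreal_leI)
    qed
    then have "mixed_qnorm B (profile \<omega> F) \<le> mixed_qnorm B (\<lambda>z. ennreal (M * c) * gauss a z)"
      using gm by (intro lebesgue_mixed_qnorm_mono[OF B] profile_measurable F measurable_weight) auto
    also have "\<dots> = ennreal (M * c) * ennreal g"
      using lebesgue_mixed_qnorm_cmult[OF B gm, of "M * c"] M(1) c g(1) by simp
    finally show ?thesis using M(1) c by (simp add: ennreal_mult'[symmetric] mult.assoc)
  qed
  then show thesis using that[of "c * g"] c g(2) by simp
qed

lemma polynomials_subset_A_space:
  assumes B: "decomposes B"
  shows "polynomials \<subseteq> A_space \<omega> B"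
proof
  fix P :: "complex^'d \<Rightarrow> complex" assume "P \<in> polynomials"
  then have P: "entire P" "poly_growth P" using polynomials_entire_poly_growth by auto
  obtain M where M: "M \<ge> 0" "\<And>w. cmod (P w) \<le> M * exp (1 / 4 * (norm w)\<^sup>2)"
    using poly_growth_gauss[OF P(2)] by blast
  obtain K where K: "\<And>F M. F \<in> borel_measurable borel \<Longrightarrow> 0 \<le> M \<Longrightarrow>
     (\<And>w. cmod (F w) \<le> M * exp (1 / 4 * (norm w)\<^sup>2)) \<Longrightarrow> mixed_qnorm B (profile \<omega> F) \<le> ennreal (M * K)"
    by (rule A_qnorm_gaussian_growth[OF B, of "1 / 4"]) auto
  have "mixed_qnorm B (profile \<omega> P) \<le> ennreal (M * K)"
    by (rule K[OF entire_borel_measurable[OF P(1)] M])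
  then show "P \<in> A_space \<omega> B" using P(1) by (auto simp: A_space_iff intro: le_less_trans)
qed

text \<open>
  The radius \<open>\<rho> = \<surd>r\<close> lies strictly between \<open>r\<close> and \<open>1\<close>, and the growth exponent \<open>b\<close> is chosen
  close enough to \<open>1/2\<close> for \<open>b \<rho>\<^sup>2 < 1/2\<close>.
\<close>

lemma dilation_polynomial_dense:
  assumes B: "decomposes B" and F: "F \<in> A_space \<omega> B" and r: "0 < r" "r < 1" and e: "0 < (e :: ennreal)"
  shows "\<exists>P\<in>polynomials. mixed_qnorm B (profile \<omega> (\<lambda>z. F (r *\<^sub>R z) - P z)) < e"
proof -
  have ent: "entire F" using F by (simp add: A_space_iff)
  define \<rho> where "\<rho> = sqrt r"
  have \<rho>: "0 < \<rho>" "r < \<rho>" "\<rho>\<^sup>2 = r"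
  proof -
    show "0 < \<rho>" "\<rho>\<^sup>2 = r" using r by (auto simp: \<rho>_def)
    have "\<rho> < 1" using r by (simp add: \<rho>_def)
    then have "\<rho> * \<rho> < \<rho> * 1" using \<open>0 < \<rho>\<close> by (intro mult_strict_left_mono)
    then show "r < \<rho>" using \<open>\<rho>\<^sup>2 = r\<close> by (simp add: power2_eq_square)
  qed
  define b where "b = 1 / 2 + (1 - r) / 4"
  have b: "b * r < 1 / 2"
  proof -
    have "1 / 2 - b * r = (1 - r) * (1 / 2 - r / 4)" by (simp add: b_def field_simps power2_eq_square)
    moreover have "0 < (1 - r) * (1 / 2 - r / 4)" using r by (intro mult_pos_pos) auto
    ultimately show ?thesis by linarith
  qed
  obtain M where M: "M \<ge> 0" "\<And>w. cmod (F w) \<le> M * exp (b * (norm w)\<^sup>2)"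
    using A_space_growth[OF B F, of "(1 - r) / 4"] r by (auto simp: b_def)
  obtain K where K: "0 \<le> K" "\<And>F M. F \<in> borel_measurable borel \<Longrightarrow> 0 \<le> M \<Longrightarrow>
     (\<And>w. cmod (F w) \<le> M * exp (b * r * (norm w)\<^sup>2)) \<Longrightarrow> mixed_qnorm B (profile \<omega> F) \<le> ennreal (M * K)"
    by (rule A_qnorm_gaussian_growth[OF B b]) auto
  define q where "q = r / \<rho>"
  have q: "0 < q" "q < 1" using r \<rho> by (auto simp: q_def)
  have "(\<lambda>N. ennreal (M / (1 - q) * K * q ^ N)) \<longlonglongrightarrow> ennreal (M / (1 - q) * K * 0)"
    using q by (intro tendsto_ennrealI tendsto_mult_left LIMSEQ_power_zero) auto
  then have "eventually (\<lambda>N. ennreal (M / (1 - q) * K * q ^ N) < e) sequentially"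
    using e by (intro order_tendstoD(2)) auto
  then obtain N where N: "ennreal (M / (1 - q) * K * q ^ N) < e"
    by (auto simp: eventually_sequentially)
  obtain P where P: "P \<in> polynomials"
    "\<And>w. cmod (F (r *\<^sub>R w) - P w) \<le> M * exp (b * \<rho>\<^sup>2 * (norm w)\<^sup>2) * (r / \<rho>) ^ N / (1 - r / \<rho>)"
    using dilation_polynomial_approximation[OF ent M(2) r(1) \<rho>(2)] by metis
  have "entire P" using polynomials_entire_poly_growth[OF P(1)] by simp
  then have [measurable]: "P \<in> borel_measurable borel" "(\<lambda>z. F (r *\<^sub>R z)) \<in> borel_measurable borel"
    using entire_dilation[OF ent] by (auto intro: entire_borel_measurable)
  have "mixed_qnorm B (profile \<omega> (\<lambda>z. F (r *\<^sub>R z) - P z)) \<le> ennreal (M * q ^ N / (1 - q) * K)"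
  proof (rule K(2))
    show "0 \<le> M * q ^ N / (1 - q)" using M(1) q by simp
    show "cmod (F (r *\<^sub>R w) - P w) \<le> M * q ^ N / (1 - q) * exp (b * r * (norm w)\<^sup>2)" for w
      using P(2)[of w] by (simp add: \<rho>(3) q_def[symmetric] mult_ac)
  qed measurable
  also have "M * q ^ N / (1 - q) * K = M / (1 - q) * K * q ^ N" by simp
  finally show ?thesis using P(1) N by (meson le_less_trans)
qed

end

section \<open>Dilations\<close>

context gaussian_weight
begin

text \<open>
  The hypothesis at \<open>x = z / \<surd>2\<close> bounds \<open>\<omega>(z)\<close> by \<open>\<omega>(r z)\<close> at the cost of a factor at most
  \<open>exp ((1 - r\<^sup>2) |z|\<^sup>2 / 4)\<close>, and this is the quotient of the Gaussian factors at \<open>r z\<close> and at \<open>z\<close>.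
\<close>

lemma profile_dilation:
  assumes "dilated_suitable \<omega>"
  obtains C \<theta> where "0 < C" "0 < \<theta>" "\<theta> < 1"
    "\<And>F r z. 1 - \<theta> < r \<Longrightarrow> r < 1 \<Longrightarrow> profile \<omega> (\<lambda>z. F (r *\<^sub>R z)) z \<le> ennreal C * profile \<omega> F (r *\<^sub>R z)"
proof -
  obtain \<epsilon> where \<epsilon>: "0 < \<epsilon>" "\<epsilon> \<le> 1" "dilated_suitable_wrt \<epsilon> \<omega>"
    using assms unfolding dilated_suitable_def by auto
  then obtain C \<theta> where C: "0 < C" "0 < \<theta>" "\<theta> < 1" "\<And>x r. 1 - \<theta> < r \<Longrightarrow> r < 1 \<Longrightarrow>
      \<omega> (sqrt 2 *\<^sub>R x) * exp (- \<epsilon> * (1 - r\<^sup>2) * (norm x)\<^sup>2 / 2) \<le> C * \<omega> ((sqrt 2 * r) *\<^sub>R x)"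
    unfolding dilated_suitable_wrt_def by (force simp: Ball_def)
  have "profile \<omega> (\<lambda>z. F (r *\<^sub>R z)) z \<le> ennreal C * profile \<omega> F (r *\<^sub>R z)"
    if r: "1 - \<theta> < r" "r < 1" for F r z
  proof -
    have r01: "0 < r" using r C by linarith
    then have r2: "r\<^sup>2 < 1" using r by (simp add: power_less_one_iff)
    let ?N = "(norm z)\<^sup>2" and ?F = "bargmann_const TYPE('d) * cmod (F (r *\<^sub>R bargmann_arg z))"
    have "\<omega> z * exp (- \<epsilon> * (1 - r\<^sup>2) * ?N / 4) \<le> C * \<omega> (r *\<^sub>R z)"
      using C(4)[OF r, of "(1 / sqrt 2) *\<^sub>R z"] by (simp add: power_divide)
    moreover have "exp (- (1 - r\<^sup>2) * ?N / 4) \<le> exp (- \<epsilon> * (1 - r\<^sup>2) * ?N / 4)"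
    proof -
      have "\<epsilon> * ((1 - r\<^sup>2) * ?N) \<le> 1 * ((1 - r\<^sup>2) * ?N)"
        using \<epsilon> r2 by (intro mult_right_mono) auto
      moreover have "- (1 - r\<^sup>2) * ?N / 4 = - ((1 - r\<^sup>2) * ?N) / 4"
        "- \<epsilon> * (1 - r\<^sup>2) * ?N / 4 = - (\<epsilon> * ((1 - r\<^sup>2) * ?N)) / 4"
        by (simp_all only: mult.assoc mult_minus_left)
      ultimately have "- (1 - r\<^sup>2) * ?N / 4 \<le> - \<epsilon> * (1 - r\<^sup>2) * ?N / 4" by linarith
      then show ?thesis by (simp only: exp_le_cancel_iff)
    qed
    then have "\<omega> z * exp (- (1 - r\<^sup>2) * ?N / 4) \<le> \<omega> z * exp (- \<epsilon> * (1 - r\<^sup>2) * ?N / 4)"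
      using pos[of z] by (intro mult_left_mono) auto
    ultimately have "\<omega> z * exp (- (1 - r\<^sup>2) * ?N / 4) \<le> C * \<omega> (r *\<^sub>R z)"
      by linarith
    then have "(\<omega> z * exp (- (1 - r\<^sup>2) * ?N / 4)) * (exp (- r\<^sup>2 * ?N / 4) * ?F) \<le> (C * \<omega> (r *\<^sub>R z)) * (exp (- r\<^sup>2 * ?N / 4) * ?F)"
      by (intro mult_right_mono) auto
    moreover have exps: "exp (- (1 - r\<^sup>2) * ?N / 4) * exp (- r\<^sup>2 * ?N / 4) = exp (- ?N / 4)"
      unfolding exp_add[symmetric] by (simp add: field_simps)
    have "(\<omega> z * exp (- (1 - r\<^sup>2) * ?N / 4)) * (exp (- r\<^sup>2 * ?N / 4) * ?F) = exp (- ?N / 4) * ?F * \<omega> z"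
      unfolding exps[symmetric] by (simp only: mult_ac)
    ultimately have "exp (- ?N / 4) * ?F * \<omega> z \<le> (C * \<omega> (r *\<^sub>R z)) * (exp (- r\<^sup>2 * ?N / 4) * ?F)"
      by (simp only:)
    then show ?thesis
      using C(1) by (simp add: profile_def bargmann_arg_scaleR power_mult_distrib ennreal_mult'[symmetric] ennreal_leI mult_ac)
  qed
  then show thesis using that C by blast
qed

text \<open>
  For \<open>1/2 \<le> r \<le> 1\<close> the factor \<open>r\<^sup>k\<close> of the dilation is bounded.
\<close>

lemma dominated_by_dilation:
  assumes B: "decomposes B" and C: "0 \<le> C"
  obtains K where "0 < K" "\<And>D h r. 1 / 2 \<le> r \<Longrightarrow> r \<le> 1 \<Longrightarrow> D \<in> borel_measurable lebesgue \<Longrightarrow> h \<in> borel_measurable lebesgue \<Longrightarrow>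
     (\<And>z :: complex^'d. D z \<le> ennreal C * h (r *\<^sub>R z) + h z) \<Longrightarrow> mixed_qnorm B D \<le> ennreal K * mixed_qnorm B h"
proof -
  obtain K0 where K0: "0 < K0" "\<And>f g. f \<in> borel_measurable lebesgue \<Longrightarrow> g \<in> borel_measurable lebesgue \<Longrightarrow>
     mixed_qnorm B (\<lambda>z. f z + g z) \<le> ennreal K0 * (mixed_qnorm B f + mixed_qnorm B g)"
    by (rule lebesgue_mixed_qnorm_triangle[OF B]) blast
  obtain k where k: "\<And>r f. 0 < r \<Longrightarrow> f \<in> borel_measurable lebesgue \<Longrightarrow>
     mixed_qnorm B (\<lambda>z. f (r *\<^sub>R z)) = ennreal (r powr k) * mixed_qnorm B f"
    by (rule lebesgue_mixed_qnorm_dilation[OF B]) blast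
  define K where "K = K0 * (C * 2 powr \<bar>k\<bar> + 1)"
  have "mixed_qnorm B D \<le> ennreal K * mixed_qnorm B h"
    if r: "1 / 2 \<le> r" "r \<le> 1" and D: "D \<in> borel_measurable lebesgue" and h: "h \<in> borel_measurable lebesgue"
      and le: "\<And>z. D z \<le> ennreal C * h (r *\<^sub>R z) + h z" for D h r
  proof -
    have hr: "(\<lambda>z. h (r *\<^sub>R z)) \<in> borel_measurable lebesgue" by (rule lebesgue_measurable_dilation[OF h])
    note [measurable] = hr h
    have rk: "r powr k \<le> 2 powr \<bar>k\<bar>"
    proof -
      have "r powr k = (1 / r) powr (- k)" using r by (simp add: powr_minus powr_divide)
      also have "\<dots> \<le> (1 / r) powr \<bar>k\<bar>" using r by (intro powr_mono) auto
      also have "\<dots> \<le> 2 powr \<bar>k\<bar>" using r by (intro powr_mono2) (auto simp: field_simps)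
      finally show ?thesis .
    qed
    have "mixed_qnorm B D \<le> mixed_qnorm B (\<lambda>z. ennreal C * h (r *\<^sub>R z) + h z)"
      using le by (intro lebesgue_mixed_qnorm_mono[OF B D]) auto
    also have "\<dots> \<le> ennreal K0 * (mixed_qnorm B (\<lambda>z. ennreal C * h (r *\<^sub>R z)) + mixed_qnorm B h)"
      by (rule K0(2)) measurable
    also have "mixed_qnorm B (\<lambda>z. ennreal C * h (r *\<^sub>R z)) = ennreal C * (ennreal (r powr k) * mixed_qnorm B h)"
      using lebesgue_mixed_qnorm_cmult[OF B hr C] k[OF _ h, of r] r by simp
    also have "\<dots> \<le> ennreal C * (ennreal (2 powr \<bar>k\<bar>) * mixed_qnorm B h)"
      using rk by (intro mult_left_mono mult_right_mono ennreal_leI) auto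
    also have "ennreal K0 * (ennreal C * (ennreal (2 powr \<bar>k\<bar>) * mixed_qnorm B h) + mixed_qnorm B h) = ennreal K * mixed_qnorm B h"
    proof -
      have "ennreal K = ennreal K0 * (ennreal C * ennreal (2 powr \<bar>k\<bar>) + 1)"
        using K0(1) C by (simp add: K_def ennreal_mult' ennreal_plus)
      then show ?thesis by (simp add: distrib_left distrib_right mult.assoc)
    qed
    finally show ?thesis by (simp add: mult_left_mono add_right_mono)
  qed
  moreover have "0 < K" using K0(1) C by (simp add: K_def add_nonneg_pos)
  ultimately show thesis using that by blast
qed

lemma profile_diff_le:
  "profile \<omega> (\<lambda>z. F z - G z) z \<le> profile \<omega> F z + profile \<omega> G z"
proof -
  let ?c = "bargmann_const TYPE('d) * exp (- (norm z)\<^sup>2 / 4)"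
  have "?c * cmod (F (bargmann_arg z) - G (bargmann_arg z)) * \<omega> z
      \<le> ?c * (cmod (F (bargmann_arg z)) + cmod (G (bargmann_arg z))) * \<omega> z"
    using pos[of z] by (intro mult_right_mono mult_left_mono norm_triangle_ineq4) auto
  then show ?thesis
    using pos[of z] by (simp add: profile_def ennreal_plus[symmetric] distrib_left distrib_right ennreal_leI less_imp_le del: ennreal_plus)
qed

lemma ennreal_below_pos:
  assumes "0 < (e :: ennreal)"
  obtains x where "0 < x" "ennreal x \<le> e"
proof (cases e)
  case (real y)
  then show thesis using that[of y] assms by simp
next
  case top
  then show thesis using that[of 1] by simp
qed

text \<open>
  \<open>F\<close> is uniformly continuous on the ball, where the weight is at most a constant; the indicator of
  the ball is dominated by a Gaussian, whose quasi-norm is finite.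
\<close>

lemma dilation_converges_on_ball:
  assumes B: "decomposes B" and F: "entire F" and R: "0 \<le> R"
  shows "((\<lambda>r. mixed_qnorm B (\<lambda>z. profile \<omega> (\<lambda>z. F (r *\<^sub>R z) - F z) z * indicator {z. norm z \<le> R} z)) \<longlongrightarrow> 0) (at_left 1)"
proof (rule order_tendstoI)
  fix e :: ennreal assume "0 < e"
  then obtain x where x: "0 < x" "ennreal x \<le> e" by (rule ennreal_below_pos)
  obtain C where C: "0 < C" "\<And>z. \<omega> z \<le> C * exp (1 * (norm z)\<^sup>2)"
    using gaussian_bounds[of 1] by auto
  have "mixed_qnorm B (gauss 1) < top" using B unfolding decomposes_def by (intro mixed_qnorm_gauss) auto
  then obtain g where g: "mixed_qnorm B (gauss 1) = ennreal g" "0 \<le> g" by (cases "mixed_qnorm B (gauss 1)") auto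
  have gm: "gauss 1 \<in> borel_measurable (lebesgue :: (complex^'d) measure)"
    by (rule measurable_completion) measurable
  define A where "A = bargmann_const TYPE('d) * C * exp (2 * R\<^sup>2)"
  have A: "0 < A" using C(1) by (simp add: A_def)
  define \<delta> where "\<delta> = x / (2 * A * (g + 1))"
  have \<delta>: "0 < \<delta>" "\<delta> * A * g < x"
  proof -
    show "0 < \<delta>" using x A g by (simp add: \<delta>_def)
    have "\<delta> * A * g = (x / 2) * (g / (g + 1))" using A by (simp add: \<delta>_def)
    also have "\<dots> \<le> (x / 2) * 1" using x g by (intro mult_left_mono) auto
    finally show "\<delta> * A * g < x" using x by simp
  qed
  have "uniformly_continuous_on (cball 0 R) F"
    using entire_continuous[OF F] by (intro compact_uniformly_continuous) (auto intro: continuous_on_subset)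
  then obtain d where d: "0 < d" "\<And>w w'. w \<in> cball 0 R \<Longrightarrow> w' \<in> cball 0 R \<Longrightarrow> dist w' w < d \<Longrightarrow> dist (F w') (F w) < \<delta>"
    unfolding uniformly_continuous_on_def using \<delta>(1) by metis
  have "eventually (\<lambda>r. r \<in> {max 0 (1 - d / (R + 1))<..<1}) (at_left (1::real))"
    using d(1) R by (intro eventually_at_leftI[of "max 0 (1 - d / (R + 1))"]) auto
  then show "eventually (\<lambda>r. mixed_qnorm B (\<lambda>z. profile \<omega> (\<lambda>z. F (r *\<^sub>R z) - F z) z * indicator {z. norm z \<le> R} z) < e) (at_left 1)"
  proof eventually_elim
    case (elim r)
    then have r: "0 < r" "r < 1" "1 - d / (R + 1) < r" by auto
    have close: "cmod (F (r *\<^sub>R w) - F w) \<le> \<delta>" if w: "norm w \<le> R" for w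
    proof -
      have "norm (r *\<^sub>R w - w) = (1 - r) * norm w"
        using r norm_scaleR[of "r - 1" w] by (simp add: scaleR_diff_left)
      also have "\<dots> \<le> (1 - r) * (R + 1)" using w r by (intro mult_left_mono) auto
      also have "\<dots> < d / (R + 1) * (R + 1)" using r R by (intro mult_strict_right_mono) auto
      also have "\<dots> = d" using R by simp
      finally have "dist (r *\<^sub>R w) w < d" by (simp add: dist_norm)
      moreover have "norm (r *\<^sub>R w) \<le> R"
        using w r mult_left_le_one_le[of "norm w" r] by simp
      ultimately have "dist (F (r *\<^sub>R w)) (F w) < \<delta>" using w by (intro d(2)) auto
      then show ?thesis by (simp add: dist_norm)
    qed
    have "profile \<omega> (\<lambda>z. F (r *\<^sub>R z) - F z) z * indicator {z. norm z \<le> R} z \<le> ennreal (\<delta> * A) * gauss 1 z" for z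
    proof (cases "norm z \<le> R")
      case True
      have "(norm (bargmann_arg z))\<^sup>2 \<le> (norm z)\<^sup>2"
        by (simp add: norm_bargmann_arg)
      then have "norm (bargmann_arg z) \<le> norm z" by (rule power2_le_imp_le) simp
      then have "cmod (F (r *\<^sub>R bargmann_arg z) - F (bargmann_arg z)) \<le> \<delta>" using True by (intro close) auto
      then have "bargmann_const TYPE('d) * exp (- (norm z)\<^sup>2 / 4) * cmod (F (r *\<^sub>R bargmann_arg z) - F (bargmann_arg z)) * \<omega> z
          \<le> bargmann_const TYPE('d) * 1 * \<delta> * (C * exp (1 * (norm z)\<^sup>2))"
        using C pos[of z] \<delta>(1) by (intro mult_mono mult_left_mono) (auto intro: less_imp_le)
      also have "exp (1 * (norm z)\<^sup>2) = exp (2 * (norm z)\<^sup>2) * exp (- 1 * (norm z)\<^sup>2)"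
        unfolding exp_add[symmetric] by simp
      also have "bargmann_const TYPE('d) * 1 * \<delta> * (C * (exp (2 * (norm z)\<^sup>2) * exp (- 1 * (norm z)\<^sup>2)))
          = (bargmann_const TYPE('d) * \<delta> * C) * (exp (2 * (norm z)\<^sup>2) * exp (- 1 * (norm z)\<^sup>2))"
        by (simp only: mult_ac mult_1_right)
      also have "\<dots> \<le> (bargmann_const TYPE('d) * \<delta> * C) * (exp (2 * R\<^sup>2) * exp (- 1 * (norm z)\<^sup>2))"
        using C(1) \<delta>(1) True by (intro mult_left_mono mult_right_mono) (auto intro: power_mono)
      also have "\<dots> = (\<delta> * A) * exp (- 1 * (norm z)\<^sup>2)" by (simp add: A_def)
      finally show ?thesis
        using True \<delta>(1) A by (simp add: profile_def ennreal_mult'[symmetric] ennreal_leI)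
    qed simp
    moreover have "(\<lambda>z. profile \<omega> (\<lambda>z. F (r *\<^sub>R z) - F z) z * indicator {z. norm z \<le> R} z) \<in> borel_measurable lebesgue"
      using entire_borel_measurable[OF F] entire_borel_measurable[OF entire_dilation[OF F]]
      by (intro borel_measurable_times_ennreal profile_measurable measurable_weight lebesgue_measurable_indicator borel_measurable_diff) auto
    ultimately have "mixed_qnorm B (\<lambda>z. profile \<omega> (\<lambda>z. F (r *\<^sub>R z) - F z) z * indicator {z. norm z \<le> R} z)
        \<le> mixed_qnorm B (\<lambda>z. ennreal (\<delta> * A) * gauss 1 z)"
      using gm by (intro lebesgue_mixed_qnorm_mono[OF B]) auto
    also have "\<dots> = ennreal (\<delta> * A) * ennreal g"
      using lebesgue_mixed_qnorm_cmult[OF B gm, of "\<delta> * A"] \<delta>(1) A g(1) by simp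
    also have "\<dots> = ennreal (\<delta> * A * g)" using \<delta>(1) A by (simp add: ennreal_mult')
    also have "\<dots> < ennreal x" using \<delta>(2) x(1) by (intro ennreal_lessI)
    finally show ?case using x(2) by (rule less_le_trans)
  qed
qed auto

lemma profile_dilation_diff_measurable:
  assumes "entire F"
  shows "profile \<omega> (\<lambda>z. F (r *\<^sub>R z) - F z) \<in> borel_measurable lebesgue"
  using entire_borel_measurable[OF assms] entire_borel_measurable[OF entire_dilation[OF assms]]
  by (intro profile_measurable measurable_weight borel_measurable_diff) auto

lemma eventually_at_left_one: "a < 1 \<Longrightarrow> eventually (\<lambda>r. a < r \<and> r < 1) (at_left (1::real))"
  by (rule eventually_at_leftI[of a]) auto

lemma dilation_mem_A_space:
  assumes B: "decomposes B" and ds: "dilated_suitable \<omega>" and F: "F \<in> A_space \<omega> B"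
  shows "eventually (\<lambda>r. (\<lambda>z. F (r *\<^sub>R z)) \<in> A_space \<omega> B) (at_left 1)"
proof -
  obtain C \<theta> where C: "0 < C" "0 < \<theta>" "\<theta> < 1"
    "\<And>F r z. 1 - \<theta> < r \<Longrightarrow> r < 1 \<Longrightarrow> profile \<omega> (\<lambda>z. F (r *\<^sub>R z)) z \<le> ennreal C * profile \<omega> F (r *\<^sub>R z)"
    by (rule profile_dilation[OF ds]) blast
  obtain K where K: "0 < K" "\<And>D h r. 1 / 2 \<le> r \<Longrightarrow> r \<le> 1 \<Longrightarrow> D \<in> borel_measurable lebesgue \<Longrightarrow> h \<in> borel_measurable lebesgue \<Longrightarrow>
     (\<And>z :: complex^'d. D z \<le> ennreal C * h (r *\<^sub>R z) + h z) \<Longrightarrow> mixed_qnorm B D \<le> ennreal K * mixed_qnorm B h"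
    by (rule dominated_by_dilation[OF B less_imp_le[OF C(1)]]) blast
  have ent: "entire F" and fin: "mixed_qnorm B (profile \<omega> F) < top" using F by (auto simp: A_space_iff)
  have "eventually (\<lambda>r. max (1 / 2) (1 - \<theta>) < r \<and> r < 1) (at_left 1)"
    using C by (intro eventually_at_left_one) auto
  then show ?thesis
  proof eventually_elim
    case (elim r)
    have "mixed_qnorm B (profile \<omega> (\<lambda>z. F (r *\<^sub>R z))) \<le> ennreal K * mixed_qnorm B (profile \<omega> F)"
    proof (rule K(2)[of r])
      show "profile \<omega> (\<lambda>z. F (r *\<^sub>R z)) z \<le> ennreal C * profile \<omega> F (r *\<^sub>R z) + profile \<omega> F z" for z
        using C(4)[of r F z] elim by (simp add: add_increasing2)
    qed (use elim ent in \<open>auto intro!: profile_measurable measurable_weight entire_borel_measurable entire_dilation\<close>)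
    also have "\<dots> < top" using fin by (simp add: ennreal_mult_less_top)
    finally show ?case using entire_dilation[OF ent] by (simp add: A_space_iff)
  qed
qed

text \<open>
  If \<open>|z| > 2R\<close> and \<open>r \<ge> 1/2\<close>, both \<open>z\<close> and \<open>r z\<close> lie outside the ball of radius \<open>R\<close>.  The bound
  holds for infinite exponents too.
\<close>

lemma dilation_tail_bound:
  assumes B: "decomposes B" and ds: "dilated_suitable \<omega>"
  obtains K \<theta> where "0 < K" "0 < \<theta>" "\<theta> \<le> 1 / 2" "\<And>F r R. entire F \<Longrightarrow> 1 - \<theta> < r \<Longrightarrow> r < 1 \<Longrightarrow>
     mixed_qnorm B (\<lambda>z. profile \<omega> (\<lambda>z. F (r *\<^sub>R z) - F z) z * indicator {z. 2 * R < norm z} z)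
       \<le> ennreal K * mixed_qnorm B (\<lambda>z. profile \<omega> F z * indicator {z. R < norm z} z)"
proof -
  obtain C \<theta> where C: "0 < C" "0 < \<theta>" "\<theta> < 1"
    "\<And>F r z. 1 - \<theta> < r \<Longrightarrow> r < 1 \<Longrightarrow> profile \<omega> (\<lambda>z. F (r *\<^sub>R z)) z \<le> ennreal C * profile \<omega> F (r *\<^sub>R z)"
    by (rule profile_dilation[OF ds]) blast
  obtain K where K: "0 < K" "\<And>D h r. 1 / 2 \<le> r \<Longrightarrow> r \<le> 1 \<Longrightarrow> D \<in> borel_measurable lebesgue \<Longrightarrow> h \<in> borel_measurable lebesgue \<Longrightarrow>
     (\<And>z :: complex^'d. D z \<le> ennreal C * h (r *\<^sub>R z) + h z) \<Longrightarrow> mixed_qnorm B D \<le> ennreal K * mixed_qnorm B h"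
    by (rule dominated_by_dilation[OF B less_imp_le[OF C(1)]]) blast
  have "mixed_qnorm B (\<lambda>z. profile \<omega> (\<lambda>z. F (r *\<^sub>R z) - F z) z * indicator {z. 2 * R < norm z} z)
       \<le> ennreal K * mixed_qnorm B (\<lambda>z. profile \<omega> F z * indicator {z. R < norm z} z)"
    if ent: "entire F" and r: "1 - min \<theta> (1 / 2) < r" "r < 1" for F r R
  proof (rule K(2)[of r])
    show "profile \<omega> (\<lambda>z. F (r *\<^sub>R z) - F z) z * indicator {z. 2 * R < norm z} z
        \<le> ennreal C * (profile \<omega> F (r *\<^sub>R z) * indicator {z. R < norm z} (r *\<^sub>R z)) + profile \<omega> F z * indicator {z. R < norm z} z" for z
    proof (cases "2 * R < norm z")
      case True
      have "R < norm z" using True norm_ge_zero[of z] by linarith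
      moreover have "R < norm (r *\<^sub>R z)"
      proof -
        have "(1 / 2) * norm z \<le> r * norm z" using r by (intro mult_right_mono) auto
        then show ?thesis using True r by simp
      qed
      moreover have "profile \<omega> (\<lambda>z. F (r *\<^sub>R z) - F z) z \<le> ennreal C * profile \<omega> F (r *\<^sub>R z) + profile \<omega> F z"
        using profile_diff_le[of "\<lambda>z. F (r *\<^sub>R z)" F z] C(4)[of r F z] r by (meson add_right_mono order_trans min_less_iff_conj less_trans diff_strict_left_mono min.cobounded1 diff_left_mono le_less_trans)
      ultimately show ?thesis using True by simp
    qed simp
    show "(\<lambda>z. profile \<omega> (\<lambda>z. F (r *\<^sub>R z) - F z) z * indicator {z. 2 * R < norm z} z) \<in> borel_measurable lebesgue"
      by (intro borel_measurable_times_ennreal profile_dilation_diff_measurable ent lebesgue_measurable_indicator) measurable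
    show "(\<lambda>z. profile \<omega> F z * indicator {z. R < norm z} z) \<in> borel_measurable lebesgue"
      by (intro borel_measurable_times_ennreal profile_measurable measurable_weight entire_borel_measurable ent lebesgue_measurable_indicator) measurable
  qed (use r in auto)
  then show thesis using that[of K "min \<theta> (1 / 2)"] K(1) C(2) by simp
qed

text \<open>
  The tail is made small first, uniformly in \<open>r\<close>; for the resulting radius the convergence on the
  ball is used.
\<close>

lemma dilation_converges:
  assumes B: "decomposes B" and p: "\<forall>(V, p)\<in>set B. p \<noteq> top" and ds: "dilated_suitable \<omega>" and F: "F \<in> A_space \<omega> B"
  shows "((\<lambda>r. mixed_qnorm B (profile \<omega> (\<lambda>z. F (r *\<^sub>R z) - F z))) \<longlongrightarrow> 0) (at_left 1)"
proof (rule order_tendstoI)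
  fix e :: ennreal assume "0 < e"
  then obtain x where x: "0 < x" "ennreal x \<le> e" by (rule ennreal_below_pos)
  have ent: "entire F" and fin: "mixed_qnorm B (profile \<omega> F) < top" using F by (auto simp: A_space_iff)
  obtain K0 where K0: "0 < K0" "\<And>f g. f \<in> borel_measurable lebesgue \<Longrightarrow> g \<in> borel_measurable lebesgue \<Longrightarrow>
     mixed_qnorm B (\<lambda>z. f z + g z) \<le> ennreal K0 * (mixed_qnorm B f + mixed_qnorm B g)"
    by (rule lebesgue_mixed_qnorm_triangle[OF B]) blast
  obtain K \<theta> where K: "0 < K" "0 < \<theta>" "\<theta> \<le> 1 / 2" "\<And>F r R. entire F \<Longrightarrow> 1 - \<theta> < r \<Longrightarrow> r < 1 \<Longrightarrow>
     mixed_qnorm B (\<lambda>z. profile \<omega> (\<lambda>z. F (r *\<^sub>R z) - F z) z * indicator {z. 2 * R < norm z} z)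
       \<le> ennreal K * mixed_qnorm B (\<lambda>z. profile \<omega> F z * indicator {z. R < norm z} z)"
    by (rule dilation_tail_bound[OF B ds]) blast
  have "(\<lambda>n. mixed_qnorm B (\<lambda>z. profile \<omega> F z * indicator {z. real n < norm z} z)) \<longlonglongrightarrow> 0"
    by (intro lebesgue_mixed_qnorm_tail[OF B p _ fin] profile_measurable measurable_weight entire_borel_measurable ent)
  moreover have "0 < ennreal (x / (4 * K0 * K))" using x K0 K by simp
  ultimately have "eventually (\<lambda>n. mixed_qnorm B (\<lambda>z. profile \<omega> F z * indicator {z. real n < norm z} z) < ennreal (x / (4 * K0 * K))) sequentially"
    by (rule order_tendstoD(2))
  then obtain n where n: "mixed_qnorm B (\<lambda>z. profile \<omega> F z * indicator {z. real n < norm z} z) < ennreal (x / (4 * K0 * K))"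
    by (auto simp: eventually_sequentially)
  have "eventually (\<lambda>r. mixed_qnorm B (\<lambda>z. profile \<omega> (\<lambda>z. F (r *\<^sub>R z) - F z) z * indicator {z. norm z \<le> 2 * real n} z) < ennreal (x / (4 * K0))) (at_left 1)"
    using x K0 by (intro order_tendstoD(2)[OF dilation_converges_on_ball[OF B ent]]) auto
  moreover have "eventually (\<lambda>r. 1 - \<theta> < r \<and> r < 1) (at_left 1)"
    using K by (intro eventually_at_left_one) auto
  ultimately show "eventually (\<lambda>r. mixed_qnorm B (profile \<omega> (\<lambda>z. F (r *\<^sub>R z) - F z)) < e) (at_left 1)"
  proof eventually_elim
    case (elim r)
    define D where "D = profile \<omega> (\<lambda>z. F (r *\<^sub>R z) - F z)"
    have Dm: "D \<in> borel_measurable lebesgue" unfolding D_def by (rule profile_dilation_diff_measurable[OF ent])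
    have "D = (\<lambda>z. D z * indicator {z. norm z \<le> 2 * real n} z + D z * indicator {z. 2 * real n < norm z} z)"
      by (auto simp: indicator_def fun_eq_iff)
    then have "mixed_qnorm B D = mixed_qnorm B (\<lambda>z. D z * indicator {z. norm z \<le> 2 * real n} z + D z * indicator {z. 2 * real n < norm z} z)"
      by (rule arg_cong)
    also have "\<dots> \<le> ennreal K0 * (mixed_qnorm B (\<lambda>z. D z * indicator {z. norm z \<le> 2 * real n} z) + mixed_qnorm B (\<lambda>z. D z * indicator {z. 2 * real n < norm z} z))"
      by (intro K0(2) borel_measurable_times_ennreal Dm lebesgue_measurable_indicator) measurable
    also have "\<dots> \<le> ennreal K0 * (ennreal (x / (4 * K0)) + ennreal K * ennreal (x / (4 * K0 * K)))"
    proof (intro mult_left_mono add_mono)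
      show "mixed_qnorm B (\<lambda>z. D z * indicator {z. norm z \<le> 2 * real n} z) \<le> ennreal (x / (4 * K0))"
        using elim by (simp add: D_def)
      have "mixed_qnorm B (\<lambda>z. D z * indicator {z. 2 * real n < norm z} z)
         \<le> ennreal K * mixed_qnorm B (\<lambda>z. profile \<omega> F z * indicator {z. real n < norm z} z)"
        unfolding D_def using elim by (intro K(4) ent) auto
      also have "\<dots> \<le> ennreal K * ennreal (x / (4 * K0 * K))" using n by (intro mult_left_mono) auto
      finally show "mixed_qnorm B (\<lambda>z. D z * indicator {z. 2 * real n < norm z} z) \<le> ennreal K * ennreal (x / (4 * K0 * K))" .
    qed auto
    also have "\<dots> = ennreal (x / 2)"
    proof -
      have "ennreal K * ennreal (x / (4 * K0 * K)) = ennreal (x / (4 * K0))"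
        using K0(1) K(1) x(1) by (simp add: ennreal_mult'[symmetric])
      moreover have "ennreal (x / (4 * K0)) + ennreal (x / (4 * K0)) = ennreal (x / (2 * K0))"
        using K0(1) x(1) by (simp add: ennreal_plus[symmetric] del: ennreal_plus)
      moreover have "ennreal K0 * ennreal (x / (2 * K0)) = ennreal (x / 2)"
        using K0(1) x(1) by (simp add: ennreal_mult'[symmetric])
      ultimately show ?thesis by simp
    qed
    also have "ennreal (x / 2) < ennreal x" using x by (simp add: ennreal_less_iff)
    finally show ?case using x(2) unfolding D_def by (rule less_le_trans)
  qed
qed auto

end

section \<open>The Gaussian pairing\<close>

lemma ennreal_tendsto_0_le:
  fixes f g :: "'a \<Rightarrow> ennreal"
  assumes "(f \<longlongrightarrow> 0) F" "\<And>x. g x \<le> f x"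
  shows "(g \<longlongrightarrow> 0) F"
  by (rule tendsto_sandwich[OF _ _ tendsto_const assms(1)]) (simp_all add: assms(2))

lemma cnj_borel_measurable [measurable]: "cnj \<in> borel_measurable borel"
  by (intro borel_measurable_continuous_onI continuous_intros)

text \<open>
  The substitution \<open>w = bargmann_arg z\<close> turns \<open>exp (- |w|\<^sup>2)\<close> into \<open>exp (- |z|\<^sup>2 / 2)\<close>, the product of
  the two factors \<open>exp (- |z|\<^sup>2 / 4)\<close>, and the weights cancel.
\<close>

lemma gauss_measure_pairing:
  fixes \<omega> :: "complex^'d \<Rightarrow> real"
  assumes \<omega>: "\<And>z. 0 < \<omega> z"
  obtains c where "0 < c" "\<And>G F. G \<in> borel_measurable borel \<Longrightarrow> F \<in> borel_measurable borel \<Longrightarrow>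
     (\<integral>\<^sup>+z. ennreal (cmod (G z * cnj (F z))) \<partial>gauss_measure)
       = ennreal c * (\<integral>\<^sup>+z. profile (\<lambda>z. 1 / \<omega> z) F z * profile \<omega> G z \<partial>lborel)"
proof -
  let ?\<kappa> = "bargmann_const TYPE('d)" and ?p = "pi powr (- real CARD('d))"
  define q where "q = ?p / ?\<kappa>\<^sup>2"
  have q: "0 < q" unfolding q_def by (intro divide_pos_pos zero_less_power bargmann_const_pos) simp
  define c where "c = (1 / sqrt 2) ^ DIM(complex^'d) * q"
  have c: "0 < c" using q by (simp add: c_def)
  have "(\<integral>\<^sup>+z. ennreal (cmod (G z * cnj (F z))) \<partial>gauss_measure)
       = ennreal c * (\<integral>\<^sup>+z. profile (\<lambda>z. 1 / \<omega> z) F z * profile \<omega> G z \<partial>lborel)"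
    if [measurable]: "G \<in> borel_measurable borel" "F \<in> borel_measurable borel" for G F :: "complex^'d \<Rightarrow> complex"
  proof -
    define h where "h w = ennreal (?p * exp (- (norm w)\<^sup>2)) * ennreal (cmod (G w * cnj (F w)))" for w
    have [measurable]: "h \<in> borel_measurable borel" unfolding h_def by measurable
    have "(\<integral>\<^sup>+z. ennreal (cmod (G z * cnj (F z))) \<partial>gauss_measure) = (\<integral>\<^sup>+w. h w \<partial>lborel)"
      unfolding gauss_measure_def h_def by (rule nn_integral_density) measurable
    also have "\<dots> = ennreal ((1 / sqrt 2) ^ DIM(complex^'d)) * (\<integral>\<^sup>+z. h (bargmann_arg z) \<partial>lborel)"
      by (rule nn_integral_bargmann_arg) measurable
    also have "(\<integral>\<^sup>+z. h (bargmann_arg z) \<partial>lborel)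
        = (\<integral>\<^sup>+z. ennreal (q * (?\<kappa>\<^sup>2 * exp (- (norm z)\<^sup>2 / 2) * (cmod (F (bargmann_arg z)) * cmod (G (bargmann_arg z))))) \<partial>lborel)"
      by (intro nn_integral_cong)
         (simp add: h_def q_def norm_bargmann_arg norm_mult ennreal_mult'[symmetric] mult_ac bargmann_const_def)
    also have "\<dots> = (\<integral>\<^sup>+z. ennreal q * ennreal (?\<kappa>\<^sup>2 * exp (- (norm z)\<^sup>2 / 2) * (cmod (F (bargmann_arg z)) * cmod (G (bargmann_arg z)))) \<partial>lborel)"
      using q by (simp only: ennreal_mult'[OF less_imp_le])
    also have "\<dots> = ennreal q * (\<integral>\<^sup>+z. ennreal (?\<kappa>\<^sup>2 * exp (- (norm z)\<^sup>2 / 2) * (cmod (F (bargmann_arg z)) * cmod (G (bargmann_arg z)))) \<partial>lborel)"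
      by (rule nn_integral_cmult) measurable
    also have "(\<integral>\<^sup>+z. ennreal (?\<kappa>\<^sup>2 * exp (- (norm z)\<^sup>2 / 2) * (cmod (F (bargmann_arg z)) * cmod (G (bargmann_arg z)))) \<partial>lborel)
        = (\<integral>\<^sup>+z. profile (\<lambda>z. 1 / \<omega> z) F z * profile \<omega> G z \<partial>lborel)"
    proof (rule nn_integral_cong)
      fix z :: "complex^'d"
      have "exp (- (norm z)\<^sup>2 / 2) = exp (- (norm z)\<^sup>2 / 4) * exp (- (norm z)\<^sup>2 / 4)"
        unfolding exp_add[symmetric] by simp
      then have "?\<kappa>\<^sup>2 * exp (- (norm z)\<^sup>2 / 2) * (cmod (F (bargmann_arg z)) * cmod (G (bargmann_arg z)))
          = (?\<kappa> * exp (- (norm z)\<^sup>2 / 4) * cmod (F (bargmann_arg z)) * (1 / \<omega> z))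
            * (?\<kappa> * exp (- (norm z)\<^sup>2 / 4) * cmod (G (bargmann_arg z)) * \<omega> z)"
        using \<omega>[of z] by (simp add: power2_eq_square)
      then show "ennreal (?\<kappa>\<^sup>2 * exp (- (norm z)\<^sup>2 / 2) * (cmod (F (bargmann_arg z)) * cmod (G (bargmann_arg z))))
          = profile (\<lambda>z. 1 / \<omega> z) F z * profile \<omega> G z"
        unfolding profile_def using \<omega>[of z] by (simp only: ennreal_mult' bargmann_const_nonneg mult_nonneg_nonneg exp_ge_zero norm_ge_zero divide_nonneg_nonneg zero_le_one less_imp_le)
    qed
    finally show ?thesis
      using q by (simp add: c_def ennreal_mult' mult.assoc)
  qed
  then show thesis using that c by blast
qed

lemma gauss_measure_measurable:
  "F \<in> borel_measurable borel \<Longrightarrow> F \<in> borel_measurable gauss_measure"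
  by (simp add: gauss_measure_def cong: measurable_cong_sets)

lemma A2_pairing_tendsto:
  fixes H :: "'i \<Rightarrow> complex^'d \<Rightarrow> complex"
  assumes meas: "\<And>i. H i \<in> borel_measurable borel" "G \<in> borel_measurable borel" "F \<in> borel_measurable borel"
    and int: "eventually (\<lambda>i. (\<integral>\<^sup>+z. ennreal (cmod (H i z * cnj (F z))) \<partial>gauss_measure) < top) Fl"
      "(\<integral>\<^sup>+z. ennreal (cmod (G z * cnj (F z))) \<partial>gauss_measure) < top"
    and lim: "((\<lambda>i. \<integral>\<^sup>+z. ennreal (cmod ((H i z - G z) * cnj (F z))) \<partial>gauss_measure) \<longlongrightarrow> 0) Fl"
  shows "((\<lambda>i. A2_pairing (H i) F) \<longlongrightarrow> A2_pairing G F) Fl"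
proof -
  note [measurable] = meas
  have prod_meas: "(\<lambda>z. G z * cnj (F z)) \<in> borel_measurable gauss_measure"
    "(\<lambda>z. H i z * cnj (F z)) \<in> borel_measurable gauss_measure" for i
    by (rule gauss_measure_measurable, measurable)+
  have iG: "integrable gauss_measure (\<lambda>z. G z * cnj (F z))"
    by (rule integrableI_bounded[OF prod_meas(1)]) (use int(2) in simp)
  have "((\<lambda>i. A2_pairing (H i) F - A2_pairing G F) \<longlongrightarrow> 0) Fl"
  proof (rule tendstoI)
    fix e :: real assume e: "0 < e"
    have "eventually (\<lambda>i. (\<integral>\<^sup>+z. ennreal (cmod ((H i z - G z) * cnj (F z))) \<partial>gauss_measure) < ennreal e) Fl"
      using e by (intro order_tendstoD(2)[OF lim]) simp
    with int(1) show "eventually (\<lambda>i. dist (A2_pairing (H i) F - A2_pairing G F) 0 < e) Fl"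
    proof eventually_elim
      case (elim i)
      have iH: "integrable gauss_measure (\<lambda>z. H i z * cnj (F z))"
        by (rule integrableI_bounded[OF prod_meas(2)]) (use elim(1) in simp)
      have "A2_pairing (H i) F - A2_pairing G F = (LINT z|gauss_measure. (H i z - G z) * cnj (F z))"
        unfolding A2_pairing_def left_diff_distrib by (rule Bochner_Integration.integral_diff[symmetric, OF iH iG])
      moreover have "integrable gauss_measure (\<lambda>z. (H i z - G z) * cnj (F z))"
        unfolding left_diff_distrib by (rule Bochner_Integration.integrable_diff[OF iH iG])
      ultimately have "ennreal (cmod (A2_pairing (H i) F - A2_pairing G F)) < ennreal e"
        using integral_norm_bound_ennreal[of gauss_measure "\<lambda>z. (H i z - G z) * cnj (F z)"] elim(2) by simp
      then show ?case using e by (simp add: ennreal_less_iff)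
    qed
  qed
  then show ?thesis by (simp only: Lim_null[symmetric])
qed

section \<open>Weak* convergence and density\<close>

text \<open>
  Convergence needs to be tested on the generating sets only, by induction on the generation of open
  sets.
\<close>

lemma limitin_topology_generated_by:
  assumes l: "l \<in> \<Union> S" and ev: "\<And>U. U \<in> S \<Longrightarrow> l \<in> U \<Longrightarrow> eventually (\<lambda>x. f x \<in> U) F"
  shows "limitin (topology_generated_by S) f l F"
  unfolding limitin_def
proof (intro conjI allI impI)
  show "l \<in> topspace (topology_generated_by S)"
    using l by (simp add: topology_generated_by_topspace)
  fix U assume "openin (topology_generated_by S) U \<and> l \<in> U"
  then have "generate_topology_on S U" "l \<in> U" by (auto simp: openin_topology_generated_by_iff)
  then show "eventually (\<lambda>x. f x \<in> U) F"
  proof induction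
    case (Int a b)
    then show ?case by (auto intro: eventually_conj)
  next
    case (UN K)
    then obtain k where "k \<in> K" "l \<in> k" by blast
    then have "eventually (\<lambda>x. f x \<in> k) F" using UN.IH by blast
    then show ?case using \<open>k \<in> K\<close> by (auto elim: eventually_mono)
  qed (use ev in auto)
qed

lemma limitin_weak_star:
  assumes G: "G \<in> A_space \<omega> (dual_space B)" and H: "eventually (\<lambda>i. H i \<in> A_space \<omega> (dual_space B)) Fl"
    and lim: "\<And>F. F \<in> A_space (\<lambda>z. 1 / \<omega> z) B \<Longrightarrow> ((\<lambda>i. A2_pairing (H i) F) \<longlongrightarrow> A2_pairing G F) Fl"
    and B: "is_mixed_space B"
  shows "limitin (weak_star \<omega> B) H G Fl"
  unfolding weak_star_def
proof (rule limitin_topology_generated_by)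
  show "G \<in> \<Union> {{G \<in> A_space \<omega> (dual_space B). A2_pairing G F \<in> U} | F U. F \<in> A_space (\<lambda>z. 1 / \<omega> z) B \<and> open U}"
    using G topspace_weak_star[OF B, of \<omega>] by (simp add: weak_star_def topology_generated_by_topspace)
  fix W assume W: "W \<in> {{G \<in> A_space \<omega> (dual_space B). A2_pairing G F \<in> U} | F U. F \<in> A_space (\<lambda>z. 1 / \<omega> z) B \<and> open U}" "G \<in> W"
  then obtain F U where FU: "W = {G \<in> A_space \<omega> (dual_space B). A2_pairing G F \<in> U}" "F \<in> A_space (\<lambda>z. 1 / \<omega> z) B" "open U"
    by blast
  have "eventually (\<lambda>i. A2_pairing (H i) F \<in> U) Fl"
    using lim[OF FU(2)] FU(1,3) W(2) by (auto simp: tendsto_def)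
  with H show "eventually (\<lambda>i. H i \<in> W) Fl" unfolding FU(1) by eventually_elim simp
qed

context gaussian_weight
begin

lemma inverse_weight_measurable: "(\<lambda>z. 1 / \<omega> z) \<in> borel_measurable lebesgue"
  using measurable_weight by measurable

lemma A_space_inverse_iff:
  "F \<in> A_space (\<lambda>z. 1 / \<omega> z) B \<longleftrightarrow> entire F \<and> mixed_qnorm B (profile (\<lambda>z. 1 / \<omega> z) F) < top"
  using pos by (simp add: A_space_def A_qnorm_eq_profile)

text \<open>
  The second estimate splits the integral along \<open>S\<close>, cutting off \<open>G\<close> on one part and \<open>F\<close> on the other.
\<close>

lemma pairing_bound:
  assumes B: "decomposes B" and p: "\<forall>(V, p)\<in>set B. 1 \<le> p"
  obtains C where "0 < C" "\<And>G F. G \<in> borel_measurable borel \<Longrightarrow> F \<in> borel_measurable borel \<Longrightarrow>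
     (\<integral>\<^sup>+z. ennreal (cmod (G z * cnj (F z))) \<partial>gauss_measure)
       \<le> ennreal C * (mixed_qnorm B (profile (\<lambda>z. 1 / \<omega> z) F) * mixed_qnorm (dual_space B) (profile \<omega> G))"
    "\<And>G F (S :: (complex^'d) set). G \<in> borel_measurable borel \<Longrightarrow> F \<in> borel_measurable borel \<Longrightarrow> S \<in> sets borel \<Longrightarrow>
     (\<integral>\<^sup>+z. ennreal (cmod (G z * cnj (F z))) \<partial>gauss_measure)
       \<le> ennreal C * (mixed_qnorm B (profile (\<lambda>z. 1 / \<omega> z) F) * mixed_qnorm (dual_space B) (\<lambda>z. profile \<omega> G z * indicator S z)
          + mixed_qnorm B (\<lambda>z. profile (\<lambda>z. 1 / \<omega> z) F z * indicator (- S) z) * mixed_qnorm (dual_space B) (profile \<omega> G))"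
proof -
  let ?N = mixed_qnorm and ?B' = "dual_space B"
  let ?f = "profile (\<lambda>z. 1 / \<omega> z)" and ?g = "profile \<omega>"
  let ?I = "\<lambda>G F. \<integral>\<^sup>+z. ennreal (cmod (G z * cnj (F z))) \<partial>gauss_measure"
  obtain c where c: "0 < c" "\<And>G F. G \<in> borel_measurable borel \<Longrightarrow> F \<in> borel_measurable borel \<Longrightarrow>
     ?I G F = ennreal c * (\<integral>\<^sup>+z. ?f F z * ?g G z \<partial>lborel)"
    by (rule gauss_measure_pairing[of \<omega>]) (use pos in blast)+
  obtain D where D: "0 < D" "\<And>f g. f \<in> borel_measurable lebesgue \<Longrightarrow> g \<in> borel_measurable lebesgue \<Longrightarrow>
     (\<integral>\<^sup>+z. f z * g z \<partial>lborel) \<le> ennreal D * ?N B f * ?N ?B' g"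
    by (rule dual_space_pairing_bound[OF B p]) blast
  have split: "?I G F \<le> ennreal (c * D) * (?N B (?f F) * ?N ?B' (\<lambda>z. ?g G z * indicator S z)
      + ?N B (\<lambda>z. ?f F z * indicator (- S) z) * ?N ?B' (?g G))"
    if G: "G \<in> borel_measurable borel" and F: "F \<in> borel_measurable borel" and S: "S \<in> sets borel" for G F S
  proof -
    have [measurable]: "?f F \<in> borel_measurable lebesgue" "?g G \<in> borel_measurable lebesgue"
      "(indicator S :: _ \<Rightarrow> ennreal) \<in> borel_measurable lebesgue" "(indicator (- S) :: _ \<Rightarrow> ennreal) \<in> borel_measurable lebesgue"
      using G F S by (auto intro!: profile_measurable inverse_weight_measurable measurable_weight lebesgue_measurable_indicator)
    have "(\<integral>\<^sup>+z. ?f F z * ?g G z \<partial>lborel) = (\<integral>\<^sup>+z. ?f F z * (?g G z * indicator S z) + (?f F z * indicator (- S) z) * ?g G z \<partial>lebesgue)"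
      unfolding nn_integral_completion by (intro nn_integral_cong) (auto simp: indicator_def)
    also have "\<dots> = (\<integral>\<^sup>+z. ?f F z * (?g G z * indicator S z) \<partial>lebesgue) + (\<integral>\<^sup>+z. (?f F z * indicator (- S) z) * ?g G z \<partial>lebesgue)"
      by (rule nn_integral_add) measurable
    also have "\<dots> \<le> ennreal D * ?N B (?f F) * ?N ?B' (\<lambda>z. ?g G z * indicator S z)
        + ennreal D * ?N B (\<lambda>z. ?f F z * indicator (- S) z) * ?N ?B' (?g G)"
      unfolding nn_integral_completion by (intro add_mono D(2)) measurable
    finally have "ennreal c * (\<integral>\<^sup>+z. ?f F z * ?g G z \<partial>lborel) \<le> ennreal c * (ennreal D * (?N B (?f F) * ?N ?B' (\<lambda>z. ?g G z * indicator S z)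
        + ?N B (\<lambda>z. ?f F z * indicator (- S) z) * ?N ?B' (?g G)))"
      by (intro mult_left_mono) (simp_all only: distrib_left mult.assoc zero_le)
    then show ?thesis
      using c(1) unfolding c(2)[OF G F] by (simp only: ennreal_mult'[OF less_imp_le] mult.assoc)
  qed
  have "?N B (\<lambda>z. 0) = 0"
    using B by (intro mixed_qnorm_zero) (auto simp: decomposes_def pos_exponents_def)
  then have "?I G F \<le> ennreal (c * D) * (?N B (?f F) * ?N ?B' (?g G))"
    if "G \<in> borel_measurable borel" "F \<in> borel_measurable borel" for G F
    using split[OF that, of UNIV] by simp
  then show thesis using that[OF mult_pos_pos[OF c(1) D(1)]] split by blast
qed

lemma pairing_finite:
  assumes B: "decomposes B" and p: "\<forall>(V, p)\<in>set B. 1 \<le> p"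
    and G: "G \<in> A_space \<omega> (dual_space B)" and F: "F \<in> A_space (\<lambda>z. 1 / \<omega> z) B"
  shows "(\<integral>\<^sup>+z. ennreal (cmod (G z * cnj (F z))) \<partial>gauss_measure) < top"
proof (rule pairing_bound[OF B p])
  fix C assume "\<And>G F. G \<in> borel_measurable borel \<Longrightarrow> F \<in> borel_measurable borel \<Longrightarrow>
     (\<integral>\<^sup>+z. ennreal (cmod (G z * cnj (F z))) \<partial>gauss_measure)
       \<le> ennreal C * (mixed_qnorm B (profile (\<lambda>z. 1 / \<omega> z) F) * mixed_qnorm (dual_space B) (profile \<omega> G))"
  from this[of G F] have "(\<integral>\<^sup>+z. ennreal (cmod (G z * cnj (F z))) \<partial>gauss_measure)
       \<le> ennreal C * (mixed_qnorm B (profile (\<lambda>z. 1 / \<omega> z) F) * mixed_qnorm (dual_space B) (profile \<omega> G))"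
    using G F by (simp add: A_space_iff A_space_inverse_iff entire_borel_measurable)
  also have "\<dots> < top" using G F by (simp add: A_space_iff A_space_inverse_iff ennreal_mult_less_top)
  finally show ?thesis .
qed

lemma weak_star_if_norm_limit:
  assumes B: "decomposes B" "is_mixed_space B" and p: "\<forall>(V, p)\<in>set B. 1 \<le> p"
    and G: "G \<in> A_space \<omega> (dual_space B)" and P: "\<And>i. P i \<in> A_space \<omega> (dual_space B)"
    and lim: "((\<lambda>i. mixed_qnorm (dual_space B) (profile \<omega> (\<lambda>z. P i z - G z))) \<longlongrightarrow> 0) Fl"
  shows "limitin (weak_star \<omega> B) P G Fl"
proof (rule limitin_weak_star[OF G _ _ B(2)])
  fix F assume F: "F \<in> A_space (\<lambda>z. 1 / \<omega> z) B"
  obtain C where C: "\<And>G F. G \<in> borel_measurable borel \<Longrightarrow> F \<in> borel_measurable borel \<Longrightarrow>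
     (\<integral>\<^sup>+z. ennreal (cmod (G z * cnj (F z))) \<partial>gauss_measure)
       \<le> ennreal C * (mixed_qnorm B (profile (\<lambda>z. 1 / \<omega> z) F) * mixed_qnorm (dual_space B) (profile \<omega> G))"
    by (rule pairing_bound[OF B(1) p]) blast
  have meas[measurable]: "G \<in> borel_measurable borel" "P i \<in> borel_measurable borel" "F \<in> borel_measurable borel" for i
    using G P F by (auto simp: A_space_iff A_space_inverse_iff intro: entire_borel_measurable)
  let ?b = "\<lambda>i. ennreal C * (mixed_qnorm B (profile (\<lambda>z. 1 / \<omega> z) F) * mixed_qnorm (dual_space B) (profile \<omega> (\<lambda>z. P i z - G z)))"
  show "((\<lambda>i. A2_pairing (P i) F) \<longlongrightarrow> A2_pairing G F) Fl"
  proof (rule A2_pairing_tendsto)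
    have le: "(\<integral>\<^sup>+z. ennreal (cmod ((P i z - G z) * cnj (F z))) \<partial>gauss_measure) \<le> ?b i" for i
      by (rule C) measurable
    have "(?b \<longlongrightarrow> ennreal C * (mixed_qnorm B (profile (\<lambda>z. 1 / \<omega> z) F) * 0)) Fl"
      using F by (intro ennreal_tendsto_cmult lim) (auto simp: A_space_inverse_iff)
    then have "(?b \<longlongrightarrow> 0) Fl" by (simp only: mult_zero_right)
    from this le show "((\<lambda>i. \<integral>\<^sup>+z. ennreal (cmod ((P i z - G z) * cnj (F z))) \<partial>gauss_measure) \<longlongrightarrow> 0) Fl"
      by (rule ennreal_tendsto_0_le)
  qed (use pairing_finite[OF B(1) p _ F] G P meas in auto)
qed (use P in simp)

text \<open>
  The difference \<open>G\<^sub>r - G\<close> stays bounded in the dual space but need not become small there, since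
  exponents of the dual space may be infinite.  It becomes small on each ball, and the test function
  \<open>F\<close>, whose exponents are finite, is small outside a large ball.
\<close>

lemma weak_star_dilation:
  assumes B: "decomposes B" "is_mixed_space B" and p: "\<forall>(V, p)\<in>set B. 1 \<le> p \<and> p \<noteq> top"
    and ds: "dilated_suitable \<omega>" and G: "G \<in> A_space \<omega> (dual_space B)"
  shows "limitin (weak_star \<omega> B) (\<lambda>r z. G (r *\<^sub>R z)) G (at_left 1)"
proof (rule limitin_weak_star[OF G _ _ B(2)])
  note B' = decomposes_dual_space[OF B(1)]
  have p1: "\<forall>(V, p)\<in>set B. 1 \<le> p" and pt: "\<forall>(V, p)\<in>set B. p \<noteq> top" using p by auto
  show mem: "eventually (\<lambda>r. (\<lambda>z. G (r *\<^sub>R z)) \<in> A_space \<omega> (dual_space B)) (at_left 1)"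
    by (rule dilation_mem_A_space[OF B' ds G])
  fix F assume F: "F \<in> A_space (\<lambda>z. 1 / \<omega> z) B"
  have ent: "entire G" "entire F" and fin: "mixed_qnorm B (profile (\<lambda>z. 1 / \<omega> z) F) < top"
      "mixed_qnorm (dual_space B) (profile \<omega> G) < top"
    using G F by (auto simp: A_space_iff A_space_inverse_iff)
  obtain C where C: "0 < C" "\<And>G F (S :: (complex^'d) set). G \<in> borel_measurable borel \<Longrightarrow> F \<in> borel_measurable borel \<Longrightarrow> S \<in> sets borel \<Longrightarrow>
     (\<integral>\<^sup>+z. ennreal (cmod (G z * cnj (F z))) \<partial>gauss_measure)
       \<le> ennreal C * (mixed_qnorm B (profile (\<lambda>z. 1 / \<omega> z) F) * mixed_qnorm (dual_space B) (\<lambda>z. profile \<omega> G z * indicator S z)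
          + mixed_qnorm B (\<lambda>z. profile (\<lambda>z. 1 / \<omega> z) F z * indicator (- S) z) * mixed_qnorm (dual_space B) (profile \<omega> G))"
    by (rule pairing_bound[OF B(1) p1]) blast
  obtain K \<theta> where K: "0 < K" "0 < \<theta>" "\<theta> \<le> 1 / 2" "\<And>F r R. entire F \<Longrightarrow> 1 - \<theta> < r \<Longrightarrow> r < 1 \<Longrightarrow>
     mixed_qnorm (dual_space B) (\<lambda>z. profile \<omega> (\<lambda>z. F (r *\<^sub>R z) - F z) z * indicator {z. 2 * R < norm z} z)
       \<le> ennreal K * mixed_qnorm (dual_space B) (\<lambda>z. profile \<omega> F z * indicator {z. R < norm z} z)"
    by (rule dilation_tail_bound[OF B' ds]) blast
  obtain f g where fg: "mixed_qnorm B (profile (\<lambda>z. 1 / \<omega> z) F) = ennreal f" "0 \<le> f"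
      "mixed_qnorm (dual_space B) (profile \<omega> G) = ennreal g" "0 \<le> g"
    using fin by (cases "mixed_qnorm B (profile (\<lambda>z. 1 / \<omega> z) F)"; cases "mixed_qnorm (dual_space B) (profile \<omega> G)") auto
  have meas[measurable]: "G \<in> borel_measurable borel" "(\<lambda>z. G (r *\<^sub>R z)) \<in> borel_measurable borel" "F \<in> borel_measurable borel" for r
    using ent entire_dilation[OF ent(1)] by (auto intro: entire_borel_measurable)
  show "((\<lambda>r. A2_pairing (\<lambda>z. G (r *\<^sub>R z)) F) \<longlongrightarrow> A2_pairing G F) (at_left 1)"
  proof (rule A2_pairing_tendsto)
    show "eventually (\<lambda>r. (\<integral>\<^sup>+z. ennreal (cmod (G (r *\<^sub>R z) * cnj (F z))) \<partial>gauss_measure) < top) (at_left 1)"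
      using mem by eventually_elim (rule pairing_finite[OF B(1) p1 _ F])
    show "((\<lambda>r. \<integral>\<^sup>+z. ennreal (cmod ((G (r *\<^sub>R z) - G z) * cnj (F z))) \<partial>gauss_measure) \<longlongrightarrow> 0) (at_left 1)"
    proof (rule order_tendstoI)
      fix e :: ennreal assume "0 < e"
      then obtain x where x: "0 < x" "ennreal x \<le> e" by (rule ennreal_below_pos)
      define \<alpha> where "\<alpha> = x / (4 * C * (f + 1))"
      define \<beta> where "\<beta> = x / (4 * C * (K * g + 1))"
      have \<alpha>: "0 < \<alpha>" and \<beta>: "0 < \<beta>" using x C(1) fg K(1) by (auto simp: \<alpha>_def \<beta>_def intro!: divide_pos_pos mult_pos_pos add_nonneg_pos)
      have "(\<lambda>n. mixed_qnorm B (\<lambda>z. profile (\<lambda>z. 1 / \<omega> z) F z * indicator {z. real n < norm z} z)) \<longlonglongrightarrow> 0"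
        by (intro lebesgue_mixed_qnorm_tail[OF B(1) pt _ fin(1)] profile_measurable inverse_weight_measurable meas)
      then have "eventually (\<lambda>n. mixed_qnorm B (\<lambda>z. profile (\<lambda>z. 1 / \<omega> z) F z * indicator {z. real n < norm z} z) < ennreal \<beta>) sequentially"
        using \<beta> by (intro order_tendstoD(2)) auto
      then obtain n where n: "mixed_qnorm B (\<lambda>z. profile (\<lambda>z. 1 / \<omega> z) F z * indicator {z. real n < norm z} z) < ennreal \<beta>"
        by (auto simp: eventually_sequentially)
      have "eventually (\<lambda>r. mixed_qnorm (dual_space B) (\<lambda>z. profile \<omega> (\<lambda>z. G (r *\<^sub>R z) - G z) z * indicator {z. norm z \<le> real n} z) < ennreal \<alpha>) (at_left 1)"
        using \<alpha> by (intro order_tendstoD(2)[OF dilation_converges_on_ball[OF B' ent(1)]]) auto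
      moreover have "eventually (\<lambda>r. 1 - \<theta> < r \<and> r < 1) (at_left 1)"
        using K by (intro eventually_at_left_one) auto
      ultimately show "eventually (\<lambda>r. (\<integral>\<^sup>+z. ennreal (cmod ((G (r *\<^sub>R z) - G z) * cnj (F z))) \<partial>gauss_measure) < e) (at_left 1)"
      proof eventually_elim
        case (elim r)
        let ?D = "profile \<omega> (\<lambda>z. G (r *\<^sub>R z) - G z)"
        have Dm: "?D \<in> borel_measurable lebesgue" by (rule profile_dilation_diff_measurable[OF ent(1)])
        \<comment> \<open>A negative radius turns the tail bound into a bound of the whole norm.\<close>
        have univ: "{z :: complex^'d. 2 * (-1) < norm z} = UNIV" "{z :: complex^'d. -1 < norm z} = UNIV"
          using norm_ge_zero by (auto intro: less_le_trans[of _ 0])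
        have D: "mixed_qnorm (dual_space B) ?D \<le> ennreal (K * g)"
          using K(4)[OF ent(1), of r "-1"] elim K(1) fg unfolding univ by (simp add: ennreal_mult')
        have compl: "- {z :: complex^'d. norm z \<le> real n} = {z. real n < norm z}" by auto
        have "(\<integral>\<^sup>+z. ennreal (cmod ((G (r *\<^sub>R z) - G z) * cnj (F z))) \<partial>gauss_measure)
            \<le> ennreal C * (ennreal f * mixed_qnorm (dual_space B) (\<lambda>z. ?D z * indicator {z. norm z \<le> real n} z)
               + mixed_qnorm B (\<lambda>z. profile (\<lambda>z. 1 / \<omega> z) F z * indicator {z. real n < norm z} z) * mixed_qnorm (dual_space B) ?D)"
          using C(2)[of "\<lambda>z. G (r *\<^sub>R z) - G z" F "{z. norm z \<le> real n}"] by (simp add: compl fg)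
        also have "\<dots> \<le> ennreal C * (ennreal f * ennreal \<alpha> + ennreal \<beta> * ennreal (K * g))"
          using elim(1) n D by (intro mult_left_mono add_mono mult_mono) auto
        also have "\<dots> = ennreal (C * (f * \<alpha> + \<beta> * (K * g)))"
          using C(1) fg \<alpha> \<beta> K(1) by (simp add: ennreal_mult'[symmetric] ennreal_plus[symmetric] del: ennreal_plus)
        also have "\<dots> < ennreal x"
        proof -
          have "C * (f * \<alpha>) = x / 4 * (f / (f + 1))" using C(1) fg by (simp add: \<alpha>_def)
          also have "\<dots> \<le> x / 4 * 1" using x fg by (intro mult_left_mono) auto
          finally have 1: "C * (f * \<alpha>) \<le> x / 4" by simp
          have kg: "0 \<le> K * g" using K(1) fg by simp
          have "C * (\<beta> * (K * g)) = x / 4 * (K * g / (K * g + 1))" using C(1) by (simp add: \<beta>_def)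
          also have "\<dots> \<le> x / 4 * 1" using x kg by (intro mult_left_mono) auto
          finally have 2: "C * (\<beta> * (K * g)) \<le> x / 4" by simp
          have "C * (f * \<alpha> + \<beta> * (K * g)) < x" using 1 2 x unfolding distrib_left by linarith
          then show ?thesis using x(1) by (intro ennreal_lessI)
        qed
        finally show ?case using x(2) by (rule less_le_trans)
      qed
    qed auto
  qed (use pairing_finite[OF B(1) p1 G F] meas in auto)
qed

lemma polynomials_dense:
  assumes B: "decomposes B" and p: "\<forall>(V, p)\<in>set B. p \<noteq> top" and ds: "dilated_suitable \<omega>"
    and F: "F \<in> A_space \<omega> B" and e: "0 < e"
  shows "\<exists>P\<in>polynomials. A_qnorm \<omega> B (\<lambda>z. F z - P z) < e"
proof -
  have ent: "entire F" using F by (simp add: A_space_iff)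
  obtain x where x: "0 < x" "ennreal x \<le> e" using e by (rule ennreal_below_pos)
  obtain K where K: "0 < K" "\<And>f g. f \<in> borel_measurable lebesgue \<Longrightarrow> g \<in> borel_measurable lebesgue \<Longrightarrow>
     mixed_qnorm B (\<lambda>z. f z + g z) \<le> ennreal K * (mixed_qnorm B f + mixed_qnorm B g)"
    by (rule lebesgue_mixed_qnorm_triangle[OF B]) blast
  define y where "y = x / (4 * K)"
  have y: "0 < y" using x K by (simp add: y_def)
  have "eventually (\<lambda>r. mixed_qnorm B (profile \<omega> (\<lambda>z. F (r *\<^sub>R z) - F z)) < ennreal y) (at_left 1)"
    using y by (intro order_tendstoD(2)[OF dilation_converges[OF B p ds F]]) auto
  moreover have "eventually (\<lambda>r. 0 < r \<and> r < 1) (at_left (1::real))" by (rule eventually_at_left_one) simp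
  ultimately have "eventually (\<lambda>r. mixed_qnorm B (profile \<omega> (\<lambda>z. F (r *\<^sub>R z) - F z)) < ennreal y \<and> 0 < r \<and> r < 1) (at_left (1::real))"
    by (rule eventually_conj)
  then obtain r where r: "mixed_qnorm B (profile \<omega> (\<lambda>z. F (r *\<^sub>R z) - F z)) < ennreal y" "0 < r" "r < 1"
    using eventually_happens'[OF trivial_limit_at_left_real] by blast
  obtain P where P: "P \<in> polynomials" "mixed_qnorm B (profile \<omega> (\<lambda>z. F (r *\<^sub>R z) - P z)) < ennreal y"
    using dilation_polynomial_dense[OF B F r(2,3), of "ennreal y"] y by auto
  have entP: "entire P" using polynomials_entire_poly_growth[OF P(1)] by simp
  have m1: "profile \<omega> (\<lambda>z. F (r *\<^sub>R z) - F z) \<in> borel_measurable lebesgue"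
    by (rule profile_dilation_diff_measurable[OF ent])
  have m2: "profile \<omega> (\<lambda>z. F (r *\<^sub>R z) - P z) \<in> borel_measurable lebesgue"
    by (intro profile_measurable measurable_weight borel_measurable_diff entire_borel_measurable entire_dilation ent entP)
  have m3: "profile \<omega> (\<lambda>z. F z - P z) \<in> borel_measurable lebesgue"
    by (intro profile_measurable measurable_weight borel_measurable_diff entire_borel_measurable ent entP)
  have "profile \<omega> (\<lambda>z. F z - P z) z \<le> profile \<omega> (\<lambda>z. F (r *\<^sub>R z) - P z) z + profile \<omega> (\<lambda>z. F (r *\<^sub>R z) - F z) z" for z
    using profile_diff_le[of "\<lambda>z. F (r *\<^sub>R z) - P z" "\<lambda>z. F (r *\<^sub>R z) - F z" z] by (simp add: profile_def)
  then have "mixed_qnorm B (profile \<omega> (\<lambda>z. F z - P z))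
      \<le> mixed_qnorm B (\<lambda>z. profile \<omega> (\<lambda>z. F (r *\<^sub>R z) - P z) z + profile \<omega> (\<lambda>z. F (r *\<^sub>R z) - F z) z)"
    using m1 m2 by (intro lebesgue_mixed_qnorm_mono[OF B m3]) auto
  also have "\<dots> \<le> ennreal K * (ennreal y + ennreal y)"
    using r(1) P(2) by (intro order_trans[OF K(2)[OF m2 m1]] mult_left_mono add_mono) auto
  also have "\<dots> = ennreal (x / 2)"
    using K(1) y by (simp add: ennreal_plus[symmetric] ennreal_mult'[symmetric] y_def del: ennreal_plus)
  also have "\<dots> < ennreal x" using x by (simp add: ennreal_less_iff)
  finally have "A_qnorm \<omega> B (\<lambda>z. F z - P z) < e" using x(2) unfolding A_qnorm_eq_profile[OF pos] by (rule less_le_trans)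
  then show ?thesis using P(1) by blast
qed

text \<open>
  An open set containing \<open>G\<close> contains some dilation \<open>G\<^sub>r\<close>; as \<open>G\<^sub>r\<close> is a norm limit of polynomials also
  when exponents are infinite, the open set contains a polynomial.
\<close>

lemma polynomials_weak_star_dense:
  assumes B: "decomposes B" and mixed: "is_mixed_space B" and p: "\<forall>(V, p)\<in>set B. 1 \<le> p \<and> p \<noteq> top"
    and ds: "dilated_suitable \<omega>"
  shows "weak_star \<omega> B closure_of polynomials = A_space \<omega> (dual_space B)"
proof
  note B' = decomposes_dual_space[OF B]
  have top: "topspace (weak_star \<omega> B) = A_space \<omega> (dual_space B)" by (rule topspace_weak_star[OF mixed])
  show "weak_star \<omega> B closure_of polynomials \<subseteq> A_space \<omega> (dual_space B)"
    using closure_of_subset_topspace[of "weak_star \<omega> B" polynomials] top by simp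
  show "A_space \<omega> (dual_space B) \<subseteq> weak_star \<omega> B closure_of polynomials"
  proof
    fix G assume G: "G \<in> A_space \<omega> (dual_space B)"
    have "\<exists>P\<in>polynomials. P \<in> T" if T: "openin (weak_star \<omega> B) T" "G \<in> T" for T
    proof -
      have "eventually (\<lambda>r. (\<lambda>z. G (r *\<^sub>R z)) \<in> T) (at_left 1)"
        using weak_star_dilation[OF B mixed p ds G] T by (auto simp: limitin_def)
      moreover have "eventually (\<lambda>r. (\<lambda>z. G (r *\<^sub>R z)) \<in> A_space \<omega> (dual_space B)) (at_left 1)"
        by (rule dilation_mem_A_space[OF B' ds G])
      moreover have "eventually (\<lambda>r. 0 < r \<and> r < 1) (at_left (1::real))" by (rule eventually_at_left_one) simp
      ultimately have "eventually (\<lambda>r. (\<lambda>z. G (r *\<^sub>R z)) \<in> T \<and> (\<lambda>z. G (r *\<^sub>R z)) \<in> A_space \<omega> (dual_space B) \<and> 0 < r \<and> r < 1) (at_left (1::real))"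
        by eventually_elim simp
      then obtain r where r: "(\<lambda>z. G (r *\<^sub>R z)) \<in> T" "(\<lambda>z. G (r *\<^sub>R z)) \<in> A_space \<omega> (dual_space B)" "0 < r" "r < 1"
        using eventually_happens'[OF trivial_limit_at_left_real] by blast
      have "\<forall>i. \<exists>P\<in>polynomials. mixed_qnorm (dual_space B) (profile \<omega> (\<lambda>z. G (r *\<^sub>R z) - P z)) < ennreal (1 / real (Suc i))"
        by (intro allI dilation_polynomial_dense[OF B' G r(3,4)]) simp
      then obtain P where P: "\<And>i. P i \<in> polynomials"
          "\<And>i. mixed_qnorm (dual_space B) (profile \<omega> (\<lambda>z. G (r *\<^sub>R z) - P i z)) < ennreal (1 / real (Suc i))"
        by metis
      have "limitin (weak_star \<omega> B) P (\<lambda>z. G (r *\<^sub>R z)) sequentially"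
      proof (rule weak_star_if_norm_limit[OF B mixed _ r(2)])
        show "\<forall>(V, p)\<in>set B. 1 \<le> p" using p by auto
        show "P i \<in> A_space \<omega> (dual_space B)" for i using polynomials_subset_A_space[OF B'] P(1) by blast
        have flip: "profile \<omega> (\<lambda>z. P i z - G (r *\<^sub>R z)) = profile \<omega> (\<lambda>z. G (r *\<^sub>R z) - P i z)" for i
          by (simp add: profile_def fun_eq_iff norm_minus_commute)
        have "(\<lambda>i. ennreal (1 / real (Suc i))) \<longlonglongrightarrow> ennreal 0"
          by (intro tendsto_ennrealI LIMSEQ_Suc[OF lim_1_over_n])
        then show "(\<lambda>i. mixed_qnorm (dual_space B) (profile \<omega> (\<lambda>z. P i z - G (r *\<^sub>R z)))) \<longlonglongrightarrow> 0"
          unfolding flip ennreal_0 by (rule ennreal_tendsto_0_le) (rule less_imp_le[OF P(2)])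
      qed
      then have "eventually (\<lambda>i. P i \<in> T) sequentially" using T(1) r(1) by (auto simp: limitin_def)
      then show ?thesis using P(1) by (auto simp: eventually_sequentially)
    qed
    then show "G \<in> weak_star \<omega> B closure_of polynomials"
      using G top by (auto simp: in_closure_of)
  qed
qed

end

lemma gaussian_weight_if_PQ0:
  assumes "\<omega> \<in> PQ0"
  shows "gaussian_weight \<omega>"
proof
  show "0 < \<omega> z" for z using assms by (auto simp: PQ0_def weight_def)
  show "\<omega> \<in> borel_measurable lebesgue" using assms by (auto simp: PQ0_def weight_def)
  show "\<exists>C>0. \<forall>z. inverse C * exp (- a * (norm z)\<^sup>2) \<le> \<omega> z \<and> \<omega> z \<le> C * exp (a * (norm z)\<^sup>2)" if "0 < a" for a
    using assms that unfolding PQ0_def mem_Collect_eq by blast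
qed

theorem theorem5p8:
  fixes \<omega> :: "complex^'d \<Rightarrow> real" and B :: "(complex^'d) mixed_space"
  assumes "\<omega> \<in> PQ0" and "dilated_suitable \<omega>"
    and "is_mixed_space B" and "nu2 B < \<infinity>"
  shows
    "(polynomials \<subseteq> A_space \<omega> B \<and>
      (\<forall>F\<in>A_space \<omega> B. \<forall>e>0. \<exists>P\<in>polynomials. A_qnorm \<omega> B (\<lambda>z. F z - P z) < e)) \<and>
     (1 \<le> nu1 B \<longrightarrow>
        polynomials \<subseteq> A_space \<omega> (dual_space B) \<and>
        weak_star \<omega> B closure_of polynomials = A_space \<omega> (dual_space B)) \<and>
     (\<forall>F\<in>A_space \<omega> B.
        ((\<lambda>r. A_qnorm \<omega> B (\<lambda>z. F (r *\<^sub>R z) - F z)) \<longlongrightarrow> 0) (at_left 1)) \<and>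
     (1 \<le> nu1 B \<longrightarrow>
        (\<forall>G\<in>A_space \<omega> (dual_space B).
           limitin (weak_star \<omega> B) (\<lambda>r z. G (r *\<^sub>R z)) G (at_left 1)))"
proof -
  interpret gaussian_weight \<omega> by (rule gaussian_weight_if_PQ0[OF assms(1)])
  note ds = assms(2) and mixed = assms(3)
  have B: "decomposes B" by (rule decomposes_if_mixed_space[OF mixed])
  note B' = decomposes_dual_space[OF B]
  have le_nu2: "p \<le> nu2 B" and nu1_le: "nu1 B \<le> p" if "(V, p) \<in> set B" for V p
    using that by (force simp: nu1_def nu2_def intro!: Max_ge Min_le)+
  have p: "\<forall>(V, p)\<in>set B. p \<noteq> top"
  proof safe
    fix V assume "(V, top) \<in> set B"
    from le_nu2[OF this] assms(4) show False by (simp add: top_unique)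
  qed
  have p': "\<forall>(V, p)\<in>set B. 1 \<le> p \<and> p \<noteq> top" if "1 \<le> nu1 B"
    using that nu1_le p by (auto intro: order_trans)
  have conv: "((\<lambda>r. A_qnorm \<omega> B (\<lambda>z. F (r *\<^sub>R z) - F z)) \<longlongrightarrow> 0) (at_left 1)" if "F \<in> A_space \<omega> B" for F
    unfolding A_qnorm_eq_profile[OF pos] by (rule dilation_converges[OF B p ds that])
  show ?thesis
    by (intro conjI impI ballI allI polynomials_subset_A_space B B' polynomials_dense[OF B p ds] conv
        polynomials_weak_star_dense[OF B mixed p' ds] weak_star_dilation[OF B mixed p' ds])
qed

end
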